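(* Let $c$ be a sufficiently large numerical constant. There is a constant $C>0$ (numerical, depending only on $c$) such that the following holds for every integer $n\ge 1$ and every $\rho_n\in(0,1]$ with $\rho_n\ge 1/n$. Let $\lambda=c\sqrt{\rho_nn}$, and for a graphon $W_0$ write $f_0'=(\rho_nW_0)\wedge1$ and $W_0'=\rho_n^{-1}[(\rho_nW_0)\wedge1]$. (1) Let $W_0\in\mathcal W_1^+$ with $\|W_0\|_1=1$ and let $0<\mu\le1$. Then for any positive integer $k\le\mu n$, $$\mathbb E_{W_0}\big[\delta_\square(\widetilde f_{\boldsymbol A},f_0')\big]\le2\rho_n\inf_{W\in\mathcal W_1^+[k,\mu]}\delta_1(W,W_0')+C\left[\rho_n\sqrt{\frac{k}{\mu n}}+\sqrt{\frac{\rho_n}{n}}\right]$$ and $$\mathbb E_{W_0}\big[\delta_\square(\widetilde f_{\widetilde{\boldsymbol\Theta}_\lambda},f_0')\big]\le2\rho_n\inf_{W\in\mathcal W_1^+[k,\mu]}\delta_1(W,W_0')+C\left[\rho_n\sqrt{\frac{k}{\mu n}}+\sqrt{\frac{\rho_n}{n}}\right].$$ (2) Let $W_0\in\mathcal W_2^+$ with $\|W_0\|_1=1$. Then for any positive integer $k\le n$, $$\mathbb E_{W_0}\big[\delta_\square(\widetilde f_{\boldsymbol A},f_0')\big]\le2\rho_n\inf_{W\in\mathcal W_2^+[k]}\delta_2(W,W_0')+C\left[\rho_n\|W_0\|_2\sqrt{\frac kn}+\sqrt{\frac{\rho_n}{n}}\right]$$ and $$\mathbb E_{W_0}\big[\delta_\square(\widetilde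 f_{\widetilde{\boldsymbol\Theta}_\lambda},f_0')\big]\le2\rho_n\inf_{W\in\mathcal W_2^+[k]}\delta_2(W,W_0')+C\left[\rho_n\|W_0\|_2\sqrt{\frac kn}+\sqrt{\frac{\rho_n}{n}}\right].$$
   Context: $[m]=\{1,\dots,m\}$; $a\wedge b=\min(a,b)$; $\lambda(\cdot)$ applied to a set denotes Lebesgue measure (while $\lambda=c\sqrt{\rho_nn}$ is the threshold). For $p\ge1$, $\mathcal W_p^+$ is the set of symmetric measurable $W:[0,1]^2\to[0,\infty)$ with $\int|W|^p<\infty$ ($L_p$ graphons). $\mathcal W_p^+[k]$ is the set of $W\in\mathcal W_p^+$ with $W(x,y)=\boldsymbol Q_{\phi(x),\phi(y)}$ for some symmetric $\boldsymbol Q\in[0,\infty)^{k\times k}$ and some $\phi:[0,1]\to[k]$; $\mathcal W_p^+[k,\mu]$ is the subset of those $W$ for which moreover $\lambda(\phi^{-1}(a))\ge\mu/k$ for all $a\in[k]$. Model: $\xi_1,\dots,\xi_n$ are i.i.d. uniform on $[0,1]$; $\boldsymbol\Theta_0$ is the symmetric $n\times n$ matrix with $\boldsymbol\Theta_{ij}=[\rho_nW_0(\xi_i,\xi_j)]\wedge1$ for $i\ne j$ and $\boldsymbol\Theta_{ii}=0$; conditionally on $\boldsymbol\Theta_0$, $\boldsymbol A$ is a symmetric $\{0,1\}$-valued matrix with zero diagonal whose entries $\boldsymbol A_{ij}$, $i<j$, are independent Bernoulli with parameters $\boldsymbol\Theta_{ij}$. $\mathbb E_{W_0}$ is the expectation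 in this model. Singular value hard thresholding: with the singular value decomposition $\boldsymbol A=\sum_j\sigma_j(\boldsymbol A)u_j(\boldsymbol A)v_j(\boldsymbol A)^T$ (over $j\le\mathrm{rank}(\boldsymbol A)$), $\widetilde{\boldsymbol\Theta}_\lambda=\sum_{j:\sigma_j(\boldsymbol A)\ge\lambda}\sigma_j(\boldsymbol A)u_j(\boldsymbol A)v_j(\boldsymbol A)^T$. For a symmetric $n\times n$ matrix $\boldsymbol B$, $\widetilde f_{\boldsymbol B}(x,y)=\boldsymbol B_{\lceil nx\rceil,\lceil ny\rceil}$ for $x,y\in(0,1]$. For integrable symmetric $W$ on $[0,1]^2$: $\|W\|_\square=\sup_{S,T\subset[0,1]}|\int_{S\times T}W|$ (measurable $S,T$), $\|W\|_1=\int|W|$, $\|W\|_2=(\int W^2)^{1/2}$. For $N\in\{\square,1,2\}$, $\delta_N(W_1,W_2)=\inf_\tau\|W_1-W_2^\tau\|_N$ over measure-preserving bijections $\tau$ of $[0,1]$, with $W^\tau(x,y)=W(\tau(x),\tau(y))$. *)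

theory Defs
  imports
    "HOL-Probability.Probability"
    "Jordan_Normal_Form.Matrix"
begin

text \<open>Matrices and labels are indexed from 0, so \<open>{..<n}\<close> plays the role of \<open>[n]\<close>.\<close>

subsection \<open>Graphons\<close>

text \<open>Measurability always refers to the Borel sets of the unit interval and the unit square.\<close>

definition I01 :: "real measure" where
  "I01 = restrict_space lborel {0..1}"

definition Lp_graphons :: "real \<Rightarrow> (real \<Rightarrow> real \<Rightarrow> real) set" where
  "Lp_graphons p = {W.
     case_prod W \<in> borel_measurable (I01 \<Otimes>\<^sub>M I01) \<and>
     (\<forall>x\<in>{0..1}. \<forall>y\<in>{0..1}. W x y = W y x \<and> 0 \<le> W x y) \<and>
     integrable (I01 \<Otimes>\<^sub>M I01) (\<lambda>(x, y). \<bar>W x y\<bar> powr p)}"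

definition block_representation ::
    "nat \<Rightarrow> real mat \<Rightarrow> (real \<Rightarrow> nat) \<Rightarrow> (real \<Rightarrow> real \<Rightarrow> real) \<Rightarrow> bool" where
  "block_representation k Q \<phi> W \<longleftrightarrow>
     Q \<in> carrier_mat k k \<and> transpose_mat Q = Q \<and>
     (\<forall>a<k. \<forall>b<k. 0 \<le> Q $$ (a, b)) \<and>
     \<phi> \<in> {0..1} \<rightarrow> {..<k} \<and>
     (\<forall>x\<in>{0..1}. \<forall>y\<in>{0..1}. W x y = Q $$ (\<phi> x, \<phi> y))"

definition step_graphons :: "real \<Rightarrow> nat \<Rightarrow> (real \<Rightarrow> real \<Rightarrow> real) set" where
  "step_graphons p k = {W \<in> Lp_graphons p. \<exists>Q \<phi>. block_representation k Q \<phi> W}"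

definition balanced_step_graphons ::
    "real \<Rightarrow> nat \<Rightarrow> real \<Rightarrow> (real \<Rightarrow> real \<Rightarrow> real) set" where
  "balanced_step_graphons p k \<mu> = {W \<in> Lp_graphons p. \<exists>Q \<phi>. block_representation k Q \<phi> W \<and>
     (\<forall>a<k. \<phi> -` {a} \<inter> {0..1} \<in> sets I01 \<and>
            \<mu> / real k \<le> measure I01 (\<phi> -` {a} \<inter> {0..1}))}"

subsection \<open>Norms and distances\<close>

definition cut_norm :: "(real \<Rightarrow> real \<Rightarrow> real) \<Rightarrow> real" where
  "cut_norm W = Sup {\<bar>LINT z:S \<times> T|(I01 \<Otimes>\<^sub>M I01). case_prod W z\<bar> |S T.
     S \<in> sets I01 \<and> T \<in> sets I01}"

definition L1_norm :: "(real \<Rightarrow> real \<Rightarrow> real) \<Rightarrow> real" where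
  "L1_norm W = (LINT (x, y)|(I01 \<Otimes>\<^sub>M I01). \<bar>W x y\<bar>)"

definition L2_norm :: "(real \<Rightarrow> real \<Rightarrow> real) \<Rightarrow> real" where
  "L2_norm W = sqrt (LINT (x, y)|(I01 \<Otimes>\<^sub>M I01). (W x y)\<^sup>2)"

definition mp_bijections :: "(real \<Rightarrow> real) set" where
  "mp_bijections = {\<tau>. bij_betw \<tau> {0..1} {0..1} \<and> \<tau> \<in> measurable I01 I01 \<and>
     distr I01 I01 \<tau> = I01}"

definition graphon_dist :: "((real \<Rightarrow> real \<Rightarrow> real) \<Rightarrow> real) \<Rightarrow>
    (real \<Rightarrow> real \<Rightarrow> real) \<Rightarrow> (real \<Rightarrow> real \<Rightarrow> real) \<Rightarrow> real" where
  "graphon_dist N W1 W2 = (INF \<tau>\<in>mp_bijections. N (\<lambda>x y. W1 x y - W2 (\<tau> x) (\<tau> y)))"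

abbreviation "cut_dist \<equiv> graphon_dist cut_norm"
abbreviation "L1_dist \<equiv> graphon_dist L1_norm"
abbreviation "L2_dist \<equiv> graphon_dist L2_norm"

text \<open>The subtraction of 1 accounts for indexing from 0. On the null set \<open>x = 0\<close> or \<open>y = 0\<close>
  truncation selects index 0, which is still in range.\<close>

definition empirical_graphon :: "nat \<Rightarrow> real mat \<Rightarrow> real \<Rightarrow> real \<Rightarrow> real" where
  "empirical_graphon n B x y =
     B $$ (nat \<lceil>real n * x\<rceil> - 1, nat \<lceil>real n * y\<rceil> - 1)"

subsection \<open>The sparse graphon model\<close>

definition Theta0 :: "nat \<Rightarrow> real \<Rightarrow> (real \<Rightarrow> real \<Rightarrow> real) \<Rightarrow> (nat \<Rightarrow> real) \<Rightarrow> real mat" where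
  "Theta0 n \<rho> W \<xi> = mat n n (\<lambda>(i, j). if i = j then 0 else min (\<rho> * W (\<xi> i) (\<xi> j)) 1)"

definition adjacency_matrix :: "nat \<Rightarrow> (nat \<times> nat \<Rightarrow> bool) \<Rightarrow> real mat" where
  "adjacency_matrix n e =
     mat n n (\<lambda>(i, j). if i \<noteq> j \<and> e (min i j, max i j) then 1 else 0)"

definition adjacency_pmf :: "nat \<Rightarrow> real mat \<Rightarrow> real mat pmf" where
  "adjacency_pmf n \<Theta> = map_pmf (adjacency_matrix n)
     (Pi_pmf {(i, j). i < j \<and> j < n} False (\<lambda>ij. bernoulli_pmf (\<Theta> $$ ij)))"

text \<open>The law of \<open>A\<close>: draw \<open>\<xi>\<close> with independent uniform coordinates, then \<open>A\<close> given
  \<open>Theta0 n \<rho> W \<xi>\<close>.\<close>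

definition graph_law :: "nat \<Rightarrow> real \<Rightarrow> (real \<Rightarrow> real \<Rightarrow> real) \<Rightarrow> real mat measure" where
  "graph_law n \<rho> W =
     (\<Pi>\<^sub>M i\<in>{..<n}. I01) \<bind> (\<lambda>\<xi>. measure_pmf (adjacency_pmf n (Theta0 n \<rho> W \<xi>)))"

lemma prob_space_I01: "prob_space I01"
  unfolding I01_def by (rule prob_spaceI) (simp add: space_restrict_space emeasure_restrict_space)

lemma Theta0_bounds:
  assumes "W \<in> Lp_graphons p" "0 < \<rho>" "\<xi> \<in> space (\<Pi>\<^sub>M i\<in>{..<n}. I01)" "i < n" "j < n"
  shows "Theta0 n \<rho> W \<xi> $$ (i, j) \<in> {0..1}"
proof -
  have "\<xi> i \<in> {0..1}" "\<xi> j \<in> {0..1}"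
    using assms by (auto simp: space_PiM PiE_def Pi_def I01_def space_restrict_space)
  then have "0 \<le> W (\<xi> i) (\<xi> j)" using assms(1) unfolding Lp_graphons_def by blast
  then show ?thesis using assms by (simp add: Theta0_def)
qed

lemma adjacency_kernel_measurable:
  assumes W: "W \<in> Lp_graphons p" and "0 < \<rho>"
  shows "(\<lambda>\<xi>. measure_pmf (adjacency_pmf n (Theta0 n \<rho> W \<xi>)))
           \<in> measurable (\<Pi>\<^sub>M i\<in>{..<n}. I01) (subprob_algebra (count_space UNIV))"
proof (rule measurable_subprob_algebra)
  fix X :: "real mat set"
  let ?P = "\<Pi>\<^sub>M i\<in>{..<n}. I01"
  let ?E = "{(i, j). i < j \<and> j < n}"
  have fE: "finite ?E" by (rule finite_subset[of _ "{..<n}\<times>{..<n}"]) auto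
  let ?D = "PiE_dflt ?E False (\<lambda>_. UNIV)"
  have fD: "finite ?D" using fE by (intro finite_PiE_dflt) auto
  let ?Y = "adjacency_matrix n -` X \<inter> ?D"
  have [measurable]: "case_prod W \<in> borel_measurable (I01 \<Otimes>\<^sub>M I01)"
    using W by (simp add: Lp_graphons_def)
  have meas: "(\<lambda>\<xi>. Theta0 n \<rho> W \<xi> $$ ij) \<in> borel_measurable ?P" if asm: "ij \<in> ?E" for ij
  proof -
    obtain i j where ij: "ij = (i, j)" "i < j" "j < n" using asm by auto
    have "(\<lambda>\<xi>. case_prod W (\<xi> i, \<xi> j)) \<in> borel_measurable ?P"
      by (rule measurable_compose[OF measurable_Pair[OF measurable_component_singleton
            measurable_component_singleton]]) (use ij in auto)
    then show ?thesis using ij by (simp add: Theta0_def)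
  qed
  have eq: "emeasure (measure_pmf (adjacency_pmf n (Theta0 n \<rho> W \<xi>))) X =
     ennreal (\<Sum>f\<in>?Y. \<Prod>ij\<in>?E. if f ij then Theta0 n \<rho> W \<xi> $$ ij else 1 - Theta0 n \<rho> W \<xi> $$ ij)"
    if "\<xi> \<in> space ?P" for \<xi>
  proof -
    let ?q = "Pi_pmf ?E False (\<lambda>ij. bernoulli_pmf (Theta0 n \<rho> W \<xi> $$ ij))"
    have "emeasure (measure_pmf (adjacency_pmf n (Theta0 n \<rho> W \<xi>))) X
        = emeasure (measure_pmf ?q) (adjacency_matrix n -` X)"
      by (simp add: adjacency_pmf_def)
    also have "\<dots> = emeasure (measure_pmf ?q) ?Y"
      using set_Pi_pmf_subset[OF fE, of False "\<lambda>ij. bernoulli_pmf (Theta0 n \<rho> W \<xi> $$ ij)"]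
      by (intro emeasure_eq_AE) (auto simp: AE_measure_pmf_iff PiE_dflt_def)
    also have "\<dots> = ennreal (\<Sum>f\<in>?Y. pmf ?q f)"
      using fD by (simp add: measure_pmf.emeasure_eq_measure measure_measure_pmf_finite)
    also have "(\<Sum>f\<in>?Y. pmf ?q f) = (\<Sum>f\<in>?Y. \<Prod>ij\<in>?E. if f ij then Theta0 n \<rho> W \<xi> $$ ij else 1 - Theta0 n \<rho> W \<xi> $$ ij)"
    proof (rule sum.cong[OF refl])
      fix f assume f: "f \<in> ?Y"
      show "pmf ?q f = (\<Prod>ij\<in>?E. if f ij then Theta0 n \<rho> W \<xi> $$ ij else 1 - Theta0 n \<rho> W \<xi> $$ ij)"
      proof (subst pmf_Pi'[OF fE])
        show "\<And>x. x \<notin> ?E \<Longrightarrow> f x = False" using f by (auto simp: PiE_dflt_def)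
        show "(\<Prod>x\<in>?E. pmf (bernoulli_pmf (Theta0 n \<rho> W \<xi> $$ x)) (f x)) =
          (\<Prod>ij\<in>?E. if f ij then Theta0 n \<rho> W \<xi> $$ ij else 1 - Theta0 n \<rho> W \<xi> $$ ij)"
        proof (rule prod.cong[OF refl])
          fix x assume "x \<in> ?E"
          then obtain i j where x: "x = (i,j)" "i < n" "j < n" by auto
          have "Theta0 n \<rho> W \<xi> $$ x \<in> {0..1}"
            using Theta0_bounds[OF W \<open>0 < \<rho>\<close> that, of i j] x by simp
          then show "pmf (bernoulli_pmf (Theta0 n \<rho> W \<xi> $$ x)) (f x) =
             (if f x then Theta0 n \<rho> W \<xi> $$ x else 1 - Theta0 n \<rho> W \<xi> $$ x)"
            by (cases "f x") auto
        qed
      qed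
    qed
    finally show ?thesis .
  qed
  have [measurable]: "(\<lambda>\<xi>. \<Prod>ij\<in>?E. if f ij then Theta0 n \<rho> W \<xi> $$ ij else 1 - Theta0 n \<rho> W \<xi> $$ ij)
      \<in> borel_measurable ?P" for f
  proof (rule borel_measurable_prod)
    fix ij assume "ij \<in> ?E"
    from meas[OF this] show "(\<lambda>\<xi>. if f ij then Theta0 n \<rho> W \<xi> $$ ij else 1 - Theta0 n \<rho> W \<xi> $$ ij)
      \<in> borel_measurable ?P" by (cases "f ij") auto
  qed
  show "(\<lambda>\<xi>. emeasure (measure_pmf (adjacency_pmf n (Theta0 n \<rho> W \<xi>))) X) \<in> borel_measurable ?P"
    by (subst measurable_cong[OF eq]) (assumption, measurable)
qed (auto simp: measure_pmf.subprob_space_axioms)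

lemma prob_space_graph_law:
  assumes "W \<in> Lp_graphons p" "0 < \<rho>"
  shows "prob_space (graph_law n \<rho> W)"
proof -
  interpret P: prob_space "\<Pi>\<^sub>M i\<in>{..<n}. I01"
    by (intro prob_space_PiM prob_space_I01)
  show ?thesis unfolding graph_law_def
    by (rule P.prob_space_bind[OF _ adjacency_kernel_measurable[OF assms]])
       (auto intro: prob_space_measure_pmf)
qed

lemma sets_graph_law:
  assumes "W \<in> Lp_graphons p" "0 < \<rho>"
  shows "sets (graph_law n \<rho> W) = UNIV"
  unfolding graph_law_def
  using prob_space.not_empty[OF prob_space_PiM[OF prob_space_I01]]
  by (subst sets_bind[OF sets_kernel[OF adjacency_kernel_measurable[OF assms]]]) auto

subsection \<open>Singular value hard thresholding\<close>

text \<open>\<open>\<Sum>j\<in>J. \<sigma> j * u j * (v j)\<^sup>T\<close> as an \<open>n \<times> n\<close> matrix\<close>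

definition singular_sum :: "nat \<Rightarrow> (nat \<Rightarrow> real) \<Rightarrow> (nat \<Rightarrow> real vec) \<Rightarrow> (nat \<Rightarrow> real vec) \<Rightarrow>
    nat set \<Rightarrow> real mat" where
  "singular_sum n \<sigma> u v J =
     mat n n (\<lambda>(a, b). \<Sum>j\<in>J. \<sigma> j * vec_index (u j) a * vec_index (v j) b)"

text \<open>Since all \<open>\<sigma> j\<close> are positive, \<open>r\<close> is necessarily the rank of \<open>A\<close>.\<close>

definition is_svd :: "nat \<Rightarrow> real mat \<Rightarrow> nat \<Rightarrow> (nat \<Rightarrow> real) \<Rightarrow> (nat \<Rightarrow> real vec) \<Rightarrow>
    (nat \<Rightarrow> real vec) \<Rightarrow> bool" where
  "is_svd n A r \<sigma> u v \<longleftrightarrow>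
     (\<forall>j<r. 0 < \<sigma> j \<and> u j \<in> carrier_vec n \<and> v j \<in> carrier_vec n) \<and>
     (\<forall>i<r. \<forall>j<r. scalar_prod (u i) (u j) = of_bool (i = j) \<and>
                  scalar_prod (v i) (v j) = of_bool (i = j)) \<and>
     A = singular_sum n \<sigma> u v {..<r}"

text \<open>Every real square matrix has a singular value decomposition, and for \<open>0 < t\<close> the
  thresholded sum does not depend on which one is chosen.\<close>

definition hard_threshold :: "nat \<Rightarrow> real \<Rightarrow> real mat \<Rightarrow> real mat" where
  "hard_threshold n t A = (SOME B. \<exists>r \<sigma> u v. is_svd n A r \<sigma> u v \<and>
     B = singular_sum n \<sigma> u v {j. j < r \<and> t \<le> \<sigma> j})"

end

theory Submission
  imports Defs
begin

text \<open>
  Let \<open>A'\<close> be the thresholded matrix. Passing from \<open>A\<close> to \<open>A'\<close> removes a matrix of operator norm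
  less than \<open>\<lambda>\<close>, so it costs at most \<open>\<lambda> / n = c * sqrt (\<rho> / n)\<close> in cut norm, whatever \<open>c\<close> is: the
  two risks satisfy the same bound up to this term. Given \<open>\<Theta>\<^sub>0\<close>, an exponential moment
  and a union bound over the \<open>4 ^ n\<close> pairs of vertex sets bound the cut norm of \<open>A - \<Theta>\<^sub>0\<close>
  by a multiple of \<open>sqrt (\<rho> / n)\<close> on average.

  Everything else is estimated in \<open>L\<^sub>1\<close>. Composing \<open>W\<^sub>0\<close> with a measure-preserving bijection does not
  change the law of \<open>A\<close>, so let \<open>W\<close> be a step function near \<open>W\<^sub>0'\<close> itself. Replacing \<open>W\<^sub>0'\<close> by \<open>W\<close> at
  the sample points and again on the square costs \<open>2 * \<rho> * L1_norm (W - W\<^sub>0')\<close>. It remains to compare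
  \<open>W\<close> with its own sample. Both are step functions with the same values, and block \<open>a\<close> has
  measure \<open>\<alpha> a\<close> in one and the empirical frequency \<open>\<beta> a\<close> in the other. A permutation of a fine grid
  matches them outside a set of measure about \<open>\<bar>\<beta> a - \<alpha> a\<bar>\<close> in block \<open>a\<close>, and the mean of this number
  is at most \<open>sqrt (\<alpha> a / n)\<close>. This is at most \<open>\<alpha> a * sqrt (k / (\<mu> * n))\<close> for balanced blocks,
  and is handled by the Cauchy-Schwarz inequality in the \<open>L\<^sub>2\<close> case.
\<close>

subsection \<open>Singular value decompositions\<close>

text \<open>The distance is an infimum over bijections of the interval, not over couplings, and the
  level sets of a labelling are arbitrary Borel sets, so no explicit rearrangement of blocks is at
  hand. Inner regularity replaces the labelling, up to an arbitrarily small error, by one that is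
  constant on the cells of a fine grid; there a rearrangement is a permutation of cells.

  The moment bound for a Bernoulli variable has to be proportional to its mean: a bound by its range
  alone would yield 1 / sqrt n instead of sqrt (\<rho> / n). It holds for bounded exponents only,
  and \<rho> \<ge> 1 / n keeps the optimal parameter in that range.

  The error of a step function is at most 7 times its norm times the rate: 1 for the diagonal, where
  \<open>Theta0\<close> vanishes and the step function does not, and 2 * 3 for the mismatch of
  labels. The 3 is 2 for the block measures plus 1 for a product of two deviations. A useful
  competitor has norm at most twice the reference value, which makes 14.\<close>

abbreviation dot :: "nat \<Rightarrow> (nat \<Rightarrow> real) \<Rightarrow> (nat \<Rightarrow> real) \<Rightarrow> real" where
  "dot n x y \<equiv> (\<Sum>i<n. x i * y i)"

text \<open>Vectors are functions on all of \<open>nat\<close>. Fixing the coordinates from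
  \<open>n\<close> on to 0 makes the sphere compact in the product topology.\<close>

definition unit_vectors :: "nat \<Rightarrow> (nat \<Rightarrow> real) set" where
  "unit_vectors n = {x. (\<forall>i\<ge>n. x i = 0) \<and> dot n x x = 1}"

text \<open>By Tychonoff: the sphere is a closed subset of a product of the compact sets [-1, 1] and
  {0}.\<close>

lemma compact_unit_vectors: "compact (unit_vectors n)"
proof -
  let ?B = "\<lambda>i. if i < n then {-1..1} else {0::real}"
  have "compact_space (product_topology (\<lambda>i. subtopology euclidean (?B i)) UNIV)"
    by (subst compact_space_product_topology) (auto simp: compact_space_subtopology)
  then have "compactin (product_topology (\<lambda>_. euclidean) UNIV) (PiE UNIV ?B)"
    by (simp add: compactin_PiE)
  then have c: "compact (PiE UNIV ?B)"
    by (simp add: euclidean_product_topology)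
  have "closed {x::nat\<Rightarrow>real. dot n x x = 1}"
    by (intro closed_Collect_eq continuous_intros continuous_on_product_coordinates)
  then have "compact (PiE UNIV ?B \<inter> {x. dot n x x = 1})"
    using c by (rule compact_Int_closed[rotated])
  moreover have "PiE UNIV ?B \<inter> {x. dot n x x = 1} = unit_vectors n"
  proof -
    have "x i \<in> {-1..1}" if "dot n x x = 1" "i < n" for x :: "nat \<Rightarrow> real" and i
    proof -
      have "x i * x i \<le> dot n x x"
        using that by (intro member_le_sum) auto
      then have "\<bar>x i\<bar> \<le> 1" using that abs_square_le_1[of "x i"] by (simp add: power2_eq_square)
      then show ?thesis by auto
    qed
    then show ?thesis 
      unfolding unit_vectors_def by (auto simp: PiE_iff not_less dest: spec split: if_splits)
  qed
  ultimately show ?thesis by simp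
qed

text \<open>The equality case of Cauchy-Schwarz. Testing with \<open>y\<close> divided by its length
  \<open>q\<close> gives \<open>q \<le> s\<close>, and the squared distance from \<open>y\<close> to
  \<open>s * u\<close> equals q^2 - s^2.\<close>

lemma dot_maximiser:
  assumes le: "\<And>x. x \<in> unit_vectors n \<Longrightarrow> dot n x y \<le> s"
    and u: "u \<in> unit_vectors n" "dot n u y = s" and "0 \<le> s" "i < n"
  shows "y i = s * u i"
proof -
  define q where "q = sqrt (dot n y y)"
  have q2: "q\<^sup>2 = dot n y y" by (simp add: q_def sum_nonneg)
  have "q \<le> s"
  proof (cases "q = 0")
    case False
    then have "q > 0" using q_def real_sqrt_ge_zero[of "dot n y y"] by (simp add: sum_nonneg less_le)
    let ?w = "\<lambda>i. if i < n then y i / q else 0"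
    have "dot n ?w ?w = dot n y y / q\<^sup>2"
      by (simp add: sum_divide_distrib power2_eq_square)
    then have "?w \<in> unit_vectors n" using False by (simp add: unit_vectors_def q2[symmetric])
    from le[OF this] have "dot n y y / q \<le> s"
      by (simp add: sum_divide_distrib)
    then show ?thesis using \<open>q > 0\<close> by (simp add: q2[symmetric] power2_eq_square)
  qed (use \<open>0 \<le> s\<close> in simp)
  have "(\<Sum>i<n. (y i - s * u i)\<^sup>2) = dot n y y - 2 * s * dot n u y + s\<^sup>2 * dot n u u"
    by (simp add: power2_eq_square algebra_simps sum.distrib sum_subtractf sum_distrib_left)
  also have "\<dots> = q\<^sup>2 - s\<^sup>2"
    using u unfolding q2[symmetric] by (simp add: unit_vectors_def power2_eq_square)
  also have "\<dots> \<le> 0" using \<open>q \<le> s\<close> by (simp add: power_mono q_def sum_nonneg del: real_sqrt_pow2 real_sqrt_pow2_iff)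
  finally have "(\<Sum>i<n. (y i - s * u i)\<^sup>2) = 0"
    by (simp add: order_antisym sum_nonneg)
  then have "(y i - s * u i)\<^sup>2 = 0"
    using \<open>i < n\<close> by (subst (asm) sum_nonneg_eq_0_iff) auto
  then show ?thesis by simp
qed

text \<open>Maximise the bilinear form of \<open>R\<close> over pairs of unit vectors. At a
  maximiser each vector also maximises the linear form obtained by fixing the other one, so
  \<open>dot_maximiser\<close> yields both singular equations.\<close>

lemma top_singular_pair:
  fixes R :: "nat \<Rightarrow> nat \<Rightarrow> real"
  assumes "a < n" "b < n" "R a b \<noteq> 0"
  obtains s u v where "0 < s" "dot n u u = 1" "dot n v v = 1"
    "\<And>i. i < n \<Longrightarrow> dot n (R i) v = s * u i"
    "\<And>j. j < n \<Longrightarrow> dot n (\<lambda>i. R i j) u = s * v j"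
proof -
  let ?F = "\<lambda>(u, v). dot n u (\<lambda>i. dot n (R i) v)"
  let ?e = "\<lambda>c k i. if i = k then c else (0::real)"
  have e: "?e c k \<in> unit_vectors n" if "k < n" "c * c = 1" for c k
    using that by (auto simp: unit_vectors_def if_distrib[of "\<lambda>x. x * _"] cong: if_cong)
  have "continuous_on (unit_vectors n \<times> unit_vectors n) ?F"
    unfolding case_prod_unfold
    by (intro continuous_intros continuous_on_product_then_coordinatewise)
  then obtain u v where uv: "u \<in> unit_vectors n" "v \<in> unit_vectors n"
    and max: "\<And>x y. x \<in> unit_vectors n \<Longrightarrow> y \<in> unit_vectors n \<Longrightarrow> ?F (x, y) \<le> ?F (u, v)"
    using continuous_attains_sup[OF compact_Times[OF compact_unit_vectors compact_unit_vectors],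
        of n n ?F] e[OF assms(1), of 1] by fastforce
  let ?s = "?F (u, v)"
  have sw: "?F (x, y) = dot n y (\<lambda>j. dot n (\<lambda>i. R i j) x)" for x y
    unfolding case_prod_conv sum_distrib_left by (subst sum.swap) (simp add: mult_ac)
  \<comment> \<open>The sign in the first basis vector turns the entry into its absolute value, so
    the maximum is positive.\<close>
  have "?F (?e (sgn (R a b)) a, ?e 1 b) = \<bar>R a b\<bar>"
    using assms by (simp add: if_distrib[of "\<lambda>x. x * _"] if_distrib[of "\<lambda>x. _ * x"] abs_sgn mult_ac cong: if_cong)
  then have pos: "0 < ?s"
    using max[OF e[OF assms(1), of "sgn (R a b)"] e[OF assms(2), of 1]] assms(3)
    by (simp add: sgn_mult_self_eq)
  show thesis
  proof (rule that[of ?s u v])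
    show "dot n (R i) v = ?s * u i" if "i < n" for i
      by (rule dot_maximiser[of n _ ?s, OF _ uv(1) _ _ that]) (use max uv pos in auto)
    show "dot n (\<lambda>i. R i j) u = ?s * v j" if "j < n" for j
      by (rule dot_maximiser[of n _ ?s, OF _ uv(2) _ _ that]) (use max[OF uv(1)] sw pos in auto)
  qed (use uv pos in \<open>auto simp: unit_vectors_def\<close>)
qed

text \<open>The squared distance from \<open>x\<close> to its projection \<open>?p\<close> onto the
  span is nonnegative, and both \<open>dot n x ?p\<close> and \<open>dot n ?p ?p\<close> equal the
  sum of squared coefficients.\<close>

lemma bessel:
  fixes u :: "nat \<Rightarrow> nat \<Rightarrow> real"
  assumes "finite J" "\<And>i j. i \<in> J \<Longrightarrow> j \<in> J \<Longrightarrow> dot n (u i) (u j) = of_bool (i = j)"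
  shows "(\<Sum>j\<in>J. (dot n (u j) x)\<^sup>2) \<le> dot n x x"
proof -
  let ?c = "\<lambda>j. dot n (u j) x"
  let ?p = "\<lambda>i. \<Sum>j\<in>J. ?c j * u j i"
  have 1: "dot n x ?p = (\<Sum>j\<in>J. (?c j)\<^sup>2)"
    unfolding sum_distrib_left
    by (subst sum.swap) (simp add: power2_eq_square sum_distrib_left sum_distrib_right mult_ac)
  have "dot n ?p ?p = (\<Sum>i<n. \<Sum>j\<in>J. \<Sum>l\<in>J. ?c j * ?c l * (u j i * u l i))"
    by (simp add: sum_product mult_ac)
  also have "\<dots> = (\<Sum>j\<in>J. \<Sum>l\<in>J. \<Sum>i<n. ?c j * ?c l * (u j i * u l i))"
    by (simp only: sum.swap[of _ J "{..<n}"])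
  also have "\<dots> = (\<Sum>j\<in>J. \<Sum>l\<in>J. ?c j * ?c l * of_bool (j = l))"
    by (intro sum.cong refl) (simp only: sum_distrib_left[symmetric] assms)
  also have "\<dots> = (\<Sum>j\<in>J. (?c j)\<^sup>2)"
    using assms(1) by (simp add: power2_eq_square)
  finally have 2: "dot n ?p ?p = (\<Sum>j\<in>J. (?c j)\<^sup>2)" .
  have "0 \<le> (\<Sum>i<n. (x i - ?p i)\<^sup>2)" by (simp add: sum_nonneg)
  also have "\<dots> = dot n x x - 2 * dot n x ?p + dot n ?p ?p"
  proof -
    have "(\<Sum>i<n. (x i - p i)\<^sup>2) = dot n x x - 2 * dot n x p + dot n p p" for p
    proof -
      have "(x i - p i)\<^sup>2 = x i * x i - 2 * (x i * p i) + p i * p i" for i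
        by (simp add: power2_eq_square algebra_simps)
      then show ?thesis by (simp add: sum.distrib sum_subtractf sum_distrib_left)
    qed
    then show ?thesis .
  qed
  finally show ?thesis using 1 2 by simp
qed

text \<open>A partial singular value decomposition: orthonormal singular pairs that need not yet
  exhaust \<open>M\<close>. Both singular equations are recorded, so that the remainder annihilates
  the chosen vectors from either side.\<close>

definition singular_system ::
    "nat \<Rightarrow> (nat \<Rightarrow> nat \<Rightarrow> real) \<Rightarrow> nat \<Rightarrow> (nat \<Rightarrow> real) \<Rightarrow> (nat \<Rightarrow> nat \<Rightarrow> real) \<Rightarrow> (nat \<Rightarrow> nat \<Rightarrow> real) \<Rightarrow> bool" where
  "singular_system n M r s u v \<longleftrightarrow>
     (\<forall>l<r. 0 < s l \<and> (\<forall>i<n. dot n (M i) (v l) = s l * u l i) \<and>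
            (\<forall>j<n. dot n (\<lambda>i. M i j) (u l) = s l * v l j)) \<and>
     (\<forall>l<r. \<forall>m<r. dot n (u l) (u m) = of_bool (l = m) \<and> dot n (v l) (v m) = of_bool (l = m))"

text \<open>Count the squared entries of all \<open>u l\<close>: by vectors the total is
  \<open>r\<close>; by coordinates, Bessel applied to the standard basis bounds each contribution by
  1.\<close>

lemma singular_system_length_le:
  assumes "singular_system n M r s u v"
  shows "r \<le> n"
proof -
  have "real r = (\<Sum>l<r. dot n (u l) (u l))"
    using assms by (simp add: singular_system_def)
  also have "\<dots> = (\<Sum>i<n. \<Sum>l<r. (u l i)\<^sup>2)"
    by (subst sum.swap) (simp add: power2_eq_square)
  also have "\<dots> \<le> (\<Sum>i<n. 1)"
  proof (rule sum_mono)
    fix i assume i: "i \<in> {..<n}"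
    have "(\<Sum>l<r. (dot n (u l) (\<lambda>k. of_bool (k = i)))\<^sup>2) \<le> dot n (\<lambda>k. of_bool (k = i)) (\<lambda>k. of_bool (k = i))"
      using assms by (intro bessel) (auto simp: singular_system_def)
    then show "(\<Sum>l<r. (u l i)\<^sup>2) \<le> 1" using i by simp
  qed
  finally show ?thesis by simp
qed

text \<open>Deflation. The remainder \<open>R\<close> kills the old singular vectors, so its top
  singular pair is orthogonal to them, and on vectors orthogonal to the old ones \<open>R\<close>
  and \<open>M\<close> coincide; hence the new pair is singular for \<open>M\<close> too.\<close>

lemma singular_system_extend:
  assumes S: "singular_system n M r s u v"
    and "a < n" "b < n" and ne: "M a b \<noteq> (\<Sum>l<r. s l * u l a * v l b)"
  shows "\<exists>s u v. singular_system n M (Suc r) s u v"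
proof -
  define R where "R i j = M i j - (\<Sum>l<r. s l * u l i * v l j)" for i j
  have Rv: "dot n (R i) x = dot n (M i) x - (\<Sum>l<r. s l * u l i * dot n (v l) x)" for x i
    unfolding R_def left_diff_distrib sum_subtractf sum_distrib_right sum_distrib_left
    by (subst (2) sum.swap) (simp add: mult_ac)
  have Ru: "dot n (\<lambda>i. R i j) x = dot n (\<lambda>i. M i j) x - (\<Sum>l<r. s l * v l j * dot n (u l) x)" for x j
    unfolding R_def left_diff_distrib sum_subtractf sum_distrib_right sum_distrib_left
    by (subst (2) sum.swap) (simp add: mult_ac)
  have Rv0: "dot n (R i) (v m) = 0" if "i < n" "m < r" for i m
    using S that unfolding Rv by (simp add: singular_system_def)
  have Ru0: "dot n (\<lambda>i. R i j) (u m) = 0" if "j < n" "m < r" for j m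
    using S that unfolding Ru by (simp add: singular_system_def)
  have "R a b \<noteq> 0" using ne by (simp add: R_def)
  then obtain s' u' v' where
    t: "0 < s'" "dot n u' u' = 1" "dot n v' v' = 1"
    "\<And>i. i < n \<Longrightarrow> dot n (R i) v' = s' * u' i"
    "\<And>j. j < n \<Longrightarrow> dot n (\<lambda>i. R i j) u' = s' * v' j"
    by (rule top_singular_pair[OF assms(2,3), of R]) blast
  have adj: "dot n x (\<lambda>i. dot n (R i) y) = dot n y (\<lambda>j. dot n (\<lambda>i. R i j) x)" for x y
    unfolding sum_distrib_left by (subst sum.swap) (simp add: mult_ac)
  have ou: "dot n (u m) u' = 0" if "m < r" for m
  proof -
    have "s' * dot n (u m) u' = dot n (u m) (\<lambda>i. dot n (R i) v')"
      unfolding sum_distrib_left[of s'] by (intro sum.cong refl) (simp add: t(4))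
    also have "\<dots> = 0" using Ru0[OF _ that] by (subst adj) simp
    finally show ?thesis using t by simp
  qed
  have ov: "dot n (v m) v' = 0" if "m < r" for m
  proof -
    have "s' * dot n (v m) v' = dot n (v m) (\<lambda>j. dot n (\<lambda>i. R i j) u')"
      unfolding sum_distrib_left[of s'] by (intro sum.cong refl) (simp add: t(5))
    also have "\<dots> = 0" using Rv0[OF _ that] by (subst adj[symmetric]) simp
    finally show ?thesis using t by simp
  qed
  have "dot n u' (u m) = 0" "dot n v' (v m) = 0" if "m < r" for m
    using ou[OF that] ov[OF that] by (simp_all add: mult.commute)
  then have "singular_system n M (Suc r) (s(r := s')) (u(r := u')) (v(r := v'))"
    using S t Rv[of _ v'] Ru[of _ u'] ou ov
    by (simp add: singular_system_def less_Suc_eq all_conj_distrib)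
  then show ?thesis by blast
qed

text \<open>A singular system of maximal length leaves no nonzero entry in the remainder, since
  otherwise it could be extended.\<close>

lemma svd_exists:
  assumes A: "A \<in> carrier_mat n n"
  shows "\<exists>r s u v. is_svd n A r s u v"
proof -
  let ?M = "\<lambda>i j. A $$ (i, j)"
  let ?P = "\<lambda>r. \<exists>s u v. singular_system n ?M r s u v"
  have "?P 0" by (simp add: singular_system_def)
  moreover have bnd: "r \<le> n" if "?P r" for r
    using that singular_system_length_le by blast
  ultimately obtain r where "?P r" and gr: "\<And>r'. ?P r' \<Longrightarrow> r' \<le> r"
    using GreatestI_nat[of ?P 0 n] Greatest_le_nat[of ?P _ n] by blast
  then obtain s u v where S: "singular_system n ?M r s u v" by blast
  have eq: "A $$ (i, j) = (\<Sum>l<r. s l * u l i * v l j)" if "i < n" "j < n" for i j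
    using singular_system_extend[OF S that] gr[of "Suc r"] by auto
  have "is_svd n A r s (\<lambda>l. vec n (u l)) (\<lambda>l. vec n (v l))"
    unfolding is_svd_def singular_sum_def
    using A S by (auto simp: scalar_prod_def singular_system_def eq lessThan_atLeast0[symmetric])
  then show ?thesis by blast
qed

text \<open>Only singular values below \<open>t\<close> are missing. Cauchy-Schwarz over the index
  of these values and Bessel for the left and right vectors bound the bilinear form. The argument
  applies to whichever decomposition the choice operator picks; \<open>svd_exists\<close> guarantees
  that it picks one.\<close>

lemma hard_threshold_residual:
  assumes A: "A \<in> carrier_mat n n" and t: "0 < t"
  shows "\<bar>\<Sum>i<n. \<Sum>j<n. (hard_threshold n t A $$ (i, j) - A $$ (i, j)) * x i * y j\<bar>
           \<le> t * sqrt (dot n x x) * sqrt (dot n y y)" (is "\<bar>?S\<bar> \<le> _")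
proof -
  obtain r s u v where svd: "is_svd n A r s u v"
    and ht: "hard_threshold n t A = singular_sum n s u v {j. j < r \<and> t \<le> s j}"
    using someI_ex[of "\<lambda>B. \<exists>r \<sigma> u v. is_svd n A r \<sigma> u v \<and> B = singular_sum n \<sigma> u v {j. j < r \<and> t \<le> \<sigma> j}"]
      svd_exists[OF A] unfolding hard_threshold_def by blast
  let ?J = "{j. j < r \<and> s j < t}"
  let ?u = "\<lambda>l i. vec_index (u l) i" and ?v = "\<lambda>l i. vec_index (v l) i"
  have Aeq: "A = singular_sum n s u v {..<r}" using svd by (simp add: is_svd_def)
  have split: "{..<r} = {j. j < r \<and> t \<le> s j} \<union> ?J" by auto
  have res: "hard_threshold n t A $$ (i, j) - A $$ (i, j) = - (\<Sum>l\<in>?J. s l * ?u l i * ?v l j)"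
    if "i < n" "j < n" for i j
  proof -
    have "A $$ (i, j) = hard_threshold n t A $$ (i, j) + (\<Sum>l\<in>?J. s l * ?u l i * ?v l j)"
      unfolding ht by (subst Aeq, subst split) (use that in \<open>simp add: singular_sum_def, intro sum.union_disjoint, auto\<close>)
    then show ?thesis by simp
  qed
  have orth: "dot n (?u i) (?u j) = of_bool (i = j)" "dot n (?v i) (?v j) = of_bool (i = j)"
    if "i < r" "j < r" for i j
  proof -
    have "scalar_prod (u i) (u j) = of_bool (i = j)" "scalar_prod (v i) (v j) = of_bool (i = j)"
      "dim_vec (u j) = n" "dim_vec (v j) = n"
      using svd that unfolding is_svd_def carrier_vec_def by blast+
    then show "dot n (?u i) (?u j) = of_bool (i = j)" "dot n (?v i) (?v j) = of_bool (i = j)"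
      by (simp_all add: scalar_prod_def atLeast0LessThan)
  qed
  have "?S
      = (\<Sum>i<n. \<Sum>j<n. \<Sum>l\<in>?J. - (s l * (?u l i * x i) * (?v l j * y j)))"
    by (intro sum.cong refl) (simp add: res sum_distrib_left sum_distrib_right sum_negf mult_ac)
  also have "\<dots> = (\<Sum>i<n. \<Sum>l\<in>?J. \<Sum>j<n. - (s l * (?u l i * x i) * (?v l j * y j)))"
    by (intro sum.cong refl sum.swap)
  also have "\<dots> = (\<Sum>l\<in>?J. \<Sum>i<n. \<Sum>j<n. - (s l * (?u l i * x i) * (?v l j * y j)))"
    by (rule sum.swap)
  also have "\<dots> = (\<Sum>l\<in>?J. - (s l * dot n (?u l) x * dot n (?v l) y))"
    by (intro sum.cong refl) (simp add: sum_distrib_left sum_distrib_right sum_negf mult_ac)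
  finally have "\<bar>?S\<bar>
      \<le> (\<Sum>l\<in>?J. \<bar>- (s l * dot n (?u l) x * dot n (?v l) y)\<bar>)" by (simp only: sum_abs)
  also have "\<dots> \<le> (\<Sum>l\<in>?J. t * (\<bar>dot n (?u l) x\<bar> * \<bar>dot n (?v l) y\<bar>))"
  proof (rule sum_mono)
    fix l assume l: "l \<in> ?J"
    have "0 < s l" using svd l by (simp add: is_svd_def)
    then show "\<bar>- (s l * dot n (?u l) x * dot n (?v l) y)\<bar> \<le> t * (\<bar>dot n (?u l) x\<bar> * \<bar>dot n (?v l) y\<bar>)"
      using l by (simp add: abs_mult mult.assoc mult_right_mono)
  qed
  also have "\<dots> = t * (\<Sum>l\<in>?J. \<bar>dot n (?u l) x\<bar> * \<bar>dot n (?v l) y\<bar>)"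
    by (simp add: sum_distrib_left)
  also have "\<dots> \<le> t * (L2_set (\<lambda>l. dot n (?u l) x) ?J * L2_set (\<lambda>l. dot n (?v l) y) ?J)"
    by (intro mult_left_mono L2_set_mult_ineq) (use t in simp)
  also have "\<dots> \<le> t * (sqrt (dot n x x) * sqrt (dot n y y))"
  proof -
    have "L2_set (\<lambda>l. dot n (?u l) x) ?J \<le> sqrt (dot n x x)"
      unfolding L2_set_def by (intro real_sqrt_le_mono bessel) (auto simp: orth)
    moreover have "L2_set (\<lambda>l. dot n (?v l) y) ?J \<le> sqrt (dot n y y)"
      unfolding L2_set_def by (intro real_sqrt_le_mono bessel) (auto simp: orth)
    ultimately show ?thesis using t by (intro mult_left_mono mult_mono) (auto simp: sum_nonneg)
  qed
  finally show "\<bar>?S\<bar>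
           \<le> t * sqrt (dot n x x) * sqrt (dot n y y)" by (simp add: mult.assoc)
qed

subsection \<open>Kernels on the unit square\<close>

interpretation I01: prob_space I01 by (rule prob_space_I01)

interpretation I2: pair_prob_space I01 I01 ..

lemma space_I01 [simp]: "space I01 = {0..1}"
  by (simp add: I01_def space_restrict_space)

abbreviation "unit_square \<equiv> I01 \<Otimes>\<^sub>M I01"

abbreviation integrable_kernel :: "(real \<Rightarrow> real \<Rightarrow> real) \<Rightarrow> bool" where
  "integrable_kernel W \<equiv> integrable unit_square (case_prod W)"

lemma kernel_diff: "integrable_kernel V \<Longrightarrow> integrable_kernel W \<Longrightarrow> integrable_kernel (\<lambda>x y. V x y - W x y)"
  using Bochner_Integration.integrable_diff[of "unit_square" "case_prod V" "case_prod W"]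
  by (simp add: case_prod_beta')

lemma set_integrable_Times:
  assumes "integrable_kernel W" "S \<in> sets I01" "T \<in> sets I01"
  shows "set_integrable unit_square (S \<times> T) (case_prod W)"
  unfolding set_integrable_def using assms by (intro Bochner_Integration.integrable_mult_indicator) auto

lemma set_integral_le_L1_norm:
  assumes "integrable_kernel W" "S \<in> sets I01" "T \<in> sets I01"
  shows "\<bar>LINT z:S \<times> T|unit_square. case_prod W z\<bar> \<le> L1_norm W"
proof -
  have "\<bar>LINT z:S \<times> T|unit_square. case_prod W z\<bar>
      \<le> (LINT z|unit_square. \<bar>indicator (S \<times> T) z *\<^sub>R case_prod W z\<bar>)"
    unfolding set_lebesgue_integral_def by (rule integral_abs_bound)
  also have "\<dots> \<le> (LINT z|unit_square. \<bar>case_prod W z\<bar>)"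
    using set_integrable_Times[OF assms] assms(1) unfolding set_integrable_def
    by (intro integral_mono integrable_abs) (auto simp: indicator_def split: prod.splits)
  finally show ?thesis by (simp add: L1_norm_def case_prod_beta')
qed

lemma cut_norm_upper:
  assumes "integrable_kernel W" "S \<in> sets I01" "T \<in> sets I01"
  shows "\<bar>LINT z:S \<times> T|unit_square. case_prod W z\<bar> \<le> cut_norm W"
  unfolding cut_norm_def
  using assms set_integral_le_L1_norm[OF assms(1)] by (intro cSup_upper) (auto intro!: bdd_aboveI)

lemma cut_norm_least:
  assumes "\<And>S T. S \<in> sets I01 \<Longrightarrow> T \<in> sets I01 \<Longrightarrow>
    \<bar>LINT z:S \<times> T|unit_square. case_prod W z\<bar> \<le> B"
  shows "cut_norm W \<le> B"
  unfolding cut_norm_def by (rule cSup_least) (use assms in auto)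

lemma cut_norm_nonneg: "integrable_kernel W \<Longrightarrow> 0 \<le> cut_norm W"
  using cut_norm_upper[of W "{}" "{}"] by simp

lemma cut_norm_le_L1_norm: "integrable_kernel W \<Longrightarrow> cut_norm W \<le> L1_norm W"
  by (rule cut_norm_least) (rule set_integral_le_L1_norm)

lemma cut_norm_triangle:
  assumes "integrable_kernel U" "integrable_kernel V" "integrable_kernel W"
  shows "cut_norm (\<lambda>x y. U x y - W x y)
    \<le> cut_norm (\<lambda>x y. U x y - V x y) + cut_norm (\<lambda>x y. V x y - W x y)"
proof (rule cut_norm_least)
  fix S T assume ST: "S \<in> sets I01" "T \<in> sets I01"
  let ?L = "\<lambda>F. LINT z:S \<times> T|unit_square. case_prod F z"
  have "?L (\<lambda>x y. U x y - W x y) = ?L (\<lambda>x y. U x y - V x y) + ?L (\<lambda>x y. V x y - W x y)"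
    using set_integral_add(2)[OF set_integrable_Times[OF kernel_diff[OF assms(1,2)] ST]
        set_integrable_Times[OF kernel_diff[OF assms(2,3)] ST]]
    by (simp add: case_prod_beta')
  then show "\<bar>?L (\<lambda>x y. U x y - W x y)\<bar>
      \<le> cut_norm (\<lambda>x y. U x y - V x y) + cut_norm (\<lambda>x y. V x y - W x y)"
    using cut_norm_upper[OF kernel_diff[OF assms(1,2)] ST] cut_norm_upper[OF kernel_diff[OF assms(2,3)] ST]
    by linarith
qed

lemma L1_norm_triangle:
  assumes "integrable_kernel U" "integrable_kernel V" "integrable_kernel W"
  shows "L1_norm (\<lambda>x y. U x y - W x y)
    \<le> L1_norm (\<lambda>x y. U x y - V x y) + L1_norm (\<lambda>x y. V x y - W x y)"
proof -
  have i: "integrable unit_square (\<lambda>z. \<bar>case_prod (\<lambda>x y. U x y - V x y) z\<bar>)"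
     "integrable unit_square (\<lambda>z. \<bar>case_prod (\<lambda>x y. V x y - W x y) z\<bar>)"
     "integrable unit_square (\<lambda>z. \<bar>case_prod (\<lambda>x y. U x y - W x y) z\<bar>)"
    by (intro integrable_abs kernel_diff assms)+
  have "L1_norm (\<lambda>x y. U x y - W x y) = (LINT z|unit_square. \<bar>case_prod (\<lambda>x y. U x y - W x y) z\<bar>)"
    by (simp add: L1_norm_def case_prod_beta')
  also have "\<dots> \<le> (LINT z|unit_square. \<bar>case_prod (\<lambda>x y. U x y - V x y) z\<bar> + \<bar>case_prod (\<lambda>x y. V x y - W x y) z\<bar>)"
    by (rule integral_mono[OF i(3) Bochner_Integration.integrable_add[OF i(1,2)]]) (auto split: prod.splits)
  also have "\<dots> = L1_norm (\<lambda>x y. U x y - V x y) + L1_norm (\<lambda>x y. V x y - W x y)"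
    unfolding Bochner_Integration.integral_add[OF i(1,2)] by (simp add: L1_norm_def case_prod_beta')
  finally show ?thesis .
qed

lemma L1_norm_nonneg: "0 \<le> L1_norm W"
  by (simp add: L1_norm_def case_prod_beta')

subsection \<open>Measure-preserving bijections\<close>

lemma id_mp_bijection: "(\<lambda>x. x) \<in> mp_bijections"
  by (simp add: mp_bijections_def bij_betw_def distr_id2)

lemma comp_mp_bijections:
  assumes "\<sigma> \<in> mp_bijections" "\<tau> \<in> mp_bijections"
  shows "(\<lambda>x. \<tau> (\<sigma> x)) \<in> mp_bijections"
  using assms bij_betw_trans[of \<sigma> "{0..1}" "{0..1}" \<tau> "{0..1}"] distr_distr[of \<tau> I01 I01 \<sigma> I01]
  by (auto simp: mp_bijections_def comp_def)

lemma distr_pair_mp_bijection: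
  assumes "\<tau> \<in> mp_bijections"
  shows "distr unit_square unit_square (\<lambda>(x, y). (\<tau> x, \<tau> y)) = unit_square"
  using assms pair_measure_distr[of \<tau> I01 I01 \<tau> I01 I01] I01.sigma_finite_measure_axioms
  by (simp add: mp_bijections_def)

lemma measurable_pair_mp_bijection:
  assumes "\<tau> \<in> mp_bijections"
  shows "(\<lambda>(x, y). (\<tau> x, \<tau> y)) \<in> measurable unit_square unit_square"
proof -
  have [measurable]: "\<tau> \<in> measurable I01 I01" using assms by (simp add: mp_bijections_def)
  show ?thesis by measurable
qed

lemma kernel_mp_bijection:
  assumes "\<tau> \<in> mp_bijections" "integrable_kernel W"
  shows "integrable_kernel (\<lambda>x y. W (\<tau> x) (\<tau> y))"
  using integrable_distr[OF measurable_pair_mp_bijection[OF assms(1)], of "case_prod W"]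
    assms distr_pair_mp_bijection[OF assms(1)] by (simp add: case_prod_beta')

lemma integral_mp_bijection:
  assumes "\<tau> \<in> mp_bijections" "case_prod F \<in> borel_measurable unit_square"
  shows "(LINT (x, y)|unit_square. F (\<tau> x) (\<tau> y)) = (LINT (x, y)|unit_square. F x y :: real)"
  using integral_distr[OF measurable_pair_mp_bijection[OF assms(1)] assms(2)]
    distr_pair_mp_bijection[OF assms(1)] by (simp add: case_prod_beta')

lemma cut_dist_le_cut_norm:
  assumes "\<tau> \<in> mp_bijections" "integrable_kernel V" "integrable_kernel W"
  shows "cut_dist V W \<le> cut_norm (\<lambda>x y. V x y - W (\<tau> x) (\<tau> y))"
  unfolding graphon_dist_def
proof (rule cINF_lower[OF bdd_belowI2])
  show "0 \<le> cut_norm (\<lambda>x y. V x y - W (\<sigma> x) (\<sigma> y))" if "\<sigma> \<in> mp_bijections" for \<sigma>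
    by (rule cut_norm_nonneg[OF kernel_diff[OF assms(2) kernel_mp_bijection[OF that assms(3)]]])
qed fact

lemma graphon_dist_greatest:
  assumes "\<And>\<tau>. \<tau> \<in> mp_bijections \<Longrightarrow> B \<le> N (\<lambda>x y. V x y - W (\<tau> x) (\<tau> y))"
  shows "B \<le> graphon_dist N V W"
  unfolding graphon_dist_def using id_mp_bijection by (intro cINF_greatest assms) auto

lemma cut_dist_nonneg:
  assumes "integrable_kernel V" "integrable_kernel W"
  shows "0 \<le> cut_dist V W"
proof (rule graphon_dist_greatest)
  fix \<tau> assume "\<tau> \<in> mp_bijections"
  from cut_norm_nonneg[OF kernel_diff[OF assms(1) kernel_mp_bijection[OF this assms(2)]]]
  show "0 \<le> cut_norm (\<lambda>x y. V x y - W (\<tau> x) (\<tau> y))" .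
qed

text \<open>The first leg is measured in cut norm, so one and the same bijection serves both cut
  distances.\<close>

lemma cut_dist_triangle:
  assumes "integrable_kernel U" "integrable_kernel V" "integrable_kernel W"
  shows "cut_dist U W \<le> cut_norm (\<lambda>x y. U x y - V x y) + cut_dist V W"
proof -
  have "cut_dist U W - cut_norm (\<lambda>x y. U x y - V x y) \<le> cut_dist V W"
  proof (rule graphon_dist_greatest)
    fix \<tau> assume \<tau>: "\<tau> \<in> mp_bijections"
    show "cut_dist U W - cut_norm (\<lambda>x y. U x y - V x y) \<le> cut_norm (\<lambda>x y. V x y - W (\<tau> x) (\<tau> y))"
      using cut_dist_le_cut_norm[OF \<tau> assms(1,3)]
        cut_norm_triangle[OF assms(1,2) kernel_mp_bijection[OF \<tau> assms(3)]] by linarith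
  qed
  then show ?thesis by linarith
qed

text \<open>Every competitor \<open>\<sigma>\<close> on the right gives the competitor
  \<open>\<tau>\<close> after \<open>\<sigma>\<close> on the left.\<close>

lemma cut_dist_mp_bijection:
  assumes "\<tau> \<in> mp_bijections" "integrable_kernel V" "integrable_kernel W"
  shows "cut_dist V W \<le> cut_dist V (\<lambda>x y. W (\<tau> x) (\<tau> y))"
proof (rule graphon_dist_greatest)
  fix \<sigma> assume "\<sigma> \<in> mp_bijections"
  from cut_dist_le_cut_norm[OF comp_mp_bijections[OF this assms(1)] assms(2,3)]
  show "cut_dist V W \<le> cut_norm (\<lambda>x y. V x y - W (\<tau> (\<sigma> x)) (\<tau> (\<sigma> y)))" .
qed

subsection \<open>Step functions\<close>

lemma measure_I2_Times:
  assumes "S \<in> sets I01" "T \<in> sets I01"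
  shows "measure unit_square (S \<times> T) = measure I01 S * measure I01 T"
  using assms by (simp add: measure_def I01.emeasure_pair_measure_Times enn2real_mult)

text \<open>This turns integrals of step functions over rectangles into bilinear forms of matrices.
  The sets \<open>S\<close> and \<open>T\<close> serve the cut norm as well as the restriction to
  mismatched points.\<close>

lemma step_integral:
  fixes F :: "nat \<Rightarrow> nat \<Rightarrow> real"
  assumes a [measurable]: "a \<in> measurable I01 (count_space UNIV)" and b [measurable]: "b \<in> measurable I01 (count_space UNIV)"
    and ak: "\<And>x. x \<in> {0..1} \<Longrightarrow> a x < k" and bl: "\<And>x. x \<in> {0..1} \<Longrightarrow> b x < l"
    and [measurable]: "S \<in> sets I01" "T \<in> sets I01"
  shows "(LINT (x, y)|unit_square. indicator S x * indicator T y * F (a x) (b y)) =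
      (\<Sum>i<k. \<Sum>j<l. F i j * measure I01 {x\<in>S. a x = i} * measure I01 {y\<in>T. b y = j})" (is "?L = ?R")
    and "integrable_kernel (\<lambda>x y. indicator S x * indicator T y * F (a x) (b y))"
proof -
  let ?A = "\<lambda>i. {x\<in>S. a x = i}" and ?B = "\<lambda>j. {y\<in>T. b y = j}"
  have S01: "S \<subseteq> {0..1}" "T \<subseteq> {0..1}" using sets.sets_into_space[of _ I01] assms by auto
  have AB: "?A i \<in> sets I01" "?B j \<in> sets I01" for i j
  proof -
    have "?A i = {x\<in>space I01. x \<in> S \<and> a x = i}" "?B j = {x\<in>space I01. x \<in> T \<and> b x = j}"
      using S01 by auto
    moreover have "{x\<in>space I01. x \<in> S \<and> a x = i} \<in> sets I01" "{x\<in>space I01. x \<in> T \<and> b x = j} \<in> sets I01"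
      by measurable
    ultimately show "?A i \<in> sets I01" "?B j \<in> sets I01" by simp_all
  qed
  have eq: "indicator S x * indicator T y * F (a x) (b y)
      = (\<Sum>i<k. \<Sum>j<l. F i j * indicator (?A i \<times> ?B j) (x, y))"
    if "x \<in> {0..1}" "y \<in> {0..1}" for x y
  proof -
    \<comment> \<open>A point lies in exactly one product of blocks, so the double sum collapses to
      a single term.\<close>
    have "F i j * indicator (?A i \<times> ?B j) (x, y)
        = (if j = b y then if i = a x then indicator S x * indicator T y * F i j else 0 else 0)" for i j
      by (simp add: indicator_def)
    then show ?thesis
      using ak[OF that(1)] bl[OF that(2)] by (simp only: sum.delta finite_lessThan lessThan_iff if_True)
    qed
  have int: "integrable unit_square (\<lambda>z. \<Sum>i<k. \<Sum>j<l. F i j * indicator (?A i \<times> ?B j) z)"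
    by (intro Bochner_Integration.integrable_sum integrable_mult_right integrable_real_indicator)
       (use AB in \<open>auto simp: I2.P.emeasure_eq_measure\<close>)
  show "integrable_kernel (\<lambda>x y. indicator S x * indicator T y * F (a x) (b y))"
    by (rule Bochner_Integration.integrable_cong[THEN iffD2, OF refl _ int]) (auto simp: space_pair_measure eq)
  have "?L = (LINT z|unit_square. (\<Sum>i<k. \<Sum>j<l. F i j * indicator (?A i \<times> ?B j) z))"
    by (rule Bochner_Integration.integral_cong) (auto simp: space_pair_measure eq)
  also have "\<dots> = (\<Sum>i<k. \<Sum>j<l. F i j * measure unit_square (?A i \<times> ?B j))"
  proof -
    have "integrable unit_square (\<lambda>z. F i j * indicator (?A i \<times> ?B j) z)" for i j
      by (intro integrable_mult_right integrable_real_indicator)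
         (use AB in \<open>auto simp: I2.P.emeasure_eq_measure\<close>)
    note i = this
    have "(LINT z|unit_square. F i j * indicator (?A i \<times> ?B j) z)
        = F i j * measure unit_square (?A i \<times> ?B j)" for i j
    proof -
      have "?A i \<times> ?B j \<in> sets unit_square" using AB by auto
      then have "(LINT z|unit_square. indicator (?A i \<times> ?B j) z) = measure unit_square (?A i \<times> ?B j)"
        by (intro has_bochner_integral_integral_eq has_bochner_integral_real_indicator) (auto simp: I2.P.emeasure_eq_measure)
      then show ?thesis by (simp only: integral_mult_right_zero)
    qed
    then show ?thesis
      by (simp only: Bochner_Integration.integral_sum Bochner_Integration.integrable_sum i)
  qed
  also have "\<dots> = ?R" using AB by (simp add: measure_I2_Times mult.assoc)
  finally show "?L = ?R" .
qed

section \<open>Grid cells as the labelling behind empirical graphons\<close>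

definition cell :: "nat \<Rightarrow> real \<Rightarrow> nat" where
  "cell n x = nat \<lceil>real n * x\<rceil> - 1"

lemma cell_less: "0 < n \<Longrightarrow> x \<in> {0..1} \<Longrightarrow> cell n x < n"
proof -
  assume n: "0 < n" and x: "x \<in> {0..1}"
  have "real n * x \<le> real n" using x by (simp add: mult_left_le)
  then have "\<lceil>real n * x\<rceil> \<le> int n" by (simp add: ceiling_le_iff)
  then show ?thesis unfolding cell_def using n by linarith
qed

lemma cell_eq_iff:
  assumes "0 < n" "0 < x" "x \<le> 1"
  shows "cell n x = i \<longleftrightarrow> real i / n < x \<and> x \<le> (real i + 1) / n"
proof -
  have "0 < real n * x" using assms by simp
  then have "1 \<le> \<lceil>real n * x\<rceil>" by linarith
  then have "cell n x = i \<longleftrightarrow> \<lceil>real n * x\<rceil> = int i + 1" unfolding cell_def by linarith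
  also have "\<dots> \<longleftrightarrow> real i < real n * x \<and> real n * x \<le> real i + 1"
    by (simp add: ceiling_eq_iff)
  also have "\<dots> \<longleftrightarrow> real i / n < x \<and> x \<le> (real i + 1) / n"
    using assms by (simp add: field_simps)
  finally show ?thesis .
qed

lemma cell_0 [simp]: "cell n 0 = 0" by (simp add: cell_def)

lemma cell_measurable [measurable]: "cell n \<in> measurable I01 (count_space UNIV)"
proof -
  have "cell n \<in> measurable borel (count_space UNIV)" unfolding cell_def[abs_def] by measurable
  then show ?thesis by (simp add: I01_def measurable_restrict_space1)
qed

lemma sets_I01: "A \<in> sets I01 \<longleftrightarrow> A \<in> sets borel \<and> A \<subseteq> {0..1}"
  unfolding I01_def by (subst sets_restrict_space_iff) auto

lemma emeasure_I01: "A \<in> sets I01 \<Longrightarrow> emeasure I01 A = emeasure lborel A"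
  unfolding I01_def by (rule emeasure_restrict_space) (auto simp: sets_restrict_space_iff)

lemma measure_I01: "A \<in> sets I01 \<Longrightarrow> measure I01 A = measure lborel A"
  by (simp add: measure_def emeasure_I01)

lemma measure_cell:
  assumes "i < n"
  shows "measure I01 {x\<in>{0..1}. cell n x = i} = 1 / n"
proof -
  let ?J = "{real i / n<..(real i + 1) / n}"
  have n: "0 < n" using assms by simp
  have J: "?J \<subseteq> {0<..1}" 
  proof
    fix x assume x: "x \<in> ?J"
    have "0 \<le> real i / n" by simp
    moreover have "(real i + 1) / n \<le> 1" using assms by simp
    moreover have "real i / n < x" "x \<le> (real i + 1) / n" using x by auto
    ultimately have "0 < x" "x \<le> 1" by linarith+
    then show "x \<in> {0<..1}" by simp
  qed
  \<comment> \<open>The point 0 belongs to cell 0 but to none of the left-open intervals; it is a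
    null set.\<close>
  have eq: "{x\<in>{0..1}. cell n x = i} - {0} = ?J"
  proof (intro subset_antisym subsetI)
    fix x assume "x \<in> {x\<in>{0..1}. cell n x = i} - {0}"
    then show "x \<in> ?J" using cell_eq_iff[OF n, of x i] by auto
  next
    fix x assume x: "x \<in> ?J"
    with J have "x \<in> {0<..1}" by (rule subsetD)
    then show "x \<in> {x\<in>{0..1}. cell n x = i} - {0}"
      using cell_eq_iff[OF n, of x i] x by simp
  qed
  have sJ: "?J \<in> sets I01" using J by (auto simp: sets_I01)
  have s: "{x\<in>{0..1}. cell n x = i} \<in> sets I01"
    using measurable_sets[OF cell_measurable, of "{i}" n] by (simp add: vimage_def Int_def conj_commute)
  have "emeasure I01 {0} = 0" by (subst emeasure_I01) (auto simp: sets_I01)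
  then have "{0} \<in> null_sets I01" by (auto simp: sets_I01)
  then have "measure I01 {x\<in>{0..1}. cell n x = i} = measure I01 ({x\<in>{0..1}. cell n x = i} - {0})"
    using s by (simp only: measure_Diff_null_set)
  also have "\<dots> = measure lborel ?J" unfolding eq using sJ by (rule measure_I01)
  also have "\<dots> = (real i + 1) / n - real i / n"
    by (rule measure_lborel_Ioc) (simp add: divide_right_mono)
  also have "\<dots> = 1 / n" by (simp add: diff_divide_distrib[symmetric])
  finally show ?thesis .
qed

lemma empirical_graphon_cell: "empirical_graphon n B x y = B $$ (cell n x, cell n y)"
  by (simp add: empirical_graphon_def cell_def)

lemma kernel_empirical_graphon:
  assumes "0 < n"
  shows "integrable_kernel (empirical_graphon n B)"
proof -
  have "integrable_kernel (\<lambda>x y. indicator {0..1} x * indicator {0..1} y * B $$ (cell n x, cell n y))"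
    by (rule step_integral(2)[where F = "\<lambda>i j. B $$ (i, j)" and a = "cell n" and b = "cell n" and k = n and l = n])
       (simp_all add: assms cell_less sets_I01)
  moreover have "integrable_kernel (empirical_graphon n B)
    \<longleftrightarrow> integrable_kernel (\<lambda>x y. indicator {0..1} x * indicator {0..1} y * B $$ (cell n x, cell n y))"
    by (rule Bochner_Integration.integrable_cong) (auto simp: space_pair_measure empirical_graphon_cell)
  ultimately show ?thesis by simp
qed

text \<open>The weights \<open>s i\<close> and \<open>t j\<close> are the measures of the parts of
  \<open>S\<close> and \<open>T\<close> inside the cells. A measurable set can cut through cells, so
  these weights range over the whole interval from 0 to 1 / n.\<close>

lemma cut_norm_empirical_le:
  assumes "0 < n"
    and "\<And>s t. (\<And>i. i < n \<Longrightarrow> 0 \<le> s i \<and> s i \<le> 1 / n) \<Longrightarrow> (\<And>i. i < n \<Longrightarrow> 0 \<le> t i \<and> t i \<le> 1 / n) \<Longrightarrow>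
      \<bar>\<Sum>i<n. \<Sum>j<n. (A $$ (i, j) - B $$ (i, j)) * s i * t j\<bar> \<le> K"
  shows "cut_norm (\<lambda>x y. empirical_graphon n A x y - empirical_graphon n B x y) \<le> K"
proof (rule cut_norm_least)
  fix S T assume ST: "S \<in> sets I01" "T \<in> sets I01"
  have s: "0 \<le> measure I01 {x\<in>S. cell n x = i} \<and> measure I01 {x\<in>S. cell n x = i} \<le> 1 / n"
    if "i < n" "S \<in> sets I01" for S i
  proof -
    have "{x\<in>{0..1}. cell n x = i} \<in> sets I01"
      using measurable_sets[OF cell_measurable, of "{i}" n] by (simp add: vimage_def Int_def conj_commute)
    then have "measure I01 {x\<in>S. cell n x = i} \<le> measure I01 {x\<in>{0..1}. cell n x = i}"
      using sets.sets_into_space[OF that(2)] by (intro I01.finite_measure_mono) auto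
    then show ?thesis using measure_cell[OF that(1)] by simp
  qed
  have "(LINT z:S \<times> T|unit_square. case_prod (\<lambda>x y. empirical_graphon n A x y - empirical_graphon n B x y) z)
    = (LINT (x, y)|unit_square. indicator S x * indicator T y * (A $$ (cell n x, cell n y) - B $$ (cell n x, cell n y)))"
    unfolding set_lebesgue_integral_def
    by (intro Bochner_Integration.integral_cong) (auto simp: empirical_graphon_cell indicator_def)
  also have "\<dots> = (\<Sum>i<n. \<Sum>j<n. (A $$ (i, j) - B $$ (i, j)) * measure I01 {x\<in>S. cell n x = i} * measure I01 {y\<in>T. cell n y = j})"
    by (rule step_integral(1)[where F = "\<lambda>i j. A $$ (i, j) - B $$ (i, j)" and a = "cell n" and b = "cell n" and k = n and l = n])
       (simp_all add: assms(1) ST cell_less)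
  finally show "\<bar>LINT z:S \<times> T|unit_square. case_prod (\<lambda>x y. empirical_graphon n A x y - empirical_graphon n B x y) z\<bar> \<le> K"
    using assms(2)[OF s[OF _ ST(1)] s[OF _ ST(2)]] by simp
qed

subsection \<open>Deviation of the adjacency matrix from its mean\<close>

definition block_sum :: "real mat \<Rightarrow> real mat \<Rightarrow> nat set \<times> nat set \<Rightarrow> real" where
  "block_sum A B = (\<lambda>(S, T). \<Sum>i\<in>S. \<Sum>j\<in>T. A $$ (i, j) - B $$ (i, j))"

abbreviation "blocks n \<equiv> Pow {..<n::nat} \<times> Pow {..<n}"

text \<open>This is the unnormalised cut norm of the matrix \<open>A - B\<close>, a maximum over
  finitely many blocks, to which a union bound applies.\<close>

definition max_deviation :: "nat \<Rightarrow> real mat \<Rightarrow> real mat \<Rightarrow> real" where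
  "max_deviation n A B = Max ((\<lambda>b. \<bar>block_sum A B b\<bar>) ` blocks n)"

lemma block_sum_le_max_deviation: "b \<in> blocks n \<Longrightarrow> \<bar>block_sum A B b\<bar> \<le> max_deviation n A B"
  unfolding max_deviation_def by (rule Max_ge) auto

text \<open>A linear form on a box is largest when positive coefficients get the full weight
  \<open>h\<close> and all others get 0.\<close>

lemma weighted_sum_le_positive_part:
  fixes c s :: "nat \<Rightarrow> real"
  assumes "\<And>i. i < n \<Longrightarrow> 0 \<le> s i \<and> s i \<le> h"
  shows "(\<Sum>i<n. c i * s i) \<le> h * (\<Sum>i | i < n \<and> 0 < c i. c i)"
proof -
  have "(\<Sum>i<n. c i * s i) \<le> (\<Sum>i<n. if 0 < c i then h * c i else 0)"
  proof (rule sum_mono)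
    fix i assume "i \<in> {..<n}"
    then have "0 \<le> s i" "s i \<le> h" using assms by auto
    then show "c i * s i \<le> (if 0 < c i then h * c i else 0)"
      by (auto simp: mult.commute[of h] mult_left_mono mult_nonpos_nonneg not_less)
  qed
  also have "\<dots> = h * (\<Sum>i | i < n \<and> 0 < c i. c i)"
    by (simp add: sum_distrib_left sum.If_cases) (rule sum.cong, auto)
  finally show ?thesis .
qed

text \<open>A bilinear form is linear in each argument, so fractional weights can be rounded to a
  vertex of the box: first \<open>s\<close> with \<open>t\<close> fixed, which gives
  \<open>?S\<close>, then \<open>t\<close> with \<open>?S\<close> fixed, which gives
  \<open>?T\<close>.\<close>

lemma bilinear_le_block:
  fixes D :: "nat \<Rightarrow> nat \<Rightarrow> real"
  assumes s: "\<And>i. i < n \<Longrightarrow> 0 \<le> s i \<and> s i \<le> h" and t: "\<And>i. i < n \<Longrightarrow> 0 \<le> t i \<and> t i \<le> h" and "0 \<le> h"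
  shows "\<exists>S T. S \<subseteq> {..<n} \<and> T \<subseteq> {..<n} \<and>
    (\<Sum>i<n. \<Sum>j<n. D i j * s i * t j) \<le> h\<^sup>2 * (\<Sum>i\<in>S. \<Sum>j\<in>T. D i j)"
proof -
  let ?c = "\<lambda>i. \<Sum>j<n. D i j * t j"
  let ?S = "{i. i < n \<and> 0 < ?c i}"
  let ?d = "\<lambda>j. \<Sum>i\<in>?S. D i j"
  let ?T = "{j. j < n \<and> 0 < ?d j}"
  have "(\<Sum>i<n. \<Sum>j<n. D i j * s i * t j) = (\<Sum>i<n. ?c i * s i)"
    by (simp add: sum_distrib_left sum_distrib_right mult_ac)
  also have "\<dots> \<le> h * (\<Sum>i\<in>?S. ?c i)"
    using s by (rule weighted_sum_le_positive_part)
  also have "(\<Sum>i\<in>?S. ?c i) = (\<Sum>j<n. ?d j * t j)"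
    by (subst sum.swap) (simp add: sum_distrib_right)
  also have "h * \<dots> \<le> h * (h * (\<Sum>j\<in>?T. ?d j))"
    using weighted_sum_le_positive_part[of n t h, OF t] \<open>0 \<le> h\<close> by (intro mult_left_mono)
  also have "\<dots> = h\<^sup>2 * (\<Sum>i\<in>?S. \<Sum>j\<in>?T. D i j)"
    by (subst sum.swap) (simp add: power2_eq_square)
  finally show ?thesis by (intro exI[of _ ?S] exI[of _ ?T]) auto
qed

lemma cut_norm_le_max_deviation:
  assumes "0 < n"
  shows "cut_norm (\<lambda>x y. empirical_graphon n A x y - empirical_graphon n B x y) \<le> max_deviation n A B / (real n)\<^sup>2"
proof (rule cut_norm_empirical_le[OF assms])
  fix s t :: "nat \<Rightarrow> real"
  assume s: "\<And>i. i < n \<Longrightarrow> 0 \<le> s i \<and> s i \<le> 1 / n" and t: "\<And>i. i < n \<Longrightarrow> 0 \<le> t i \<and> t i \<le> 1 / n"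
  have "(\<Sum>i<n. \<Sum>j<n. D i j * s i * t j) \<le> max_deviation n A B / (real n)\<^sup>2"
    if D: "\<And>S T. S \<subseteq> {..<n} \<Longrightarrow> T \<subseteq> {..<n} \<Longrightarrow> (\<Sum>i\<in>S. \<Sum>j\<in>T. D i j) \<le> max_deviation n A B" for D
  proof -
    obtain S T where "S \<subseteq> {..<n}" "T \<subseteq> {..<n}"
      "(\<Sum>i<n. \<Sum>j<n. D i j * s i * t j) \<le> (1 / n)\<^sup>2 * (\<Sum>i\<in>S. \<Sum>j\<in>T. D i j)"
      using bilinear_le_block[of n s "1 / n" t D] s t by auto
    moreover have "(1 / n)\<^sup>2 * (\<Sum>i\<in>S. \<Sum>j\<in>T. D i j) \<le> (1 / n)\<^sup>2 * max_deviation n A B"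
      using D calculation by (intro mult_left_mono) auto
    ultimately show ?thesis by (simp add: power_divide)
  qed
  \<comment> \<open>The rounding is one-sided; using it for the difference and for its negative
    gives the absolute value.\<close>
  note this[of "\<lambda>i j. A $$ (i, j) - B $$ (i, j)"] this[of "\<lambda>i j. - (A $$ (i, j) - B $$ (i, j))"]
  moreover have "(\<Sum>i\<in>S. \<Sum>j\<in>T. A $$ (i, j) - B $$ (i, j)) \<le> max_deviation n A B"
    "(\<Sum>i\<in>S. \<Sum>j\<in>T. - (A $$ (i, j) - B $$ (i, j))) \<le> max_deviation n A B"
    if "S \<subseteq> {..<n}" "T \<subseteq> {..<n}" for S T
    using block_sum_le_max_deviation[of "(S, T)" n A B] that
    by (simp_all add: block_sum_def sum_negf del: minus_diff_eq)
  ultimately have "(\<Sum>i<n. \<Sum>j<n. (A $$ (i, j) - B $$ (i, j)) * s i * t j) \<le> max_deviation n A B / (real n)\<^sup>2"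
    "(\<Sum>i<n. \<Sum>j<n. - (A $$ (i, j) - B $$ (i, j)) * s i * t j) \<le> max_deviation n A B / (real n)\<^sup>2"
    by blast+
  then show "\<bar>\<Sum>i<n. \<Sum>j<n. (A $$ (i, j) - B $$ (i, j)) * s i * t j\<bar> \<le> max_deviation n A B / (real n)\<^sup>2"
    by (simp add: sum_negf abs_le_iff del: minus_diff_eq)
qed

section \<open>Exponential moments of the centred adjacency matrix\<close>

lemma exp_le_quadratic:
  assumes "\<bar>z\<bar> \<le> (1::real)"
  shows "exp z \<le> 1 + z + z\<^sup>2"
proof (cases "0 \<le> z")
  case True
  then show ?thesis using assms exp_bound[of z] by simp
next
  case False
  define w where "w = - z"
  have w: "0 < w" "w \<le> 1" using False assms by (auto simp: w_def)
  have "exp z = 1 / exp w" by (simp add: w_def exp_minus field_simps)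
  also have "\<dots> \<le> 1 / (1 + w)" using w exp_ge_add_one_self[of w] by (intro divide_left_mono) auto
  also have "\<dots> \<le> 1 - w + w\<^sup>2"
  proof -
    have "(1 - w + w\<^sup>2) * (1 + w) = 1 + w ^ 3" by (simp add: power2_eq_square power3_eq_cube algebra_simps)
    then have "1 \<le> (1 - w + w\<^sup>2) * (1 + w)" using w by simp
    then show ?thesis using w by (simp add: divide_le_eq)
  qed
  finally show ?thesis by (simp add: w_def)
qed

text \<open>A Bernstein type bound: the exponent is proportional to \<open>p\<close>, the size of
  the variance in the sparse regime, and not merely to the squared range. It comes from 1 + x \<le>
  exp x after bounding \<open>exp z - 1\<close> by \<open>z + z\<^sup>2\<close>.\<close>

lemma bernoulli_centred_mgf:
  assumes p: "0 \<le> p" "p \<le> 1" and z: "\<bar>z\<bar> \<le> 1"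
  shows "measure_pmf.expectation (bernoulli_pmf p) (\<lambda>b. exp (z * (of_bool b - p))) \<le> exp (z\<^sup>2 * p)"
proof -
  have "measure_pmf.expectation (bernoulli_pmf p) (\<lambda>b. exp (z * (of_bool b - p)))
      = exp (- (z * p)) * (1 + p * (exp z - 1))"
    using p by (simp add: exp_diff exp_minus algebra_simps field_simps)
  also have "\<dots> \<le> exp (- (z * p)) * exp (p * (z + z\<^sup>2))"
  proof (rule mult_left_mono)
    have "1 + p * (exp z - 1) \<le> 1 + p * (z + z\<^sup>2)"
      using exp_le_quadratic[OF z] p by (intro add_left_mono mult_left_mono) auto
    also have "\<dots> \<le> exp (p * (z + z\<^sup>2))" by (rule exp_ge_add_one_self)
    finally show "1 + p * (exp z - 1) \<le> exp (p * (z + z\<^sup>2))" .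
  qed simp
  also have "\<dots> = exp (z\<^sup>2 * p)" by (simp add: exp_add[symmetric] algebra_simps)
  finally show ?thesis .
qed

abbreviation "edges n \<equiv> {(i, j). i < j \<and> j < (n::nat)}"

lemma finite_edges: "finite (edges n)"
  by (rule finite_subset[of _ "{..<n} \<times> {..<n}"]) auto

text \<open>The entries at (i, j) and (j, i) of the adjacency matrix are the same random variable.
  Rewriting a block sum over pairs \<open>i < j\<close>, with multiplicity 0, 1 or 2, exposes
  independent summands.\<close>

lemma sum_symmetric_block:
  fixes D :: "nat \<Rightarrow> nat \<Rightarrow> real"
  assumes sym: "\<And>i j. i < n \<Longrightarrow> j < n \<Longrightarrow> D i j = D j i" and diag: "\<And>i. i < n \<Longrightarrow> D i i = 0"
    and "S \<subseteq> {..<n}" "T \<subseteq> {..<n}"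
  shows "(\<Sum>i\<in>S. \<Sum>j\<in>T. D i j) =
    (\<Sum>(i, j)\<in>edges n. (of_bool (i \<in> S \<and> j \<in> T) + of_bool (j \<in> S \<and> i \<in> T)) * D i j)"
proof -
  let ?F = "\<lambda>(i, j). of_bool (i \<in> S \<and> j \<in> T) * D i j"
  let ?G = "{(i, j). j < i \<and> i < n}"
  have fG: "finite ?G" by (rule finite_subset[of _ "{..<n} \<times> {..<n}"]) auto
  have fS: "finite S" "finite T" using assms(3,4) finite_subset by blast+
  have "(\<Sum>i\<in>S. \<Sum>j\<in>T. D i j) = (\<Sum>z\<in>S \<times> T. ?F z)"
    unfolding sum.cartesian_product by (rule sum.cong) auto
  also have "\<dots> = (\<Sum>z\<in>edges n \<union> ?G. ?F z)"
  proof (rule sum.mono_neutral_cong)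
    show "?F z = 0" if "z \<in> S \<times> T - (edges n \<union> ?G)" for z
      using that diag assms(3,4) by (auto simp: subset_iff not_less split: prod.splits)
  qed (use finite_edges fG fS in auto)
  also have "\<dots> = (\<Sum>z\<in>edges n. ?F z) + (\<Sum>z\<in>?G. ?F z)"
    by (rule sum.union_disjoint) (use finite_edges fG in auto)
  also have "(\<Sum>z\<in>?G. ?F z) = (\<Sum>(i, j)\<in>edges n. of_bool (j \<in> S \<and> i \<in> T) * D i j)"
    by (rule sum.reindex_bij_witness[of _ prod.swap prod.swap]) (auto simp: sym)
  finally show ?thesis by (simp add: sum.distrib[symmetric] case_prod_beta' ring_distribs)
qed

text \<open>Independence factorises the moment over the edges. The multiplicity \<open>c\<close> is
  at most 2, hence the range 1 / 2 for \<open>u\<close>, which keeps \<open>u * c ij\<close> within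
  [-1, 1], and the factor 4, which bounds the square of the multiplicity.\<close>

lemma adjacency_block_mgf:
  assumes \<Theta>: "\<And>i j. i < n \<Longrightarrow> j < n \<Longrightarrow> 0 \<le> \<Theta> $$ (i, j) \<and> \<Theta> $$ (i, j) \<le> 1 \<and> \<Theta> $$ (i, j) = \<Theta> $$ (j, i)"
    and diag: "\<And>i. i < n \<Longrightarrow> \<Theta> $$ (i, i) = 0"
    and u: "\<bar>u\<bar> \<le> 1 / 2" and b: "b \<in> blocks n"
  shows "measure_pmf.expectation (adjacency_pmf n \<Theta>) (\<lambda>A. exp (u * block_sum A \<Theta> b))
    \<le> exp (4 * u\<^sup>2 * (\<Sum>ij\<in>edges n. \<Theta> $$ ij))"
proof -
  obtain S T where ST: "b = (S, T)" "S \<subseteq> {..<n}" "T \<subseteq> {..<n}" using b by auto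
  define c :: "nat \<times> nat \<Rightarrow> real" where "c = (\<lambda>(i, j). of_bool (i \<in> S \<and> j \<in> T) + of_bool (j \<in> S \<and> i \<in> T))"
  let ?p = "\<lambda>ij. bernoulli_pmf (\<Theta> $$ ij)"
  have bs: "block_sum (adjacency_matrix n e) \<Theta> b = (\<Sum>ij\<in>edges n. c ij * (of_bool (e ij) - \<Theta> $$ ij))" for e
  proof -
    have "block_sum (adjacency_matrix n e) \<Theta> b =
       (\<Sum>(i, j)\<in>edges n. (of_bool (i \<in> S \<and> j \<in> T) + of_bool (j \<in> S \<and> i \<in> T)) *
         (adjacency_matrix n e $$ (i, j) - \<Theta> $$ (i, j)))"
      unfolding ST block_sum_def case_prod_conv
      by (rule sum_symmetric_block[OF _ _ ST(2,3)])
         (use \<Theta> diag in \<open>auto simp: adjacency_matrix_def min.commute max.commute\<close>)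
    then show ?thesis by (auto simp: c_def adjacency_matrix_def intro!: sum.cong)
  qed
  have "measure_pmf.expectation (adjacency_pmf n \<Theta>) (\<lambda>A. exp (u * block_sum A \<Theta> b))
      = measure_pmf.expectation (Pi_pmf (edges n) False ?p) (\<lambda>e. \<Prod>ij\<in>edges n. exp (u * c ij * (of_bool (e ij) - \<Theta> $$ ij)))"
    unfolding adjacency_pmf_def by (simp add: bs exp_sum[OF finite_edges] sum_distrib_left mult.assoc)
  also have "\<dots> = (\<Prod>ij\<in>edges n. measure_pmf.expectation (?p ij) (\<lambda>e. exp (u * c ij * (of_bool e - \<Theta> $$ ij))))"
    by (rule expectation_prod_Pi_pmf[OF finite_edges]) (auto intro: integrable_measure_pmf_finite)
  also have "\<dots> \<le> (\<Prod>ij\<in>edges n. exp (4 * u\<^sup>2 * \<Theta> $$ ij))"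
  proof (rule prod_mono)
    fix ij assume "ij \<in> edges n"
    then obtain i j where ij: "ij = (i, j)" "i < n" "j < n" by auto
    have t: "0 \<le> \<Theta> $$ ij" "\<Theta> $$ ij \<le> 1" using \<Theta> ij by auto
    have c2: "0 \<le> c ij" "c ij \<le> 2" by (auto simp: c_def ij)
    have "\<bar>u * c ij\<bar> \<le> 1 / 2 * 2" unfolding abs_mult using u c2 by (intro mult_mono) auto
    then have "measure_pmf.expectation (?p ij) (\<lambda>e. exp (u * c ij * (of_bool e - \<Theta> $$ ij))) \<le> exp ((u * c ij)\<^sup>2 * \<Theta> $$ ij)"
      by (intro bernoulli_centred_mgf t) simp
    also have "\<dots> \<le> exp (4 * u\<^sup>2 * \<Theta> $$ ij)"
    proof -
      have "(c ij)\<^sup>2 \<le> 2\<^sup>2" using c2 by (intro power_mono) auto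
      then have "u\<^sup>2 * (c ij)\<^sup>2 * \<Theta> $$ ij \<le> u\<^sup>2 * 4 * \<Theta> $$ ij"
        using t by (intro mult_right_mono mult_left_mono) auto
      then show ?thesis by (simp add: power_mult_distrib mult_ac)
    qed
    finally show "0 \<le> measure_pmf.expectation (?p ij) (\<lambda>e. exp (u * c ij * (of_bool e - \<Theta> $$ ij))) \<and>
       measure_pmf.expectation (?p ij) (\<lambda>e. exp (u * c ij * (of_bool e - \<Theta> $$ ij))) \<le> exp (4 * u\<^sup>2 * \<Theta> $$ ij)"
      by simp
  qed
  also have "\<dots> = exp (4 * u\<^sup>2 * (\<Sum>ij\<in>edges n. \<Theta> $$ ij))"
    by (simp add: exp_sum[OF finite_edges] sum_distrib_left)
  finally show ?thesis .
qed

lemma finite_set_adjacency_pmf: "finite (set_pmf (adjacency_pmf n \<Theta>))"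
proof -
  have "set_pmf (Pi_pmf (edges n) False (\<lambda>ij. bernoulli_pmf (\<Theta> $$ ij))) \<subseteq> PiE_dflt (edges n) False (\<lambda>_. UNIV)"
  proof
    fix e assume "e \<in> set_pmf (Pi_pmf (edges n) False (\<lambda>ij. bernoulli_pmf (\<Theta> $$ ij)))"
    then have "e \<in> {f. \<forall>ij. ij \<notin> edges n \<longrightarrow> f ij = False}"
      by (rule subsetD[OF set_Pi_pmf_subset[OF finite_edges]])
    then show "e \<in> PiE_dflt (edges n) False (\<lambda>_. UNIV)" unfolding PiE_dflt_def by blast
  qed
  moreover have "finite (PiE_dflt (edges n) False (\<lambda>_. UNIV :: bool set))"
    using finite_edges by (intro finite_PiE_dflt) auto
  ultimately show ?thesis by (simp add: adjacency_pmf_def finite_subset)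
qed

text \<open>The exponential of the maximum is at most the sum \<open>Y\<close> of the exponentials
  over all blocks and both signs. The expectation of the maximum is then bounded directly through
  the logarithm, without passing through tail probabilities.\<close>

lemma expectation_max_deviation:
  assumes \<Theta>: "\<And>i j. i < n \<Longrightarrow> j < n \<Longrightarrow> 0 \<le> \<Theta> $$ (i, j) \<and> \<Theta> $$ (i, j) \<le> 1 \<and> \<Theta> $$ (i, j) = \<Theta> $$ (j, i)"
    and diag: "\<And>i. i < n \<Longrightarrow> \<Theta> $$ (i, i) = 0"
    and u: "0 < u" "u \<le> 1 / 2"
  shows "measure_pmf.expectation (adjacency_pmf n \<Theta>) (\<lambda>A. max_deviation n A \<Theta>)
    \<le> (ln 2 + 2 * real n * ln 2) / u + 4 * u * (\<Sum>ij\<in>edges n. \<Theta> $$ ij)"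
proof -
  let ?P = "adjacency_pmf n \<Theta>"
  let ?E = "measure_pmf.expectation ?P"
  define v where "v = (\<Sum>ij\<in>edges n. \<Theta> $$ ij)"
  \<comment> \<open>An upper bound for the mean of \<open>Y\<close>: two signs, \<open>4 ^ n\<close>
    pairs of vertex sets, and the moment bound for each.\<close>
  define M where "M = 2 * 4 ^ n * exp (4 * u\<^sup>2 * v)"
  define Y where "Y A = (\<Sum>b\<in>blocks n. exp (u * block_sum A \<Theta> b) + exp (- u * block_sum A \<Theta> b))" for A
  have int: "integrable (measure_pmf ?P) (f :: _ \<Rightarrow> real)" for f
    by (rule integrable_measure_pmf_finite[OF finite_set_adjacency_pmf])
  have "0 < M" by (simp add: M_def)
  \<comment> \<open>The logarithm lies below its tangent at \<open>M\<close>. Taking expectations of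
    this linear bound replaces Jensen's inequality.\<close>
  have pw: "u * max_deviation n A \<Theta> \<le> Y A / M + ln M - 1" for A
  proof -
    have "max_deviation n A \<Theta> \<in> (\<lambda>b. \<bar>block_sum A \<Theta> b\<bar>) ` blocks n"
      unfolding max_deviation_def by (rule Max_in) auto
    then obtain b where b: "b \<in> blocks n" "max_deviation n A \<Theta> = \<bar>block_sum A \<Theta> b\<bar>" by blast
    have "exp (u * max_deviation n A \<Theta>) \<le> exp (u * block_sum A \<Theta> b) + exp (- u * block_sum A \<Theta> b)"
      using u by (auto simp: b(2) abs_if)
    also have "\<dots> \<le> Y A" unfolding Y_def by (rule member_le_sum[OF b(1)]) (auto intro: add_nonneg_nonneg)
    finally have e: "exp (u * max_deviation n A \<Theta>) \<le> Y A" .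
    then have "0 < Y A" using exp_gt_zero less_le_trans by blast
    have "u * max_deviation n A \<Theta> \<le> ln (Y A)" using e \<open>0 < Y A\<close> by (simp add: ln_ge_iff)
    also have "ln (Y A) = ln (Y A / M) + ln M" using \<open>0 < Y A\<close> \<open>0 < M\<close> by (simp add: ln_div)
    also have "ln (Y A / M) \<le> Y A / M - 1" using \<open>0 < Y A\<close> \<open>0 < M\<close> by (intro ln_le_minus_one) auto
    finally show ?thesis by simp
  qed
  have "?E Y = (\<Sum>b\<in>blocks n. ?E (\<lambda>A. exp (u * block_sum A \<Theta> b)) + ?E (\<lambda>A. exp (- u * block_sum A \<Theta> b)))"
    unfolding Y_def by (simp add: Bochner_Integration.integral_sum int Bochner_Integration.integral_add)
  also have "\<dots> \<le> (\<Sum>b\<in>blocks n. exp (4 * u\<^sup>2 * v) + exp (4 * u\<^sup>2 * v))"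
    using u adjacency_block_mgf[of n \<Theta> u, OF \<Theta> diag] adjacency_block_mgf[of n \<Theta> "- u", OF \<Theta> diag]
    by (intro sum_mono add_mono) (simp_all add: v_def)
  also have "\<dots> = M" by (simp add: M_def card_cartesian_product card_Pow power_mult_distrib[symmetric])
  finally have EY: "?E Y \<le> M" .
  have "u * ?E (\<lambda>A. max_deviation n A \<Theta>) = ?E (\<lambda>A. u * max_deviation n A \<Theta>)" by simp
  also have "\<dots> \<le> ?E (\<lambda>A. Y A / M + (ln M - 1))"
    using pw by (intro integral_mono int) (simp add: algebra_simps)
  also have "\<dots> = ?E Y / M + (ln M - 1)"
    by (subst Bochner_Integration.integral_add) (auto intro: int)
  also have "\<dots> \<le> ln M" using EY \<open>0 < M\<close> by (simp add: divide_le_eq)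
  also have "\<dots> = ln 2 + 2 * real n * ln 2 + 4 * u\<^sup>2 * v"
  proof -
    have "ln (4::real) = 2 * ln 2" using ln_realpow[of 2 2] by simp
    then show ?thesis by (simp add: M_def ln_mult ln_realpow)
  qed
  finally have "?E (\<lambda>A. max_deviation n A \<Theta>) \<le> (ln 2 + 2 * real n * ln 2 + 4 * u\<^sup>2 * v) / u"
    using u by (simp add: le_divide_eq mult.commute)
  also have "\<dots> = (ln 2 + 2 * real n * ln 2) / u + 4 * u * v"
    using u by (simp add: add_divide_distrib power2_eq_square)
  finally show ?thesis by (simp add: v_def)
qed

subsection \<open>Matching the labels of two partitions\<close>

lemma measure_cell_Collect:
  assumes "0 < n"
  shows "measure I01 {x\<in>{0..1}. P (cell n x)} = card {i. i < n \<and> P i} / n"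
proof -
  have s: "{x\<in>{0..1}. cell n x = i} \<in> sets I01" for i
    using measurable_sets[OF cell_measurable, of "{i}" n] by (simp add: vimage_def Int_def conj_commute)
  have "{x\<in>{0..1}. P (cell n x)} = (\<Union>i\<in>{i. i < n \<and> P i}. {x\<in>{0..1}. cell n x = i})"
    using cell_less[OF assms] by auto
  then have "measure I01 {x\<in>{0..1}. P (cell n x)} = (\<Sum>i\<in>{i. i < n \<and> P i}. measure I01 {x\<in>{0..1}. cell n x = i})"
    using s by (simp only:) (rule I01.finite_measure_finite_Union, auto simp: disjoint_family_on_def)
  also have "\<dots> = card {i. i < n \<and> P i} / n"
  proof -
    have "(\<Sum>i\<in>{i. i < n \<and> P i}. measure I01 {x\<in>{0..1}. cell n x = i}) = (\<Sum>i\<in>{i. i < n \<and> P i}. 1 / n)"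
      by (rule sum.cong[OF refl], rule measure_cell) simp
    then show ?thesis by simp
  qed
  finally show ?thesis .
qed

text \<open>Refining the grid by a factor \<open>m\<close> lets the sample labels, constant on
  \<open>n\<close> cells, and the approximation of \<open>\<phi>\<close> live on one common
  grid.\<close>

lemma cell_mult_div:
  assumes "0 < n" "0 < m" "x \<in> {0..1}"
  shows "cell n x = cell (n * m) x div m"
proof (cases "x = 0")
  case False
  then have x: "0 < x" "x \<le> 1" using assms by auto
  let ?c = "cell (n * m) x"
  have c: "real ?c / real (n * m) < x" "x \<le> (real ?c + 1) / real (n * m)"
    using cell_eq_iff[of "n * m" x ?c] x assms by auto
  have "real (?c div m * m) \<le> real ?c" using div_times_less_eq_dividend of_nat_le_iff by blast
  then have "real (?c div m) \<le> real ?c / m" using assms by (simp add: field_simps)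
  then have 1: "real (?c div m) / n \<le> real ?c / real (n * m)"
    using assms divide_right_mono[of "real (?c div m)" "real ?c / m" "real n"] by (simp add: mult.commute)
  have "?c < (?c div m + 1) * m"
    using assms by (metis add.commute dividend_less_times_div mult.commute mult_Suc_right plus_1_eq_Suc)
  then have "?c + 1 \<le> (?c div m + 1) * m" by simp
  then have "real (?c + 1) \<le> real ((?c div m + 1) * m)" by (simp only: of_nat_le_iff)
  then have "(real ?c + 1) / m \<le> real (?c div m) + 1" using assms by (simp add: field_simps)
  then have 2: "(real ?c + 1) / real (n * m) \<le> (real (?c div m) + 1) / n"
    using assms divide_right_mono[of "(real ?c + 1) / m" "real (?c div m) + 1" "real n"] by (simp add: mult.commute)
  show ?thesis using cell_eq_iff[OF assms(1) x, of "?c div m"] c 1 2 by auto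
qed simp

lemma cell_eq_dist:
  assumes "0 < n" "x \<in> {0..1}" "y \<in> {0..1}" "cell n x = cell n y"
  shows "\<bar>x - y\<bar> \<le> 1 / n"
proof -
  have "real (cell n x) / n \<le> x \<and> x \<le> (real (cell n x) + 1) / n" if "x \<in> {0..1}" for x
    using cell_eq_iff[OF assms(1), of x "cell n x"] that by (cases "x = 0") auto
  from this[OF assms(2)] this[OF assms(3)] show ?thesis
    using assms(4) by (simp add: add_divide_distrib abs_le_iff)
qed

text \<open>The cells are the intervals \<open>(c / N, (c + 1) / N]\<close>, so the point \<open>0\<close> is kept fixed.\<close>

definition grid_map :: "nat \<Rightarrow> (nat \<Rightarrow> nat) \<Rightarrow> real \<Rightarrow> real" where
  "grid_map N \<pi> x = (if x = 0 then 0 else x + (real (\<pi> (cell N x)) - real (cell N x)) / N)"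

lemma grid_map_cell:
  assumes "\<pi> permutes {..<N}" "0 < x" "x \<le> 1" "0 < N"
  shows "0 < grid_map N \<pi> x" "grid_map N \<pi> x \<le> 1" "cell N (grid_map N \<pi> x) = \<pi> (cell N x)"
proof -
  let ?c = "cell N x" and ?y = "grid_map N \<pi> x"
  have c: "real ?c / N < x" "x \<le> (real ?c + 1) / N" using cell_eq_iff[of N x ?c] assms by auto
  have "?c < N" using cell_less assms by auto
  then have p: "\<pi> ?c < N" using permutes_in_image[OF assms(1), of ?c] by simp
  have y: "real (\<pi> ?c) / N < ?y" "?y \<le> (real (\<pi> ?c) + 1) / N"
    using c assms by (auto simp: grid_map_def add_divide_distrib diff_divide_distrib)
  have "0 \<le> real (\<pi> ?c) / N" by simp
  with y(1) show p0: "0 < ?y" by linarith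
  have "(real (\<pi> ?c) + 1) / N \<le> 1" using p by simp
  with y(2) show p1: "?y \<le> 1" by linarith
  show "cell N ?y = \<pi> ?c" using cell_eq_iff[OF assms(4) p0 p1] y by blast
qed

lemma grid_map_inverse:
  assumes \<pi>: "\<pi> permutes {..<N}" and x: "x \<in> {0..1}" and N: "0 < N"
  shows "grid_map N (inv_into UNIV \<pi>) (grid_map N \<pi> x) = x"
proof (cases "x = 0")
  case False
  then have x: "0 < x" "x \<le> 1" using x by auto
  show ?thesis
    using grid_map_cell[OF \<pi> x N] permutes_inverses(2)[OF \<pi>, of "cell N x"] False
    unfolding grid_map_def[of N "inv_into UNIV \<pi>"]
    by (simp add: grid_map_def add_divide_distrib diff_divide_distrib)
qed (simp add: grid_map_def)

lemma grid_map_range: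
  assumes \<pi>: "\<pi> permutes {..<N}" and x: "x \<in> {0..1}" and N: "0 < N"
  shows "grid_map N \<pi> x \<in> {0..1}"
  using grid_map_cell(1,2)[OF \<pi> _ _ N, of x] x by (cases "x = 0") (auto simp: grid_map_def)

lemma emeasure_I01_cells:
  assumes "X \<in> sets I01" "0 < N"
  shows "emeasure I01 X = (\<Sum>c<N. emeasure lborel (X \<inter> {real c / N<..(real c + 1) / N}))"
proof -
  let ?J = "\<lambda>c. {real c / N<..(real c + 1) / N}"
  have X: "X \<in> sets borel" "X \<subseteq> {0..1}" using assms(1) by (auto simp: sets_I01)
  have "emeasure I01 X = emeasure lborel X" by (rule emeasure_I01) fact
  also have "\<dots> = emeasure lborel (X - {0})"
    using X by (intro emeasure_Diff_null_set[symmetric]) auto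
  also have "X - {0} = (\<Union>c<N. X \<inter> ?J c)"
  proof (intro subset_antisym subsetI)
    fix x assume x: "x \<in> X - {0}"
    then have "0 < x" "x \<le> 1" using X by force+
    then have "x \<in> ?J (cell N x)" "cell N x < N"
      using cell_eq_iff[OF assms(2), of x "cell N x"] cell_less[OF assms(2), of x] by auto
    then show "x \<in> (\<Union>c<N. X \<inter> ?J c)" using x by blast
  next
    fix x assume "x \<in> (\<Union>c<N. X \<inter> ?J c)"
    then obtain c where "x \<in> X" "real c / N < x" by auto
    moreover have "0 \<le> real c / N" by simp
    ultimately have "x \<in> X" "0 < x" by linarith+
    then show "x \<in> X - {0}" by simp
  qed
  also have "emeasure lborel \<dots> = (\<Sum>c<N. emeasure lborel (X \<inter> ?J c))"
  proof (rule sum_emeasure[symmetric])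
    have "c = d" if "x \<in> ?J c" "x \<in> ?J d" for x c d
    proof -
      have "real c < N * x" "N * x \<le> real c + 1" "real d < N * x" "N * x \<le> real d + 1"
        using that assms(2) by (simp_all add: field_simps)
      then have "real c < real d + 1" "real d < real c + 1" by linarith+
      then show ?thesis by linarith
    qed
    then show "disjoint_family_on (\<lambda>c. X \<inter> ?J c) {..<N}" unfolding disjoint_family_on_def by blast
  qed (use X in auto)
  finally show ?thesis .
qed

lemma emeasure_lborel_translate:
  assumes "A \<in> sets borel"
  shows "emeasure lborel ((\<lambda>x. t + x) -` A) = emeasure lborel (A :: real set)"
proof -
  have "emeasure lborel A = emeasure (distr lborel borel ((+) t)) A"
    by (simp add: lborel_distr_plus)
  also have "\<dots> = emeasure lborel ((\<lambda>x. t + x) -` A)"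
    using assms by (subst emeasure_distr) auto
  finally show ?thesis by simp
qed

text \<open>The map translates each cell onto another cell, so translation invariance preserves the
  measure cell by cell and \<open>\<pi>\<close> only permutes the summands. The inverse permutation
  provides the inverse map.\<close>

lemma grid_map_mp_bijection:
  assumes \<pi>: "\<pi> permutes {..<N}" and N: "0 < N"
  shows "grid_map N \<pi> \<in> mp_bijections"
proof -
  let ?g = "grid_map N \<pi>"
  have [measurable]: "cell N \<in> measurable borel (count_space UNIV)"
    unfolding cell_def[abs_def] by measurable
  have "?g \<in> borel_measurable borel"
    unfolding grid_map_def[abs_def] by measurable
  then have "?g \<in> measurable I01 lborel"
    unfolding I01_def by (intro measurable_restrict_space1) simp
  then have meas: "?g \<in> measurable I01 I01"
    by (subst (2) I01_def, intro measurable_restrict_space2) (use grid_map_range[OF \<pi> _ N] in auto)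
  have bij: "bij_betw ?g {0..1} {0..1}"
    by (rule bij_betw_byWitness[of _ "grid_map N (inv_into UNIV \<pi>)"])
       (use grid_map_inverse[OF \<pi> _ N] grid_map_inverse[OF permutes_inv[OF \<pi>] _ N]
          grid_map_range[OF \<pi> _ N] grid_map_range[OF permutes_inv[OF \<pi>] _ N]
          permutes_inv_inv[OF \<pi>] in \<open>auto simp del: atLeastAtMost_iff\<close>)
  have "distr I01 I01 ?g = I01"
  proof (rule measure_eqI)
    fix A assume "A \<in> sets (distr I01 I01 ?g)"
    then have A: "A \<in> sets I01" by simp
    let ?J = "\<lambda>c. {real c / N<..(real c + 1) / N}"
    let ?X = "?g -` A \<inter> space I01"
    have X: "?X \<in> sets I01" using meas A by (rule measurable_sets)
    have J: "?X \<inter> ?J c = (\<lambda>x. (real (\<pi> c) - real c) / N + x) -` (A \<inter> ?J (\<pi> c))" if c: "c < N" for c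
    proof -
      have "x \<in> ?X \<inter> ?J c \<longleftrightarrow> (real (\<pi> c) - real c) / N + x \<in> A \<inter> ?J (\<pi> c)" for x
      proof (cases "x \<in> ?J c")
        case True
        have "0 \<le> real c / N" "(real c + 1) / N \<le> 1" using c by simp_all
        moreover have "real c / N < x" "x \<le> (real c + 1) / N" using True by auto
        ultimately have x: "0 < x" "x \<le> 1" by linarith+
        then have "cell N x = c" using cell_eq_iff[OF N x] True by auto
        then have "?g x = (real (\<pi> c) - real c) / N + x" using x by (simp add: grid_map_def)
        then show ?thesis using True x by (auto simp: add_divide_distrib diff_divide_distrib)
      next
        case False
        then show ?thesis by (auto simp: add_divide_distrib diff_divide_distrib)
      qed
      then show ?thesis by blast
    qed
    have "emeasure (distr I01 I01 ?g) A = emeasure I01 ?X" by (rule emeasure_distr[OF meas A])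
    also have "\<dots> = (\<Sum>c<N. emeasure lborel (?X \<inter> ?J c))" by (rule emeasure_I01_cells[OF X N])
    also have "\<dots> = (\<Sum>c<N. emeasure lborel (A \<inter> ?J (\<pi> c)))"
    proof (rule sum.cong[OF refl])
      fix c assume "c \<in> {..<N}"
      then have c: "c < N" by simp
      show "emeasure lborel (?X \<inter> ?J c) = emeasure lborel (A \<inter> ?J (\<pi> c))"
        unfolding J[OF c] by (rule emeasure_lborel_translate) (use A in \<open>auto simp: sets_I01\<close>)
    qed
    also have "\<dots> = (\<Sum>c<N. emeasure lborel (A \<inter> ?J c))"
      by (rule sum.permute[OF \<pi>, symmetric, unfolded comp_def])
    also have "\<dots> = emeasure I01 A" by (rule emeasure_I01_cells[OF A N, symmetric])
    finally show "emeasure (distr I01 I01 ?g) A = emeasure I01 A" .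
  qed simp
  then show ?thesis using meas bij by (simp add: mp_bijections_def)
qed

text \<open>A permutation with the largest number of agreements cannot be improved by a transposition.\<close>

lemma maximal_matching:
  fixes f g :: "nat \<Rightarrow> nat"
  shows "\<exists>\<pi>. \<pi> permutes {..<N} \<and>
    (\<forall>a. (\<forall>j<N. g j = a \<longrightarrow> f (\<pi> j) = a) \<or> (\<forall>j<N. f (\<pi> j) = a \<longrightarrow> g j = a))"
proof -
  let ?ag = "\<lambda>\<pi>. {j. j < N \<and> f (\<pi> j) = g j}"
  let ?P = "{\<pi>. \<pi> permutes {..<N}}"
  have "finite ((\<lambda>\<pi>. card (?ag \<pi>)) ` ?P)" "(\<lambda>\<pi>. card (?ag \<pi>)) ` ?P \<noteq> {}"
    using permutes_id[of "{..<N}"] by (blast intro: finite_imageI finite_permutations finite_lessThan)+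
  from Max_in[OF this] Max_ge[OF this(1)] obtain \<pi> where \<pi>: "\<pi> permutes {..<N}"
    and mx: "\<And>\<pi>'. \<pi>' permutes {..<N} \<Longrightarrow> card (?ag \<pi>') \<le> card (?ag \<pi>)"
    by fastforce
  have False if j: "j < N" "g j = a" "f (\<pi> j) \<noteq> a" and l: "l < N" "f (\<pi> l) = a" "g l \<noteq> a" for a j l
  proof -
    \<comment> \<open>After the swap \<open>j\<close> receives an element labelled \<open>a\<close>
      and becomes an agreement. Neither \<open>j\<close> nor \<open>l\<close> agreed before, so
      nothing is lost.\<close>
    let ?\<pi> = "\<pi> \<circ> Transposition.transpose j l"
    have "?\<pi> permutes {..<N}" using j l by (intro permutes_compose[OF _ \<pi>] permutes_swap_id) auto
    then have "card (?ag ?\<pi>) \<le> card (?ag \<pi>)" by (rule mx)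
    moreover have "?ag \<pi> \<subset> ?ag ?\<pi>"
    proof
      show "?ag \<pi> \<subseteq> ?ag ?\<pi>" using j l by (auto simp: Transposition.transpose_def)
      have "j \<in> ?ag ?\<pi>" "j \<notin> ?ag \<pi>" using j l by auto
      then show "?ag \<pi> \<noteq> ?ag ?\<pi>" by blast
    qed
    ultimately show False using psubset_card_mono[of "?ag ?\<pi>" "?ag \<pi>"] by simp
  qed
  then show ?thesis using \<pi> by blast
qed

text \<open>The set \<open>?b\<close> of agreements on \<open>a\<close> is common to both counts:
  one is \<open>?o\<close> plus \<open>?b\<close>, the other \<open>?i\<close> plus
  \<open>?b\<close>. By assumption one of \<open>?o\<close> and \<open>?i\<close> is empty, so the
  other has exactly the size of the difference.\<close>

lemma matching_counts:
  fixes f g :: "nat \<Rightarrow> nat"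
  assumes \<pi>: "\<pi> permutes {..<N}"
    and or: "(\<forall>j<N. g j = a \<longrightarrow> f (\<pi> j) = a) \<or> (\<forall>j<N. f (\<pi> j) = a \<longrightarrow> g j = a)"
  shows "real (card {j. j < N \<and> g j = a \<and> f (\<pi> j) \<noteq> a}) \<le> \<bar>real (card {j. j < N \<and> g j = a}) - card {j. j < N \<and> f j = a}\<bar>"
    and "real (card {j. j < N \<and> f (\<pi> j) = a \<and> g j \<noteq> a}) \<le> \<bar>real (card {j. j < N \<and> g j = a}) - card {j. j < N \<and> f j = a}\<bar>"
proof -
  let ?o = "{j. j < N \<and> g j = a \<and> f (\<pi> j) \<noteq> a}" and ?i = "{j. j < N \<and> f (\<pi> j) = a \<and> g j \<noteq> a}"
  let ?b = "{j. j < N \<and> f (\<pi> j) = a \<and> g j = a}"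
  have "card {j. j < N \<and> f j = a} = card {j. j < N \<and> f (\<pi> j) = a}"
  proof (rule bij_betw_same_card[symmetric, of \<pi>])
    show "bij_betw \<pi> {j. j < N \<and> f (\<pi> j) = a} {j. j < N \<and> f j = a}"
      unfolding bij_betw_def
    proof
      show "inj_on \<pi> {j. j < N \<and> f (\<pi> j) = a}" using permutes_inj[OF \<pi>] by (rule inj_on_subset) simp
      show "\<pi> ` {j. j < N \<and> f (\<pi> j) = a} = {j. j < N \<and> f j = a}"
      proof (intro subset_antisym subsetI)
        fix y assume "y \<in> {j. j < N \<and> f j = a}"
        then have "inv_into UNIV \<pi> y \<in> {j. j < N \<and> f (\<pi> j) = a}" "\<pi> (inv_into UNIV \<pi> y) = y"
          using permutes_inverses(1)[OF \<pi>] permutes_in_image[OF permutes_inv[OF \<pi>], of y] by auto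
        then show "y \<in> \<pi> ` {j. j < N \<and> f (\<pi> j) = a}" by (metis imageI)
      qed (use permutes_in_image[OF \<pi>] in auto)
    qed
  qed
  also have "card {j. j < N \<and> f (\<pi> j) = a} = card (?i \<union> ?b)" by (rule arg_cong[of _ _ card]) auto
  also have "\<dots> = card ?i + card ?b" by (rule card_Un_disjoint) auto
  finally have 1: "card {j. j < N \<and> f j = a} = card ?i + card ?b" .
  have "card {j. j < N \<and> g j = a} = card (?o \<union> ?b)" by (rule arg_cong[of _ _ card]) auto
  also have "\<dots> = card ?o + card ?b" by (rule card_Un_disjoint) auto
  finally have 2: "card {j. j < N \<and> g j = a} = card ?o + card ?b" .
  have "?o = {} \<or> ?i = {}" using or by auto
  then have "card ?o = 0 \<or> card ?i = 0" by (elim disjE) (simp_all only: card.empty simp_thms)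
  then show "real (card ?o) \<le> \<bar>real (card {j. j < N \<and> g j = a}) - card {j. j < N \<and> f j = a}\<bar>"
    and "real (card ?i) \<le> \<bar>real (card {j. j < N \<and> g j = a}) - card {j. j < N \<and> f j = a}\<bar>"
    using 1 2 by linarith+
qed

text \<open>Each level set contains a compact set \<open>K a\<close> that misses measure less than
  \<open>e / k\<close>. The finitely many disjoint compact sets lie a positive distance
  \<open>\<delta>\<close> apart, so a cell shorter than \<open>\<delta>\<close> meets at most one of
  them, and that one names the label of the cell.\<close>

lemma grid_approximation:
  fixes \<phi> :: "real \<Rightarrow> nat"
  assumes \<phi> [measurable]: "\<phi> \<in> measurable I01 (count_space UNIV)"
    and k: "\<And>x. x \<in> {0..1} \<Longrightarrow> \<phi> x < k" and e: "0 < e" and n: "0 < n"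
  obtains m f where "0 < m" "measure I01 {x\<in>{0..1}. \<phi> x \<noteq> f (cell (n * m) x)} < e"
proof -
  define X where "X a = {x\<in>{0..1}. \<phi> x = a}" for a
  have X: "X a \<in> sets I01" for a
  proof -
    have "{x\<in>space I01. \<phi> x = a} \<in> sets I01" by measurable
    then show ?thesis by (simp add: X_def)
  qed
  have k0: "0 < k" using k[of 0] by simp
  have "\<exists>K. closed K \<and> K \<subseteq> X a \<and> measure lebesgue (X a - K) < e / k" for a
  proof -
    have "X a \<in> sets lebesgue" using X[of a] by (simp add: sets_I01)
    from sets_lebesgue_inner_closed[OF this, of "e / k"] e k0
    obtain K where "closed K" "K \<subseteq> X a" "X a - K \<in> lmeasurable" "emeasure lebesgue (X a - K) < ennreal (e / k)" by auto
    moreover from this have "emeasure lebesgue (X a - K) = ennreal (measure lebesgue (X a - K))"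
      by (intro emeasure_eq_ennreal_measure) auto
    ultimately show ?thesis using e k0 by (intro exI[of _ K]) (simp add: ennreal_less_iff)
  qed
  then obtain K where K: "\<And>a. closed (K a)" "\<And>a. K a \<subseteq> X a" "\<And>a. measure lebesgue (X a - K a) < e / k" by metis
  have KI: "K a \<subseteq> {0..1}" for a using K(2)[of a] by (auto simp: X_def)
  have cK: "compact (K a)" for a
    using K(1) KI compact_Icc[of 0 "1::real"] by (metis closed_Int_compact inf.absorb_iff1)
  have "\<exists>d>0. \<forall>x\<in>K a. \<forall>y\<in>K b. a \<noteq> b \<longrightarrow> d \<le> dist x y" for a b
  proof (cases "a = b")
    case False
    then have "K a \<inter> K b = {}" using K(2)[of a] K(2)[of b] by (auto simp: X_def)
    then show ?thesis using separate_compact_closed[OF cK[of a] K(1)[of b]] by blast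
  qed (auto intro: exI[of _ 1])
  then obtain d where d: "\<And>a b. 0 < d a b" "\<And>a b x y. x \<in> K a \<Longrightarrow> y \<in> K b \<Longrightarrow> a \<noteq> b \<Longrightarrow> d a b \<le> dist x y" by metis
  let ?D = "insert 1 ((\<lambda>(a, b). d a b) ` ({..<k} \<times> {..<k}))"
  define \<delta> where "\<delta> = Min ?D"
  have "0 < \<delta>" unfolding \<delta>_def using d(1) by (subst Min_gr_iff) auto
  have \<delta>: "\<delta> \<le> d a b" if "a < k" "b < k" for a b
    unfolding \<delta>_def using that by (intro Min_le) auto
  obtain m :: nat where m: "1 / \<delta> < m" using reals_Archimedean2 by blast
  have "0 < 1 / \<delta>" using \<open>0 < \<delta>\<close> by simp
  with m have "0 < m" by (metis less_trans of_nat_0_less_iff)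
  have "real m \<le> real (n * m)" using n by (simp only: of_nat_le_iff) simp
  with m have "1 / \<delta> < real (n * m)" by linarith
  then have N: "1 / real (n * m) < \<delta>" using \<open>0 < \<delta>\<close> n \<open>0 < m\<close> by (simp add: field_simps)
  \<comment> \<open>Cells that meet no \<open>K a\<close> get an arbitrary label; their points lie
    in the small exceptional set.\<close>
  define f where "f c = (SOME a. \<exists>x\<in>K a. cell (n * m) x = c)" for c
  have f: "f (cell (n * m) x) = a" if "x \<in> K a" for x a
  proof -
    have "\<exists>y\<in>K (f (cell (n * m) x)). cell (n * m) y = cell (n * m) x"
      unfolding f_def by (rule someI_ex) (use that in blast)
    then obtain y where y: "y \<in> K (f (cell (n * m) x))" "cell (n * m) y = cell (n * m) x" by blast
    have I: "x \<in> {0..1}" "y \<in> {0..1}" using KI that y by blast+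
    have less: "a < k" "f (cell (n * m) x) < k"
      using k[OF I(1)] k[OF I(2)] subsetD[OF K(2) that] subsetD[OF K(2) y(1)] by (auto simp: X_def)
    have "dist x y \<le> 1 / real (n * m)"
      unfolding dist_real_def 
      by (rule cell_eq_dist[OF _ I y(2)[symmetric]]) (use n \<open>0 < m\<close> in simp)
    then have "dist x y < \<delta>" using N by linarith
    then show ?thesis using d(2)[OF that y(1)] \<delta>[OF less] by linarith
  qed
  have sub: "{x\<in>{0..1}. \<phi> x \<noteq> f (cell (n * m) x)} \<subseteq> (\<Union>a<k. X a - K a)"
  proof
    fix x assume x: "x \<in> {x\<in>{0..1}. \<phi> x \<noteq> f (cell (n * m) x)}"
    then have "x \<in> X (\<phi> x)" "\<phi> x < k" using k by (auto simp: X_def)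
    moreover have "x \<notin> K (\<phi> x)" using f x by force
    ultimately show "x \<in> (\<Union>a<k. X a - K a)" by blast
  qed
  have XK: "X a - K a \<in> sets I01" for a
    using X[of a] K(1)[of a] by (auto simp: sets_I01)
  have "measure I01 {x\<in>{0..1}. \<phi> x \<noteq> f (cell (n * m) x)} \<le> measure I01 (\<Union>a<k. X a - K a)"
    using sub XK by (intro I01.finite_measure_mono) auto
  also have "\<dots> \<le> (\<Sum>a<k. measure I01 (X a - K a))"
    using XK by (intro measure_UNION_le) auto
  also have "\<dots> < (\<Sum>a<k. e / k)"
  proof (rule sum_strict_mono)
    fix a
    have "measure I01 (X a - K a) = measure lebesgue (X a - K a)"
      using XK[of a] by (simp add: measure_I01 sets_I01 measure_completion)
    then show "measure I01 (X a - K a) < e / k" using K(3)[of a] by simp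
  qed (use k0 in auto)
  also have "\<dots> = e" using k0 by simp
  finally show thesis using that[OF \<open>0 < m\<close>] by blast
qed

lemma measure_mp_bijection:
  assumes "\<sigma> \<in> mp_bijections" "G \<in> sets I01"
  shows "measure I01 {x\<in>{0..1}. \<sigma> x \<in> G} = measure I01 G"
proof -
  have m: "\<sigma> \<in> measurable I01 I01" "distr I01 I01 \<sigma> = I01" using assms by (auto simp: mp_bijections_def)
  have "measure (distr I01 I01 \<sigma>) G = measure I01 (\<sigma> -` G \<inter> space I01)"
    using m(1) assms(2) by (rule measure_distr)
  also have "\<sigma> -` G \<inter> space I01 = {x\<in>{0..1}. \<sigma> x \<in> G}" by auto
  finally show ?thesis by (simp add: m(2))
qed

text \<open>The labels \<open>\<psi>\<close> are exactly constant on the common grid,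
  \<open>\<phi>\<close> only outside the small set \<open>G\<close>. The discrete matching aligns
  the two grid labellings, and \<open>grid_map\<close> realises it on the interval.\<close>

lemma match_labels:
  fixes \<phi> :: "real \<Rightarrow> nat" and \<psi> :: "nat \<Rightarrow> nat"
  assumes \<phi> [measurable]: "\<phi> \<in> measurable I01 (count_space UNIV)"
    and k: "\<And>x. x \<in> {0..1} \<Longrightarrow> \<phi> x < k" and n: "0 < n" and e: "0 < e"
  defines "\<alpha> \<equiv> \<lambda>a. measure I01 {x\<in>{0..1}. \<phi> x = a}"
    and "\<beta> \<equiv> \<lambda>a. real (card {i. i < n \<and> \<psi> i = a}) / n"
  obtains \<sigma> where "\<sigma> \<in> mp_bijections"
    "\<And>a. measure I01 {x\<in>{0..1}. \<psi> (cell n x) = a \<and> \<phi> (\<sigma> x) \<noteq> a} \<le> \<bar>\<beta> a - \<alpha> a\<bar> + e"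
    "\<And>a. measure I01 {x\<in>{0..1}. \<phi> (\<sigma> x) = a \<and> \<psi> (cell n x) \<noteq> a} \<le> \<bar>\<beta> a - \<alpha> a\<bar> + e"
proof -
  obtain m f where m: "0 < m" and f: "measure I01 {x\<in>{0..1}. \<phi> x \<noteq> f (cell (n * m) x)} < e / 2"
    using grid_approximation[OF \<phi> k, of "e / 2" n] e n by auto
  define N where "N = n * m"
  define g where "g = (\<lambda>j. \<psi> (j div m))"
  have N: "0 < N" using n m by (simp add: N_def)
  obtain \<pi> where \<pi>: "\<pi> permutes {..<N}" and
    or: "\<And>a. (\<forall>j<N. g j = a \<longrightarrow> f (\<pi> j) = a) \<or> (\<forall>j<N. f (\<pi> j) = a \<longrightarrow> g j = a)"
    using maximal_matching[of N g f] by blast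
  define \<sigma> where "\<sigma> = grid_map N \<pi>"
  have \<sigma>: "\<sigma> \<in> mp_bijections" unfolding \<sigma>_def by (rule grid_map_mp_bijection[OF \<pi> N])
  then have \<sigma>m [measurable]: "\<sigma> \<in> measurable I01 I01" by (simp add: mp_bijections_def)
  define G where "G = {x\<in>{0..1}. \<phi> x \<noteq> f (cell N x)}"
  have G: "G \<in> sets I01"
  proof -
    have "{x\<in>space I01. \<exists>a. \<phi> x = a \<and> f (cell N x) \<noteq> a} \<in> sets I01" by measurable
    then show ?thesis by (simp add: G_def eq_commute)
  qed
  have G': "{x\<in>{0..1}. \<sigma> x \<in> G} \<in> sets I01"
  proof -
    have "\<sigma> -` G \<inter> space I01 \<in> sets I01" using \<sigma>m G by (rule measurable_sets)
    moreover have "\<sigma> -` G \<inter> space I01 = {x\<in>{0..1}. \<sigma> x \<in> G}" by auto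
    ultimately show ?thesis by simp
  qed
  have mG: "measure I01 G < e / 2" using f by (simp add: G_def N_def)
  have mG': "measure I01 {x\<in>{0..1}. \<sigma> x \<in> G} < e / 2"
    using mG measure_mp_bijection[OF \<sigma> G] by simp
  have cellP: "{x\<in>{0..1}. P (cell N x)} \<in> sets I01" for P
  proof -
    have "{x\<in>space I01. P (cell N x)} \<in> sets I01" by measurable
    then show ?thesis by simp
  qed
  have \<alpha>: "\<bar>card {j. j < N \<and> f j = a} / N - \<alpha> a\<bar> \<le> e / 2" for a
  proof -
    let ?A = "{x\<in>{0..1}. \<phi> x = a}" and ?B = "{x\<in>{0..1}. f (cell N x) = a}"
    have "{x\<in>space I01. \<phi> x = a} \<in> sets I01" by measurable
    then have A: "?A \<in> sets I01" by simp
    have B: "?B \<in> sets I01" by (rule cellP)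
    have "measure I01 ?A \<le> measure I01 (?B \<union> G)"
      using A B G by (intro I01.finite_measure_mono) (auto simp: G_def)
    also have "\<dots> \<le> measure I01 ?B + measure I01 G"
      using B G by (rule measure_Un_le)
    finally have 1: "measure I01 ?A \<le> measure I01 ?B + e / 2" using mG by linarith
    have "measure I01 ?B \<le> measure I01 (?A \<union> G)"
      using A B G by (intro I01.finite_measure_mono) (auto simp: G_def)
    also have "\<dots> \<le> measure I01 ?A + measure I01 G"
      using A G by (rule measure_Un_le)
    finally have 2: "measure I01 ?B \<le> measure I01 ?A + e / 2" using mG by linarith
    have "measure I01 ?B = card {j. j < N \<and> f j = a} / N" by (rule measure_cell_Collect[OF N])
    with 1 2 show ?thesis unfolding \<alpha>_def by linarith
  qed
  have \<beta>: "\<beta> a = card {j. j < N \<and> g j = a} / N" for a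
  proof -
    have "\<beta> a = measure I01 {x\<in>{0..1}. \<psi> (cell n x) = a}"
      unfolding \<beta>_def by (rule measure_cell_Collect[OF n, symmetric])
    also have "\<dots> = measure I01 {x\<in>{0..1}. g (cell N x) = a}"
      by (rule arg_cong[of _ _ "measure I01"]) (use cell_mult_div[OF n m] in \<open>auto simp: g_def N_def simp del: atLeastAtMost_iff\<close>)
    also have "\<dots> = card {j. j < N \<and> g j = a} / N" by (rule measure_cell_Collect[OF N])
    finally show ?thesis .
  qed
  \<comment> \<open>One half of \<open>e\<close> pays for the points sent into \<open>G\<close>, the
    other half for the difference between the grid frequency of \<open>a\<close> and
    \<open>\<alpha> a\<close>. The point 0 is set apart because \<open>grid_map\<close> fixes it
    whatever \<open>\<pi>\<close> is.\<close>
  have cov: "measure I01 X \<le> \<bar>\<beta> a - \<alpha> a\<bar> + e"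
    if X: "X \<subseteq> {0} \<union> {x\<in>{0..1}. \<sigma> x \<in> G} \<union> {x\<in>{0..1}. P (cell N x)}"
      and P: "real (card {j. j < N \<and> P j}) \<le> \<bar>real (card {j. j < N \<and> g j = a}) - card {j. j < N \<and> f j = a}\<bar>" for X P a
  proof -
    have z: "{0} \<in> sets I01" by (simp add: sets_I01)
    have "emeasure I01 {0} = 0" by (subst emeasure_I01) (auto simp: sets_I01)
    then have z0: "measure I01 {0} = 0" by (simp add: measure_def)
    have "measure I01 X \<le> measure I01 ({0} \<union> {x\<in>{0..1}. \<sigma> x \<in> G} \<union> {x\<in>{0..1}. P (cell N x)})"
      using X by (rule I01.finite_measure_mono) (intro sets.Un z G' cellP)
    also have "\<dots> \<le> measure I01 ({0} \<union> {x\<in>{0..1}. \<sigma> x \<in> G}) + measure I01 {x\<in>{0..1}. P (cell N x)}"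
      by (intro measure_Un_le sets.Un z G' cellP)
    also have "measure I01 ({0} \<union> {x\<in>{0..1}. \<sigma> x \<in> G}) \<le> measure I01 {0} + measure I01 {x\<in>{0..1}. \<sigma> x \<in> G}"
      by (intro measure_Un_le z G')
    also have "measure I01 {x\<in>{0..1}. P (cell N x)} = card {j. j < N \<and> P j} / N" by (rule measure_cell_Collect[OF N])
    also have "\<dots> \<le> \<bar>real (card {j. j < N \<and> g j = a}) - card {j. j < N \<and> f j = a}\<bar> / N"
      using P by (intro divide_right_mono) auto
    also have "\<dots> = \<bar>card {j. j < N \<and> g j = a} / N - card {j. j < N \<and> f j = a} / N\<bar>"
      by (simp add: diff_divide_distrib[symmetric])
    also have "\<dots> \<le> \<bar>\<beta> a - \<alpha> a\<bar> + e / 2"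
      using \<alpha>[of a] unfolding \<beta> by linarith
    finally show ?thesis using z0 mG' by linarith
  qed
  have c: "cell n x = cell N x div m" if "x \<in> {0..1}" for x
    using cell_mult_div[OF n m that] by (simp add: N_def)
  have s: "cell N (\<sigma> x) = \<pi> (cell N x)" "\<sigma> x \<in> {0..1}" if "x \<in> {0..1}" "x \<noteq> 0" for x
    using grid_map_cell[OF \<pi> _ _ N, of x] that by (auto simp: \<sigma>_def)
  show thesis
  proof (rule that[OF \<sigma>])
    fix a
    show "measure I01 {x\<in>{0..1}. \<psi> (cell n x) = a \<and> \<phi> (\<sigma> x) \<noteq> a} \<le> \<bar>\<beta> a - \<alpha> a\<bar> + e"
    proof (rule cov[where P = "\<lambda>j. g j = a \<and> f (\<pi> j) \<noteq> a"])
      show "{x\<in>{0..1}. \<psi> (cell n x) = a \<and> \<phi> (\<sigma> x) \<noteq> a}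
        \<subseteq> {0} \<union> {x\<in>{0..1}. \<sigma> x \<in> G} \<union> {x\<in>{0..1}. g (cell N x) = a \<and> f (\<pi> (cell N x)) \<noteq> a}"
      proof
        fix x assume x: "x \<in> {x\<in>{0..1}. \<psi> (cell n x) = a \<and> \<phi> (\<sigma> x) \<noteq> a}"
        then show "x \<in> {0} \<union> {x\<in>{0..1}. \<sigma> x \<in> G} \<union> {x\<in>{0..1}. g (cell N x) = a \<and> f (\<pi> (cell N x)) \<noteq> a}"
          using c[of x] s[of x] by (cases "x = 0") (auto simp: G_def g_def)
      qed
    qed (rule matching_counts(1)[OF \<pi> or])
    show "measure I01 {x\<in>{0..1}. \<phi> (\<sigma> x) = a \<and> \<psi> (cell n x) \<noteq> a} \<le> \<bar>\<beta> a - \<alpha> a\<bar> + e"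
    proof (rule cov[where P = "\<lambda>j. f (\<pi> j) = a \<and> g j \<noteq> a"])
      show "{x\<in>{0..1}. \<phi> (\<sigma> x) = a \<and> \<psi> (cell n x) \<noteq> a}
        \<subseteq> {0} \<union> {x\<in>{0..1}. \<sigma> x \<in> G} \<union> {x\<in>{0..1}. f (\<pi> (cell N x)) = a \<and> g (cell N x) \<noteq> a}"
      proof
        fix x assume x: "x \<in> {x\<in>{0..1}. \<phi> (\<sigma> x) = a \<and> \<psi> (cell n x) \<noteq> a}"
        then show "x \<in> {0} \<union> {x\<in>{0..1}. \<sigma> x \<in> G} \<union> {x\<in>{0..1}. f (\<pi> (cell N x)) = a \<and> g (cell N x) \<noteq> a}"
          using c[of x] s[of x] by (cases "x = 0") (auto simp: G_def g_def)
      qed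
    qed (rule matching_counts(2)[OF \<pi> or])
  qed
qed

lemma kernel_step:
  fixes F :: "nat \<Rightarrow> nat \<Rightarrow> real"
  assumes "a \<in> measurable I01 (count_space UNIV)" "b \<in> measurable I01 (count_space UNIV)"
    and "\<And>x. x \<in> {0..1} \<Longrightarrow> a x < k" "\<And>x. x \<in> {0..1} \<Longrightarrow> b x < l"
  shows "integrable_kernel (\<lambda>x y. F (a x) (b y))"
proof -
  have "integrable_kernel (\<lambda>x y. F (a x) (b y)) \<longleftrightarrow>
      integrable_kernel (\<lambda>x y. indicator {0..1} x * indicator {0..1} y * F (a x) (b y))"
    by (rule Bochner_Integration.integrable_cong) (auto simp: space_pair_measure)
  also have \<dots> by (rule step_integral(2)[OF assms]) (simp_all add: sets_I01)
  finally show ?thesis .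
qed

text \<open>The two step functions agree at \<open>(x, y)\<close> unless \<open>x\<close> or \<open>y\<close> carries mismatched labels.\<close>

lemma cut_dist_step_le:
  fixes \<phi> :: "real \<Rightarrow> nat" and \<psi> :: "nat \<Rightarrow> nat" and Q :: "nat \<Rightarrow> nat \<Rightarrow> real"
  assumes \<phi> [measurable]: "\<phi> \<in> measurable I01 (count_space UNIV)"
    and k: "\<And>x. x \<in> {0..1} \<Longrightarrow> \<phi> x < k" and n: "0 < n" and \<psi>: "\<And>i. i < n \<Longrightarrow> \<psi> i < k"
    and Q: "\<And>a b. a < k \<Longrightarrow> b < k \<Longrightarrow> 0 \<le> Q a b \<and> Q a b = Q b a"
  defines "\<alpha> \<equiv> \<lambda>a. measure I01 {x\<in>{0..1}. \<phi> x = a}"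
    and "\<beta> \<equiv> \<lambda>a. real (card {i. i < n \<and> \<psi> i = a}) / n"
  shows "cut_dist (empirical_graphon n (mat n n (\<lambda>(i, j). Q (\<psi> i) (\<psi> j)))) (\<lambda>x y. Q (\<phi> x) (\<phi> y))
    \<le> 2 * (\<Sum>a<k. \<Sum>b<k. Q a b * \<bar>\<beta> a - \<alpha> a\<bar> * (\<alpha> b + \<beta> b))" (is "cut_dist ?f ?W \<le> ?R")
proof (rule field_le_epsilon)
  fix e :: real assume "0 < e"
  define K where "K = 2 * (\<Sum>a<k. \<Sum>b<k. Q a b * (\<alpha> b + \<beta> b))"
  have K: "0 \<le> K" unfolding K_def using Q by (intro mult_nonneg_nonneg sum_nonneg) (auto simp: \<alpha>_def \<beta>_def)
  \<comment> \<open>The slack \<open>d\<close> of every block adds up to \<open>d * K\<close> in the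
    final bound; the 1 avoids division by zero.\<close>
  define d where "d = e / (K + 1)"
  have d: "0 < d" "d * K \<le> e"
    using \<open>0 < e\<close> K by (auto simp: d_def field_simps)
  obtain \<sigma> where \<sigma>: "\<sigma> \<in> mp_bijections"
    and m1: "\<And>a. measure I01 {x\<in>{0..1}. \<psi> (cell n x) = a \<and> \<phi> (\<sigma> x) \<noteq> a} \<le> \<bar>\<beta> a - \<alpha> a\<bar> + d"
    and m2: "\<And>a. measure I01 {x\<in>{0..1}. \<phi> (\<sigma> x) = a \<and> \<psi> (cell n x) \<noteq> a} \<le> \<bar>\<beta> a - \<alpha> a\<bar> + d"
    using match_labels[OF \<phi> k n d(1), of \<psi>] unfolding \<alpha>_def \<beta>_def by blast
  have [measurable]: "\<sigma> \<in> measurable I01 I01" and \<sigma>01: "\<And>x. x \<in> {0..1} \<Longrightarrow> \<sigma> x \<in> {0..1}"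
    using \<sigma> by (auto simp: mp_bijections_def bij_betw_def)
  let ?p = "\<lambda>x. \<psi> (cell n x)" and ?q = "\<lambda>x. \<phi> (\<sigma> x)"
  have mp [measurable]: "?p \<in> measurable I01 (count_space UNIV)" and mq [measurable]: "?q \<in> measurable I01 (count_space UNIV)"
    by measurable
  have pk: "?p x < k" and qk: "?q x < k" if "x \<in> {0..1}" for x
    using that k \<psi> cell_less[OF n] \<sigma>01 by auto
  define D where "D = {x\<in>{0..1}. ?p x \<noteq> ?q x}"
  have D: "D \<in> sets I01"
  proof -
    have "{x\<in>space I01. \<exists>a. ?p x = a \<and> ?q x \<noteq> a} \<in> sets I01" by measurable
    then show ?thesis by (simp add: D_def eq_commute)
  qed
  have U: "{0..1} \<in> sets I01" by (simp add: sets_I01)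
  have \<beta>: "measure I01 {x\<in>{0..1}. ?p x = a} = \<beta> a" for a
    unfolding \<beta>_def by (rule measure_cell_Collect[OF n])
  have \<alpha>: "measure I01 {x\<in>{0..1}. ?q x = a} = \<alpha> a" for a
  proof -
    have "{x\<in>space I01. \<phi> x = a} \<in> sets I01" by measurable
    then have "measure I01 {x\<in>{0..1}. \<sigma> x \<in> {x\<in>{0..1}. \<phi> x = a}} = \<alpha> a"
      unfolding \<alpha>_def by (intro measure_mp_bijection[OF \<sigma>]) simp
    moreover have "{x\<in>{0..1}. \<sigma> x \<in> {x\<in>{0..1}. \<phi> x = a}} = {x\<in>{0..1}. ?q x = a}" using \<sigma>01 by blast
    ultimately show ?thesis by simp
  qed
  have Dp: "measure I01 {x\<in>D. ?p x = a} \<le> \<bar>\<beta> a - \<alpha> a\<bar> + d" for a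
  proof -
    have "{x\<in>D. ?p x = a} = {x\<in>{0..1}. ?p x = a \<and> ?q x \<noteq> a}" by (auto simp: D_def)
    then show ?thesis using m1[of a] by simp
  qed
  have Dq: "measure I01 {x\<in>D. ?q x = a} \<le> \<bar>\<beta> a - \<alpha> a\<bar> + d" for a
  proof -
    have "{x\<in>D. ?q x = a} = {x\<in>{0..1}. ?q x = a \<and> ?p x \<noteq> a}" by (auto simp: D_def)
    then show ?thesis using m2[of a] by simp
  qed
  let ?B = "\<lambda>\<gamma>. \<Sum>a<k. \<Sum>b<k. Q a b * (\<bar>\<beta> a - \<alpha> a\<bar> + d) * \<gamma> b"
  have step: "(LINT (x, y)|unit_square. indicator S x * indicator T y * Q (l x) (l y)) \<le> ?B \<gamma>"
    if l: "l \<in> measurable I01 (count_space UNIV)" "\<And>x. x \<in> {0..1} \<Longrightarrow> l x < k"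
      and \<gamma>: "\<And>a. measure I01 {x\<in>{0..1}. l x = a} = \<gamma> a"
      and mD: "\<And>a. measure I01 {x\<in>D. l x = a} \<le> \<bar>\<beta> a - \<alpha> a\<bar> + d"
      and ST: "S = D \<and> T = {0..1} \<or> S = {0..1} \<and> T = D" for S T l \<gamma>
  proof -
    have \<gamma>0: "0 \<le> \<gamma> a" for a using \<gamma>[of a] measure_nonneg by metis
    have eq: "(LINT (x, y)|unit_square. indicator S x * indicator T y * Q (l x) (l y)) =
      (\<Sum>a<k. \<Sum>b<k. Q a b * measure I01 {x\<in>S. l x = a} * measure I01 {y\<in>T. l y = b})"
      by (rule step_integral(1)[OF l(1) l(1) l(2) l(2)]) (use ST D U in auto)
    from ST show ?thesis
    proof
      assume "S = D \<and> T = {0..1}"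
      then show ?thesis unfolding eq using mD Q \<gamma>0
        by (auto intro!: sum_mono mult_right_mono mult_left_mono simp: \<gamma> simp del: atLeastAtMost_iff)
    next
      assume ST: "S = {0..1} \<and> T = D"
      \<comment> \<open>Symmetry of \<open>Q\<close> lets the coordinates exchange roles, so a
        mismatch in \<open>y\<close> costs as much as one in \<open>x\<close>.\<close>
      have "(\<Sum>a<k. \<Sum>b<k. Q a b * measure I01 {x\<in>S. l x = a} * measure I01 {y\<in>T. l y = b})
          = (\<Sum>b<k. \<Sum>a<k. Q b a * measure I01 {y\<in>D. l y = b} * \<gamma> a)"
        using ST by (subst sum.swap, intro sum.cong refl) (simp add: \<gamma> Q mult_ac del: atLeastAtMost_iff)
      also have "\<dots> \<le> ?B \<gamma>" using mD Q \<gamma>0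
        by (auto intro!: sum_mono mult_right_mono mult_left_mono)
      finally show ?thesis unfolding eq .
    qed
  qed
  have kf: "integrable_kernel ?f" by (rule kernel_empirical_graphon[OF n])
  have kW: "integrable_kernel ?W" by (rule kernel_step[OF \<phi> \<phi> k k])
  have kd: "integrable_kernel (\<lambda>x y. ?f x y - ?W (\<sigma> x) (\<sigma> y))"
    by (rule kernel_diff[OF kf kernel_mp_bijection[OF \<sigma> kW]])
  let ?H = "\<lambda>S T l. \<lambda>z. indicator S (fst z) * indicator T (snd z) * Q (l (fst z)) (l (snd z))"
  have iH: "integrable unit_square (?H S T l)"
    if "l \<in> measurable I01 (count_space UNIV)" "\<And>x. x \<in> {0..1} \<Longrightarrow> l x < k" "S \<in> sets I01" "T \<in> sets I01" for S T l
    using step_integral(2)[OF that(1) that(1) that(2) that(2) that(3,4), where F = Q] by (simp add: case_prod_beta')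
  note iH' = iH[OF mp pk D U] iH[OF mp pk U D] iH[OF mq qk D U] iH[OF mq qk U D]
  have "cut_dist ?f ?W \<le> cut_norm (\<lambda>x y. ?f x y - ?W (\<sigma> x) (\<sigma> y))"
    by (rule cut_dist_le_cut_norm[OF \<sigma> kf kW])
  also have "\<dots> \<le> L1_norm (\<lambda>x y. ?f x y - ?W (\<sigma> x) (\<sigma> y))" by (rule cut_norm_le_L1_norm[OF kd])
  also have "\<dots> = (LINT z|unit_square. \<bar>case_prod (\<lambda>x y. ?f x y - ?W (\<sigma> x) (\<sigma> y)) z\<bar>)"
    by (simp add: L1_norm_def case_prod_beta')
  \<comment> \<open>On the mismatched strips the difference of the two nonnegative functions is
    bounded by their sum; elsewhere it vanishes.\<close>
  also have "\<dots> \<le> (LINT z|unit_square. ?H D {0..1} ?p z + ?H {0..1} D ?p z + ?H D {0..1} ?q z + ?H {0..1} D ?q z)"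
  proof (rule integral_mono)
    fix z assume "z \<in> space unit_square"
    then obtain x y where z: "z = (x, y)" "x \<in> {0..1}" "y \<in> {0..1}" by (auto simp: space_pair_measure)
    have f: "?f x y = Q (?p x) (?p y)"
      using cell_less[OF n z(2)] cell_less[OF n z(3)] by (simp add: empirical_graphon_cell)
    have "0 \<le> Q (?p x) (?p y)" "0 \<le> Q (?q x) (?q y)" using Q pk qk z by auto
    moreover have "x \<in> D \<or> y \<in> D \<or> Q (?p x) (?p y) = Q (?q x) (?q y)" using z by (auto simp: D_def)
    ultimately show "\<bar>case_prod (\<lambda>x y. ?f x y - ?W (\<sigma> x) (\<sigma> y)) z\<bar>
        \<le> ?H D {0..1} ?p z + ?H {0..1} D ?p z + ?H D {0..1} ?q z + ?H {0..1} D ?q z"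
      using z(2,3) unfolding z(1) case_prod_conv f by (auto simp: indicator_def abs_if)
  qed (intro integrable_abs kd Bochner_Integration.integrable_add iH')+
  also have "\<dots> = (LINT z|unit_square. ?H D {0..1} ?p z) + (LINT z|unit_square. ?H {0..1} D ?p z)
      + (LINT z|unit_square. ?H D {0..1} ?q z) + (LINT z|unit_square. ?H {0..1} D ?q z)"
    by (simp only: Bochner_Integration.integral_add Bochner_Integration.integrable_add iH')
  also have "\<dots> \<le> ?B \<beta> + ?B \<beta> + ?B \<alpha> + ?B \<alpha>"
    using step[OF mp pk \<beta> Dp, of D "{0..1}"] step[OF mp pk \<beta> Dp, of "{0..1}" D]
      step[OF mq qk \<alpha> Dq, of D "{0..1}"] step[OF mq qk \<alpha> Dq, of "{0..1}" D]
    by (intro add_mono) (simp_all add: case_prod_beta')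
  also have "\<dots> = ?R + d * K"
    unfolding K_def by (simp add: ring_distribs sum.distrib sum_distrib_left sum_distrib_right mult_ac)
  finally show "cut_dist ?f ?W \<le> ?R + e" using d(2) by linarith
qed

subsection \<open>Empirical label frequencies\<close>

abbreviation samples :: "nat \<Rightarrow> (nat \<Rightarrow> real) measure" where
  "samples n \<equiv> (\<Pi>\<^sub>M i\<in>{..<n}. I01)"

lemma prob_space_samples: "prob_space (samples n)"
  by (intro prob_space_PiM prob_space_I01)

text \<open>Two different sample points are jointly uniform on the square. Every later use of
  independence between sample points goes through such pairs.\<close>

lemma distr_samples_pair:
  assumes "i < n" "j < n" "i \<noteq> j"
  shows "distr (samples n) unit_square (\<lambda>\<xi>. (\<xi> i, \<xi> j)) = unit_square"
proof (rule pair_measure_eqI[symmetric])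
  interpret prod: product_prob_space "\<lambda>_. I01" "{..<n}"
    by unfold_locales
  fix A B assume AB: "A \<in> sets I01" "B \<in> sets I01"
  have m: "(\<lambda>\<xi>. (\<xi> i, \<xi> j)) \<in> measurable (samples n) unit_square"
    using assms by (intro measurable_Pair measurable_component_singleton) auto
  let ?X = "\<lambda>l. if l = i then A else B"
  have "emeasure (distr (samples n) unit_square (\<lambda>\<xi>. (\<xi> i, \<xi> j))) (A \<times> B)
      = emeasure (samples n) {\<xi>\<in>space (samples n). \<forall>l\<in>{i, j}. \<xi> l \<in> ?X l}"
    using AB assms by (subst emeasure_distr[OF m]) (auto intro!: arg_cong[of _ _ "emeasure _"])
  also have "\<dots> = (\<Prod>l\<in>{i, j}. emeasure I01 (?X l))"
    by (rule prod.emeasure_PiM_Collect) (use AB assms in auto)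
  also have "\<dots> = emeasure I01 A * emeasure I01 B" using assms(3) by simp
  finally show "emeasure I01 A * emeasure I01 B = emeasure (distr (samples n) unit_square (\<lambda>\<xi>. (\<xi> i, \<xi> j))) (A \<times> B)" by simp
qed (auto intro: I01.sigma_finite_measure_axioms)

lemma samples_pair:
  assumes "i < n" "j < n" "i \<noteq> j" and H: "integrable_kernel H"
  shows "integrable (samples n) (\<lambda>\<xi>. H (\<xi> i) (\<xi> j))"
    and "(LINT \<xi>|samples n. H (\<xi> i) (\<xi> j)) = (LINT (x, y)|unit_square. H x y)"
proof -
  have m: "(\<lambda>\<xi>. (\<xi> i, \<xi> j)) \<in> measurable (samples n) unit_square"
    using assms by (intro measurable_Pair measurable_component_singleton) auto
  show "integrable (samples n) (\<lambda>\<xi>. H (\<xi> i) (\<xi> j))"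
    using integrable_distr[OF m, of "case_prod H"] H by (simp add: distr_samples_pair[OF assms(1-3)])
  show "(LINT \<xi>|samples n. H (\<xi> i) (\<xi> j)) = (LINT (x, y)|unit_square. H x y)"
    using integral_distr[OF m, of "case_prod H"] H by (simp add: distr_samples_pair[OF assms(1-3)])
qed

locale labelled_sample =
  fixes \<phi> :: "real \<Rightarrow> nat" and k n :: nat
  assumes \<phi> [measurable]: "\<phi> \<in> measurable I01 (count_space UNIV)"
    and k: "\<And>x. x \<in> {0..1} \<Longrightarrow> \<phi> x < k" and n: "0 < n"
begin

definition \<alpha> :: "nat \<Rightarrow> real" where
  "\<alpha> a = measure I01 {x\<in>{0..1}. \<phi> x = a}"

definition \<beta> :: "(nat \<Rightarrow> real) \<Rightarrow> nat \<Rightarrow> real" where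
  "\<beta> \<xi> a = card {i. i < n \<and> \<phi> (\<xi> i) = a} / n"

abbreviation \<Delta> :: "nat \<Rightarrow> (nat \<Rightarrow> real) \<Rightarrow> real" where
  "\<Delta> a \<xi> \<equiv> \<beta> \<xi> a - \<alpha> a"

text \<open>Half the bound of \<open>cut_dist_step_le\<close>, with the empirical
  \<open>\<beta> \<xi> b\<close> replaced by the larger
  \<open>\<alpha> b + \<bar>\<Delta> b \<xi>\<bar>\<close>, so that randomness enters through
  deviations only.\<close>

definition mismatch :: "(nat \<Rightarrow> nat \<Rightarrow> real) \<Rightarrow> (nat \<Rightarrow> real) \<Rightarrow> real" where
  "mismatch Q \<xi> = (\<Sum>a<k. \<Sum>b<k. Q a b * (\<bar>\<Delta> a \<xi>\<bar> * (2 * \<alpha> b) + \<bar>\<Delta> a \<xi>\<bar> * \<bar>\<Delta> b \<xi>\<bar>))"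

sublocale P: prob_space "samples n" by (rule prob_space_samples)

lemma \<alpha>_nonneg: "0 \<le> \<alpha> a" by (simp add: \<alpha>_def)

lemma level_sets [measurable]: "{x\<in>{0..1}. \<phi> x = a} \<in> sets I01"
proof -
  have "{x\<in>space I01. \<phi> x = a} \<in> sets I01" by measurable
  then show ?thesis by simp
qed

lemma sum_\<alpha>: "(\<Sum>a<k. \<alpha> a) = 1"
proof -
  have "(\<Sum>a<k. \<alpha> a) = measure I01 (\<Union>a<k. {x\<in>{0..1}. \<phi> x = a})"
    unfolding \<alpha>_def
    by (rule I01.finite_measure_finite_Union[symmetric]) (use level_sets in \<open>auto simp: disjoint_family_on_def simp del: atLeastAtMost_iff\<close>)
  also have "(\<Union>a<k. {x\<in>{0..1}. \<phi> x = a}) = space I01" using k by auto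
  finally show ?thesis by (simp only: I01.prob_space)
qed

lemma step_kernel_integral:
  "(LINT (x, y)|unit_square. F (\<phi> x) (\<phi> y)) = (\<Sum>a<k. \<Sum>b<k. F a b * \<alpha> a * \<alpha> b)"
  for F :: "nat \<Rightarrow> nat \<Rightarrow> real"
proof -
  have "(LINT (x, y)|unit_square. F (\<phi> x) (\<phi> y)) =
      (LINT (x, y)|unit_square. indicator {0..1} x * indicator {0..1} y * F (\<phi> x) (\<phi> y))"
    by (rule Bochner_Integration.integral_cong) (auto simp: space_pair_measure)
  also have "\<dots> = (\<Sum>a<k. \<Sum>b<k. F a b * \<alpha> a * \<alpha> b)"
    unfolding \<alpha>_def by (rule step_integral(1)[OF \<phi> \<phi> k k]) (simp_all add: sets_I01)
  finally show ?thesis .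
qed

lemma label_measurable: "i < n \<Longrightarrow> (\<lambda>\<xi>. \<phi> (\<xi> i)) \<in> measurable (samples n) (count_space UNIV)"
  by (rule measurable_compose[where f = "\<lambda>\<xi>. \<xi> i" and N = I01, OF measurable_component_singleton \<phi>]) simp

lemma label_expectation:
  fixes h :: "nat \<Rightarrow> real"
  assumes i: "i < n"
  shows "integrable (samples n) (\<lambda>\<xi>. h (\<phi> (\<xi> i)))"
    and "(LINT \<xi>|samples n. h (\<phi> (\<xi> i))) = (\<Sum>a<k. h a * \<alpha> a)"
proof -
  have m: "(\<lambda>\<xi>. \<xi> i) \<in> measurable (samples n) I01"
    using i by (intro measurable_component_singleton) auto
  have d: "distr (samples n) I01 (\<lambda>\<xi>. \<xi> i) = I01"
    using i prob_space_I01 by (intro distr_PiM_component) auto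
  have eq: "h (\<phi> x) = (\<Sum>a<k. h a * indicator {x\<in>{0..1}. \<phi> x = a} x)" if "x \<in> {0..1}" for x
  proof -
    have "(\<Sum>a<k. h a * indicator {x\<in>{0..1}. \<phi> x = a} x) = (\<Sum>a<k. if a = \<phi> x then h a else 0)"
      using that by (intro sum.cong refl) (simp add: indicator_def)
    then show ?thesis using k[OF that] by simp
  qed
  have hm: "(\<lambda>x. h (\<phi> x)) \<in> borel_measurable I01" by measurable
  have int: "integrable I01 (\<lambda>x. h a * indicator {x\<in>{0..1}. \<phi> x = a} x :: real)" for a
    by (intro integrable_mult_right integrable_real_indicator level_sets) (simp add: I01.emeasure_eq_measure)
  have "integrable I01 (\<lambda>x. h (\<phi> x)) \<longleftrightarrow> integrable I01 (\<lambda>x. \<Sum>a<k. h a * indicator {x\<in>{0..1}. \<phi> x = a} x)"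
    by (rule Bochner_Integration.integrable_cong) (use eq in auto)
  also have \<dots> by (intro Bochner_Integration.integrable_sum int)
  finally show "integrable (samples n) (\<lambda>\<xi>. h (\<phi> (\<xi> i)))"
    using integrable_distr[OF m, of "\<lambda>x. h (\<phi> x)"] by (simp add: d)
  have "(LINT \<xi>|samples n. h (\<phi> (\<xi> i))) = (LINT x|I01. h (\<phi> x))"
    using integral_distr[OF m hm] by (simp add: d)
  also have "\<dots> = (LINT x|I01. (\<Sum>a<k. h a * indicator {x\<in>{0..1}. \<phi> x = a} x))"
    by (rule Bochner_Integration.integral_cong) (use eq in auto)
  also have "\<dots> = (\<Sum>a<k. LINT x|I01. h a * indicator {x\<in>{0..1}. \<phi> x = a} x)"
    by (rule Bochner_Integration.integral_sum) (rule int)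
  also have "\<dots> = (\<Sum>a<k. h a * \<alpha> a)"
  proof (rule sum.cong[OF refl])
    fix a
    have "(LINT x|I01. indicator {x\<in>{0..1}. \<phi> x = a} x) = \<alpha> a"
      unfolding \<alpha>_def
      by (intro has_bochner_integral_integral_eq has_bochner_integral_real_indicator level_sets)
         (simp add: I01.emeasure_eq_measure)
    then show "(LINT x|I01. h a * indicator {x\<in>{0..1}. \<phi> x = a} x) = h a * \<alpha> a"
      by (simp only: integral_mult_right_zero)
  qed
  finally show "(LINT \<xi>|samples n. h (\<phi> (\<xi> i))) = (\<Sum>a<k. h a * \<alpha> a)" .
qed

lemma \<beta>_eq_sum: "\<beta> \<xi> a = (\<Sum>i<n. of_bool (\<phi> (\<xi> i) = a)) / n"
proof -
  have "(\<Sum>i<n. of_bool (\<phi> (\<xi> i) = a)) = real (card {i \<in> {..<n}. \<phi> (\<xi> i) = a})"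
    by (simp add: of_bool_def sum.If_cases Int_def)
  then show ?thesis by (simp add: \<beta>_def)
qed

lemma \<Delta>_measurable [measurable]: "\<Delta> a \<in> borel_measurable (samples n)"
proof -
  have "(\<lambda>\<xi>. of_bool (\<phi> (\<xi> i) = a)) \<in> borel_measurable (samples n)" if "i < n" for i
    using label_measurable[OF that] by measurable
  then show ?thesis unfolding \<beta>_eq_sum
    by (intro borel_measurable_diff borel_measurable_divide borel_measurable_sum borel_measurable_const) auto
qed

lemma \<Delta>_bound: "\<bar>\<Delta> a \<xi>\<bar> \<le> 1"
proof -
  have "card {i. i < n \<and> \<phi> (\<xi> i) = a} \<le> card {..<n}" by (intro card_mono) auto
  then have "0 \<le> \<beta> \<xi> a" "\<beta> \<xi> a \<le> 1" using n by (simp_all add: \<beta>_def)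
  moreover have "\<alpha> a \<le> 1" by (simp add: \<alpha>_def)
  ultimately show ?thesis using \<alpha>_nonneg[of a] by linarith
qed

lemma \<Delta>_integrable:
  "integrable (samples n) (\<lambda>\<xi>. \<bar>\<Delta> a \<xi>\<bar>)" "integrable (samples n) (\<lambda>\<xi>. \<bar>\<Delta> a \<xi>\<bar> * \<bar>\<Delta> b \<xi>\<bar>)"
proof -
  show "integrable (samples n) (\<lambda>\<xi>. \<bar>\<Delta> a \<xi>\<bar>)"
    by (rule P.integrable_const_bound[where B = 1]) (use \<Delta>_bound in auto)
  show "integrable (samples n) (\<lambda>\<xi>. \<bar>\<Delta> a \<xi>\<bar> * \<bar>\<Delta> b \<xi>\<bar>)"
  proof (rule P.integrable_const_bound[where B = 1])
    show "AE \<xi> in samples n. norm (\<bar>\<Delta> a \<xi>\<bar> * \<bar>\<Delta> b \<xi>\<bar>) \<le> 1"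
      using mult_mono[OF \<Delta>_bound[of _ a] \<Delta>_bound[of _ b]] by (simp add: abs_mult)
  qed measurable
qed

text \<open>The variance of an empirical frequency is \<alpha> (1 - \<alpha>) / n. In the expanded
  square the mixed terms vanish, because the centred indicators \<open>z\<close> of distinct sample
  points are independent with mean 0.\<close>

lemma expectation_\<Delta>_square_le:
  assumes "a < k"
  shows "(LINT \<xi>|samples n. \<bar>\<Delta> a \<xi>\<bar> * \<bar>\<Delta> a \<xi>\<bar>) \<le> \<alpha> a / n"
proof -
  define z where "z c = of_bool (c = a) - \<alpha> a" for c :: nat
  have mean: "(\<Sum>c<k. z c * \<alpha> c) = 0"
    using assms sum_\<alpha> by (simp add: z_def left_diff_distrib sum_subtractf sum_distrib_left[symmetric])
  have kz: "integrable_kernel (\<lambda>x y. z (\<phi> x) * z (\<phi> y))" by (rule kernel_step[OF \<phi> \<phi> k k])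
  have off: "(LINT \<xi>|samples n. z (\<phi> (\<xi> i)) * z (\<phi> (\<xi> j))) = 0" if "i < n" "j < n" "i \<noteq> j" for i j
  proof -
    have "(LINT \<xi>|samples n. z (\<phi> (\<xi> i)) * z (\<phi> (\<xi> j))) = (\<Sum>a<k. \<Sum>b<k. z a * z b * \<alpha> a * \<alpha> b)"
      unfolding samples_pair(2)[OF that kz] by (rule step_kernel_integral)
    also have "\<dots> = (\<Sum>c<k. z c * \<alpha> c) * (\<Sum>c<k. z c * \<alpha> c)"
      by (simp add: sum_product mult_ac)
    finally show ?thesis by (simp add: mean)
  qed
  have dia: "(LINT \<xi>|samples n. z (\<phi> (\<xi> i)) * z (\<phi> (\<xi> i))) \<le> \<alpha> a" if "i < n" for i
  proof -
    have "(LINT \<xi>|samples n. z (\<phi> (\<xi> i)) * z (\<phi> (\<xi> i))) = (\<Sum>c<k. z c * z c * \<alpha> c)"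
      by (rule label_expectation(2)[OF that, of "\<lambda>c. z c * z c"])
    also have "\<dots> = (\<Sum>c<k. of_bool (c = a) * \<alpha> c - \<alpha> a * (z c * \<alpha> c) - \<alpha> a * (of_bool (c = a) * \<alpha> c))"
      by (intro sum.cong refl) (simp add: z_def algebra_simps)
    also have "\<dots> = \<alpha> a - \<alpha> a * \<alpha> a"
      using assms mean by (simp add: sum_subtractf sum_distrib_left[symmetric])
    finally show ?thesis using \<alpha>_nonneg[of a] by simp
  qed
  have int: "integrable (samples n) (\<lambda>\<xi>. z (\<phi> (\<xi> i)) * z (\<phi> (\<xi> j)))" if "i < n" "j < n" for i j
    using samples_pair(1)[OF that _ kz] label_expectation(1)[OF that(1), of "\<lambda>c. z c * z c"] by (cases "i = j") auto
  have \<Delta>: "\<Delta> a \<xi> = (\<Sum>i<n. z (\<phi> (\<xi> i))) / n" for \<xi>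
    using n by (simp add: \<beta>_eq_sum z_def sum_subtractf diff_divide_distrib)
  have "(LINT \<xi>|samples n. \<bar>\<Delta> a \<xi>\<bar> * \<bar>\<Delta> a \<xi>\<bar>) = (LINT \<xi>|samples n. (\<Sum>i<n. \<Sum>j<n. z (\<phi> (\<xi> i)) * z (\<phi> (\<xi> j))) / (real n)\<^sup>2)"
    by (simp add: \<Delta> sum_product power2_eq_square)
  also have "\<dots> = (\<Sum>i<n. \<Sum>j<n. LINT \<xi>|samples n. z (\<phi> (\<xi> i)) * z (\<phi> (\<xi> j))) / (real n)\<^sup>2"
  proof -
    have "(LINT \<xi>|samples n. (\<Sum>i<n. \<Sum>j<n. z (\<phi> (\<xi> i)) * z (\<phi> (\<xi> j))))
        = (\<Sum>i<n. LINT \<xi>|samples n. (\<Sum>j<n. z (\<phi> (\<xi> i)) * z (\<phi> (\<xi> j))))"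
      by (rule Bochner_Integration.integral_sum, rule Bochner_Integration.integrable_sum) (simp add: int)
    also have "\<dots> = (\<Sum>i<n. \<Sum>j<n. LINT \<xi>|samples n. z (\<phi> (\<xi> i)) * z (\<phi> (\<xi> j)))"
      by (rule sum.cong[OF refl], rule Bochner_Integration.integral_sum) (simp add: int)
    finally show ?thesis by simp
  qed
  also have "\<dots> = (\<Sum>i<n. LINT \<xi>|samples n. z (\<phi> (\<xi> i)) * z (\<phi> (\<xi> i))) / (real n)\<^sup>2"
  proof -
    have "(\<Sum>j<n. LINT \<xi>|samples n. z (\<phi> (\<xi> i)) * z (\<phi> (\<xi> j)))
        = (\<Sum>j<n. if j = i then LINT \<xi>|samples n. z (\<phi> (\<xi> i)) * z (\<phi> (\<xi> i)) else 0)" if "i < n" for i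
      using off that by (intro sum.cong refl) auto
    then show ?thesis by simp
  qed
  also have "\<dots> \<le> (\<Sum>i<n. \<alpha> a) / (real n)\<^sup>2"
    using dia by (intro divide_right_mono sum_mono) auto
  also have "\<dots> = \<alpha> a / n" by (simp add: power2_eq_square)
  finally show ?thesis .
qed

text \<open>Frequencies of different labels come from the same sample and are dependent;
  Cauchy-Schwarz reduces the product to the two variances.\<close>

lemma expectation_\<Delta>_product_le:
  assumes "a < k" "b < k"
  shows "(LINT \<xi>|samples n. \<bar>\<Delta> a \<xi>\<bar> * \<bar>\<Delta> b \<xi>\<bar>) \<le> sqrt (\<alpha> a * \<alpha> b) / n"
proof -
  let ?E = "\<lambda>a b. LINT \<xi>|samples n. \<bar>\<Delta> a \<xi>\<bar> * \<bar>\<Delta> b \<xi>\<bar>"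
  have nn: "(\<integral>\<^sup>+\<xi>. ennreal \<bar>\<Delta> a \<xi>\<bar> * ennreal \<bar>\<Delta> b \<xi>\<bar> \<partial>samples n) = ennreal (?E a b)" for a b
    by (simp add: ennreal_mult[symmetric] nn_integral_eq_integral \<Delta>_integrable)
  have pos: "0 \<le> ?E a b" for a b by simp
  have "(ennreal (?E a b))\<^sup>2 \<le> ennreal (?E a a) * ennreal (?E b b)"
    unfolding nn[symmetric]
    using Cauchy_Schwarz_nn_integral[of "\<lambda>\<xi>. ennreal \<bar>\<Delta> a \<xi>\<bar>" "samples n" "\<lambda>\<xi>. ennreal \<bar>\<Delta> b \<xi>\<bar>"]
    by (simp add: power2_eq_square)
  then have "(?E a b)\<^sup>2 \<le> ?E a a * ?E b b"
    by (simp add: ennreal_mult[symmetric] ennreal_power)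
  also have "\<dots> \<le> (\<alpha> a / n) * (\<alpha> b / n)"
    using expectation_\<Delta>_square_le assms pos \<alpha>_nonneg by (intro mult_mono) auto
  finally have "?E a b \<le> sqrt ((\<alpha> a / n) * (\<alpha> b / n))" by (rule real_le_rsqrt)
  also have "\<dots> = sqrt (\<alpha> a * \<alpha> b) / n"
    by (simp add: real_sqrt_mult real_sqrt_divide)
  finally show ?thesis .
qed

lemma expectation_\<Delta>_le:
  assumes "a < k"
  shows "(LINT \<xi>|samples n. \<bar>\<Delta> a \<xi>\<bar>) \<le> sqrt (\<alpha> a / n)"
proof -
  have nn: "(\<integral>\<^sup>+\<xi>. ennreal \<bar>\<Delta> a \<xi>\<bar> * 1 \<partial>samples n) = ennreal (LINT \<xi>|samples n. \<bar>\<Delta> a \<xi>\<bar>)"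
    by (simp add: nn_integral_eq_integral \<Delta>_integrable)
  have nn2: "(\<integral>\<^sup>+\<xi>. ennreal \<bar>\<Delta> a \<xi>\<bar> * ennreal \<bar>\<Delta> a \<xi>\<bar> \<partial>samples n) = ennreal (LINT \<xi>|samples n. \<bar>\<Delta> a \<xi>\<bar> * \<bar>\<Delta> a \<xi>\<bar>)"
    by (simp add: ennreal_mult[symmetric] nn_integral_eq_integral \<Delta>_integrable del: abs_mult_self_eq)
  have "(ennreal (LINT \<xi>|samples n. \<bar>\<Delta> a \<xi>\<bar>))\<^sup>2 \<le> ennreal (LINT \<xi>|samples n. \<bar>\<Delta> a \<xi>\<bar> * \<bar>\<Delta> a \<xi>\<bar>)"
    unfolding nn[symmetric] nn2[symmetric]
    using Cauchy_Schwarz_nn_integral[of "\<lambda>\<xi>. ennreal \<bar>\<Delta> a \<xi>\<bar>" "samples n" "\<lambda>\<xi>. 1"]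
    by (simp add: power2_eq_square P.emeasure_space_1)
  then have "(LINT \<xi>|samples n. \<bar>\<Delta> a \<xi>\<bar>)\<^sup>2 \<le> (LINT \<xi>|samples n. \<bar>\<Delta> a \<xi>\<bar> * \<bar>\<Delta> a \<xi>\<bar>)"
    by (simp add: ennreal_power del: abs_mult_self_eq)
  also have "\<dots> \<le> \<alpha> a / n" by (rule expectation_\<Delta>_square_le[OF assms])
  finally show ?thesis by (rule real_le_rsqrt)
qed

lemma expectation_mismatch_le:
  assumes Q: "\<And>a b. a < k \<Longrightarrow> b < k \<Longrightarrow> 0 \<le> Q a b"
  shows "integrable (samples n) (mismatch Q)"
    and "(LINT \<xi>|samples n. mismatch Q \<xi>)
      \<le> (\<Sum>a<k. \<Sum>b<k. Q a b * (sqrt (\<alpha> a / n) * (2 * \<alpha> b) + sqrt (\<alpha> a * \<alpha> b) / n))"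
proof -
  have i: "integrable (samples n) (\<lambda>\<xi>. Q a b * (\<bar>\<Delta> a \<xi>\<bar> * (2 * \<alpha> b) + \<bar>\<Delta> a \<xi>\<bar> * \<bar>\<Delta> b \<xi>\<bar>))" for a b
    by (intro integrable_mult_right Bochner_Integration.integrable_add integrable_mult_left \<Delta>_integrable)
  show "integrable (samples n) (mismatch Q)"
    unfolding mismatch_def[abs_def] by (intro Bochner_Integration.integrable_sum i)
  have e: "(LINT \<xi>|samples n. Q a b * (\<bar>\<Delta> a \<xi>\<bar> * (2 * \<alpha> b) + \<bar>\<Delta> a \<xi>\<bar> * \<bar>\<Delta> b \<xi>\<bar>))
      = Q a b * ((LINT \<xi>|samples n. \<bar>\<Delta> a \<xi>\<bar>) * (2 * \<alpha> b) + (LINT \<xi>|samples n. \<bar>\<Delta> a \<xi>\<bar> * \<bar>\<Delta> b \<xi>\<bar>))" for a b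
    using \<Delta>_integrable(1)[of a] \<Delta>_integrable(2)[of a b]
    by (simp only: integral_mult_right_zero integral_mult_left_zero Bochner_Integration.integral_add integrable_mult_left)
  have "(LINT \<xi>|samples n. mismatch Q \<xi>)
    = (\<Sum>a<k. \<Sum>b<k. Q a b * ((LINT \<xi>|samples n. \<bar>\<Delta> a \<xi>\<bar>) * (2 * \<alpha> b) + (LINT \<xi>|samples n. \<bar>\<Delta> a \<xi>\<bar> * \<bar>\<Delta> b \<xi>\<bar>)))"
    by (simp only: mismatch_def Bochner_Integration.integral_sum Bochner_Integration.integrable_sum i e)
  also have "\<dots> \<le> (\<Sum>a<k. \<Sum>b<k. Q a b * (sqrt (\<alpha> a / n) * (2 * \<alpha> b) + sqrt (\<alpha> a * \<alpha> b) / n))"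
    using expectation_\<Delta>_le expectation_\<Delta>_product_le Q \<alpha>_nonneg
    by (intro sum_mono mult_left_mono add_mono mult_right_mono) auto
  finally show "(LINT \<xi>|samples n. mismatch Q \<xi>)
      \<le> (\<Sum>a<k. \<Sum>b<k. Q a b * (sqrt (\<alpha> a / n) * (2 * \<alpha> b) + sqrt (\<alpha> a * \<alpha> b) / n))" .
qed

end

subsection \<open>The risk bound for a given step function\<close>

text \<open>The counterpart of \<open>cut_dist_triangle\<close> for changing the second argument.
  That argument is rearranged by \<open>\<sigma>\<close>, so the added term has to be invariant
  under rearrangement; for the L1 norm this is a change of variables.\<close>

lemma cut_dist_triangle_L1:
  assumes "integrable_kernel U" "integrable_kernel V" "integrable_kernel W"
  shows "cut_dist U W \<le> cut_dist U V + L1_norm (\<lambda>x y. V x y - W x y)"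
proof -
  let ?L = "L1_norm (\<lambda>x y. V x y - W x y)"
  have "cut_dist U W - ?L \<le> cut_dist U V"
  proof (rule graphon_dist_greatest)
    fix \<sigma> assume \<sigma>: "\<sigma> \<in> mp_bijections"
    note k = kernel_mp_bijection[OF \<sigma> assms(2)] kernel_mp_bijection[OF \<sigma> assms(3)]
    have "cut_dist U W \<le> cut_norm (\<lambda>x y. U x y - W (\<sigma> x) (\<sigma> y))"
      by (rule cut_dist_le_cut_norm[OF \<sigma> assms(1,3)])
    also have "\<dots> \<le> cut_norm (\<lambda>x y. U x y - V (\<sigma> x) (\<sigma> y)) + cut_norm (\<lambda>x y. V (\<sigma> x) (\<sigma> y) - W (\<sigma> x) (\<sigma> y))"
      by (rule cut_norm_triangle[OF assms(1) k])
    also have "cut_norm (\<lambda>x y. V (\<sigma> x) (\<sigma> y) - W (\<sigma> x) (\<sigma> y)) \<le> L1_norm (\<lambda>x y. V (\<sigma> x) (\<sigma> y) - W (\<sigma> x) (\<sigma> y))"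
      by (rule cut_norm_le_L1_norm[OF kernel_diff[OF k]])
    also have "\<dots> = ?L"
    proof -
      have "(\<lambda>(x, y). \<bar>V x y - W x y\<bar>) \<in> borel_measurable unit_square"
        using borel_measurable_abs[OF borel_measurable_integrable[OF kernel_diff[OF assms(2,3)]]]
        by (simp add: case_prod_beta')
      then show ?thesis
        unfolding L1_norm_def by (rule integral_mp_bijection[OF \<sigma>])
    qed
    finally show "cut_dist U W - ?L \<le> cut_norm (\<lambda>x y. U x y - V (\<sigma> x) (\<sigma> y))" by simp
  qed
  then show ?thesis by simp
qed

lemma cut_norm_empirical_le_sum:
  assumes "0 < n"
  shows "cut_norm (\<lambda>x y. empirical_graphon n A x y - empirical_graphon n B x y)
    \<le> (\<Sum>i<n. \<Sum>j<n. \<bar>A $$ (i, j) - B $$ (i, j)\<bar>) / (real n)\<^sup>2"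
proof (rule cut_norm_empirical_le[OF assms])
  fix s t :: "nat \<Rightarrow> real"
  assume st: "\<And>i. i < n \<Longrightarrow> 0 \<le> s i \<and> s i \<le> 1 / n" "\<And>i. i < n \<Longrightarrow> 0 \<le> t i \<and> t i \<le> 1 / n"
  have "\<bar>\<Sum>i<n. \<Sum>j<n. (A $$ (i, j) - B $$ (i, j)) * s i * t j\<bar>
      \<le> (\<Sum>i<n. \<Sum>j<n. \<bar>(A $$ (i, j) - B $$ (i, j)) * s i * t j\<bar>)"
    by (rule order_trans[OF sum_abs]) (intro sum_mono sum_abs)
  also have "\<dots> \<le> (\<Sum>i<n. \<Sum>j<n. \<bar>A $$ (i, j) - B $$ (i, j)\<bar> * ((1 / n) * (1 / n)))"
  proof (intro sum_mono)
    fix i j assume "i \<in> {..<n}" "j \<in> {..<n}"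
    then have "0 \<le> s i" "s i \<le> 1 / n" "0 \<le> t j" "t j \<le> 1 / n" using st by auto
    then have "\<bar>s i * t j\<bar> \<le> (1 / n) * (1 / n)" unfolding abs_mult by (intro mult_mono) auto
    then show "\<bar>(A $$ (i, j) - B $$ (i, j)) * s i * t j\<bar> \<le> \<bar>A $$ (i, j) - B $$ (i, j)\<bar> * ((1 / n) * (1 / n))"
      unfolding mult.assoc abs_mult[of "A $$ (i, j) - B $$ (i, j)"] by (rule mult_left_mono) simp
  qed
  also have "\<dots> = (\<Sum>i<n. \<Sum>j<n. \<bar>A $$ (i, j) - B $$ (i, j)\<bar>) / (real n)\<^sup>2"
    by (simp add: sum_divide_distrib power2_eq_square)
  finally show "\<bar>\<Sum>i<n. \<Sum>j<n. (A $$ (i, j) - B $$ (i, j)) * s i * t j\<bar>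
     \<le> (\<Sum>i<n. \<Sum>j<n. \<bar>A $$ (i, j) - B $$ (i, j)\<bar>) / (real n)\<^sup>2" .
qed

lemma Lp_graphons_mp_bijection:
  assumes "W \<in> Lp_graphons p" "\<tau> \<in> mp_bijections"
  shows "(\<lambda>x y. W (\<tau> x) (\<tau> y)) \<in> Lp_graphons p"
proof -
  have \<tau>: "\<tau> x \<in> {0..1}" if "x \<in> {0..1}" for x using assms(2) that by (auto simp: mp_bijections_def bij_betw_def)
  have "case_prod (\<lambda>x y. W (\<tau> x) (\<tau> y)) \<in> borel_measurable unit_square"
    using measurable_compose[OF measurable_pair_mp_bijection[OF assms(2)], of "case_prod W" borel] assms(1)
    by (simp add: Lp_graphons_def case_prod_beta')
  moreover have "integrable_kernel (\<lambda>x y. \<bar>W (\<tau> x) (\<tau> y)\<bar> powr p)"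
    by (rule kernel_mp_bijection[OF assms(2)]) (use assms(1) in \<open>simp add: Lp_graphons_def\<close>)
  ultimately show ?thesis using assms(1) \<tau> by (auto simp: Lp_graphons_def simp del: atLeastAtMost_iff)
qed

text \<open>Applying \<open>\<tau>\<close> to every coordinate preserves the law of the sample, and
  sampling the rearranged graphon at \<open>\<xi>\<close> is sampling \<open>W\<close> at the moved
  points.\<close>

lemma graph_law_mp_bijection:
  assumes "W \<in> Lp_graphons p" "0 < \<rho>" "\<tau> \<in> mp_bijections"
  shows "graph_law n \<rho> (\<lambda>x y. W (\<tau> x) (\<tau> y)) = graph_law n \<rho> W"
proof -
  have [measurable]: "\<tau> \<in> measurable I01 I01" and d: "distr I01 I01 \<tau> = I01" using assms(3) by (auto simp: mp_bijections_def)
  have dP: "distr (samples n) (samples n) (compose {..<n} \<tau>) = samples n"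
    by (subst distr_PiM_finite_prob_space') (simp_all add: prob_space_I01 d)
  have c: "compose {..<n} \<tau> \<in> measurable (samples n) (samples n)"
    unfolding compose_def by measurable
  have "Theta0 n \<rho> W (compose {..<n} \<tau> \<xi>) = Theta0 n \<rho> (\<lambda>x y. W (\<tau> x) (\<tau> y)) \<xi>" for \<xi>
    by (rule eq_matI) (auto simp: Theta0_def compose_def)
  then have "graph_law n \<rho> (\<lambda>x y. W (\<tau> x) (\<tau> y)) =
      samples n \<bind> (\<lambda>\<xi>. measure_pmf (adjacency_pmf n (Theta0 n \<rho> W (compose {..<n} \<tau> \<xi>))))"
    by (simp add: graph_law_def)
  also have "\<dots> = distr (samples n) (samples n) (compose {..<n} \<tau>) \<bind> (\<lambda>\<xi>. measure_pmf (adjacency_pmf n (Theta0 n \<rho> W \<xi>)))"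
    by (rule bind_distr[symmetric, OF c adjacency_kernel_measurable[OF assms(1,2)]])
       (rule prob_space.not_empty[OF prob_space_samples])
  finally show ?thesis by (simp add: dP graph_law_def)
qed

definition truncated :: "real \<Rightarrow> (real \<Rightarrow> real \<Rightarrow> real) \<Rightarrow> real \<Rightarrow> real \<Rightarrow> real" where
  "truncated \<rho> W x y = min (\<rho> * W x y) 1"

lemma kernel_truncated:
  assumes "W \<in> Lp_graphons p" "0 < \<rho>"
  shows "integrable_kernel (truncated \<rho> W)"
proof (rule I2.P.integrable_const_bound[where B = 1])
  have [measurable]: "case_prod W \<in> borel_measurable unit_square"
    using assms(1) by (simp add: Lp_graphons_def)
  have "(\<lambda>z. min (\<rho> * case_prod W z) 1) \<in> borel_measurable unit_square"
    by measurable
  then show "case_prod (truncated \<rho> W) \<in> borel_measurable unit_square"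
    by (simp add: truncated_def[abs_def] case_prod_beta')
  show "AE z in unit_square. norm (case_prod (truncated \<rho> W) z) \<le> 1"
    by (rule AE_I2) (use assms in \<open>auto simp: space_pair_measure truncated_def Lp_graphons_def\<close>)
qed

text \<open>The first summand pays for the zero diagonal of \<open>Theta0\<close>, the second is
  twice the bound on the expected \<open>mismatch\<close>. The factor \<open>\<rho>\<close> is left
  out.\<close>

definition (in labelled_sample) step_error :: "(nat \<Rightarrow> nat \<Rightarrow> real) \<Rightarrow> real" where
  "step_error Q = (\<Sum>a<k. Q a a * \<alpha> a) / n +
     2 * (\<Sum>a<k. \<Sum>b<k. Q a b * (sqrt (\<alpha> a / n) * (2 * \<alpha> b) + sqrt (\<alpha> a * \<alpha> b) / n))"

context labelled_sample
begin

text \<open>The chain runs from \<open>Theta0\<close> to the sampled step function \<open>B\<close>,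
  then to the step function itself, then to the target. The first link compares entries and meets
  the diagonal, where \<open>B\<close> is not 0; the second is the matching of labels; the third is
  an L1 distance on the square.\<close>

lemma cut_dist_sample_le:
  assumes W: "W \<in> Lp_graphons p" and \<rho>: "0 < \<rho>" and \<xi>: "\<xi> \<in> space (samples n)"
    and Q: "\<And>a b. a < k \<Longrightarrow> b < k \<Longrightarrow> 0 \<le> Q a b \<and> Q a b = Q b a"
  defines "H \<equiv> \<lambda>x y. \<rho> * Q (\<phi> x) (\<phi> y) - truncated \<rho> W x y"
  shows "cut_dist (empirical_graphon n (Theta0 n \<rho> W \<xi>)) (truncated \<rho> W) \<le>
    (\<Sum>i<n. \<Sum>j<n. if i = j then \<rho> * Q (\<phi> (\<xi> i)) (\<phi> (\<xi> i)) else \<bar>H (\<xi> i) (\<xi> j)\<bar>) / (real n)\<^sup>2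
    + 2 * \<rho> * mismatch Q \<xi>
    + L1_norm H"
proof -
  define B where "B = mat n n (\<lambda>(i, j). \<rho> * Q (\<phi> (\<xi> i)) (\<phi> (\<xi> j)))"
  let ?V = "\<lambda>x y. \<rho> * Q (\<phi> x) (\<phi> y)"
  have \<xi>01: "\<xi> i \<in> {0..1}" if "i < n" for i
    using \<xi> that by (auto simp: space_PiM PiE_iff)
  have kW: "integrable_kernel (truncated \<rho> W)" by (rule kernel_truncated[OF W \<rho>])
  have kV: "integrable_kernel ?V" by (rule kernel_step[OF \<phi> \<phi> k k])
  note kB = kernel_empirical_graphon[OF n]
  have "cut_dist (empirical_graphon n (Theta0 n \<rho> W \<xi>)) (truncated \<rho> W)
      \<le> cut_norm (\<lambda>x y. empirical_graphon n (Theta0 n \<rho> W \<xi>) x y - empirical_graphon n B x y)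
        + cut_dist (empirical_graphon n B) (truncated \<rho> W)"
    by (rule cut_dist_triangle[OF kB kB kW])
  also have "cut_norm (\<lambda>x y. empirical_graphon n (Theta0 n \<rho> W \<xi>) x y - empirical_graphon n B x y)
      \<le> (\<Sum>i<n. \<Sum>j<n. \<bar>Theta0 n \<rho> W \<xi> $$ (i, j) - B $$ (i, j)\<bar>) / (real n)\<^sup>2"
    by (rule cut_norm_empirical_le_sum[OF n])
  also have "(\<Sum>i<n. \<Sum>j<n. \<bar>Theta0 n \<rho> W \<xi> $$ (i, j) - B $$ (i, j)\<bar>)
      = (\<Sum>i<n. \<Sum>j<n. if i = j then \<rho> * Q (\<phi> (\<xi> i)) (\<phi> (\<xi> i)) else \<bar>H (\<xi> i) (\<xi> j)\<bar>)"
  proof (intro sum.cong refl)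
    fix i j assume ij: "i \<in> {..<n}" "j \<in> {..<n}"
    then have "0 \<le> Q (\<phi> (\<xi> i)) (\<phi> (\<xi> i))" using Q k \<xi>01 by auto
    then show "\<bar>Theta0 n \<rho> W \<xi> $$ (i, j) - B $$ (i, j)\<bar>
        = (if i = j then \<rho> * Q (\<phi> (\<xi> i)) (\<phi> (\<xi> i)) else \<bar>H (\<xi> i) (\<xi> j)\<bar>)"
      using ij \<rho> by (auto simp: Theta0_def B_def H_def truncated_def abs_minus_commute)
  qed
  also have "cut_dist (empirical_graphon n B) (truncated \<rho> W) \<le> cut_dist (empirical_graphon n B) ?V + L1_norm H"
    unfolding H_def by (rule cut_dist_triangle_L1[OF kB kV kW])
  also have "cut_dist (empirical_graphon n B) ?V \<le> 2 * (\<Sum>a<k. \<Sum>b<k. \<rho> * Q a b * \<bar>\<Delta> a \<xi>\<bar> * (\<alpha> b + \<beta> \<xi> b))"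
    unfolding B_def \<alpha>_def \<beta>_def
    by (rule cut_dist_step_le[where Q = "\<lambda>a b. \<rho> * Q a b" and \<psi> = "\<lambda>i. \<phi> (\<xi> i)"])
       (use \<phi> k n \<xi>01 Q \<rho> in auto)
  also have "\<dots> \<le> 2 * \<rho> * mismatch Q \<xi>"
  proof -
    have "\<rho> * Q a b * \<bar>\<Delta> a \<xi>\<bar> * (\<alpha> b + \<beta> \<xi> b) \<le> \<rho> * (Q a b * (\<bar>\<Delta> a \<xi>\<bar> * (2 * \<alpha> b) + \<bar>\<Delta> a \<xi>\<bar> * \<bar>\<Delta> b \<xi>\<bar>))"
      if "a < k" "b < k" for a b
    proof -
      have "\<rho> * Q a b * \<bar>\<Delta> a \<xi>\<bar> * (\<alpha> b + \<beta> \<xi> b) \<le> \<rho> * Q a b * \<bar>\<Delta> a \<xi>\<bar> * (2 * \<alpha> b + \<bar>\<Delta> b \<xi>\<bar>)"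
        using \<rho> Q[OF that] by (intro mult_left_mono) auto
      then show ?thesis by (simp add: algebra_simps)
    qed
    then show ?thesis
      unfolding mismatch_def mult.assoc[of 2] sum_distrib_left[of \<rho>] by (intro mult_left_mono sum_mono) auto
  qed
  finally show ?thesis by simp
qed

text \<open>The parameter \<open>1 / (2 * sqrt (\<rho> * n))\<close> of the exponential moment balances the entropy \<open>n\<close>
  of the union bound against the expected number \<open>\<rho> * n\<^sup>2\<close> of edges.\<close>

lemma expected_cut_dist_le:
  assumes W: "W \<in> Lp_graphons p" and kW: "integrable_kernel W" and L1: "L1_norm W \<le> 1"
    and \<rho>: "0 < \<rho>" "1 / n \<le> \<rho>"
    and Q: "\<And>a b. a < k \<Longrightarrow> b < k \<Longrightarrow> 0 \<le> Q a b \<and> Q a b = Q b a"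
    and F: "\<And>A. A \<in> carrier_mat n n \<Longrightarrow>
      cut_norm (\<lambda>x y. empirical_graphon n (F A) x y - empirical_graphon n A x y) \<le> \<kappa>" and \<kappa>: "0 \<le> \<kappa>"
  defines "H \<equiv> \<lambda>x y. \<rho> * Q (\<phi> x) (\<phi> y) - truncated \<rho> W x y"
  shows "(\<integral>\<^sup>+A. ennreal (cut_dist (empirical_graphon n (F A)) (truncated \<rho> W)) \<partial>graph_law n \<rho> W)
    \<le> ennreal (\<kappa> + 8 * sqrt (\<rho> / n) + 2 * L1_norm H + \<rho> * step_error Q)"
proof -
  let ?d = "\<lambda>A. cut_dist (empirical_graphon n (F A)) (truncated \<rho> W)"
  define u where "u = 1 / (2 * sqrt (\<rho> * n))"
  have "1 \<le> \<rho> * n" using \<rho> n by (simp add: field_simps)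
  then have "1 \<le> sqrt (\<rho> * n)" by simp
  then have u: "0 < u" "u \<le> 1 / 2" by (simp_all add: u_def)
  \<comment> \<open>The edge probabilities enter without truncation, so that their mean follows from
    the norm of \<open>W\<close>.\<close>
  define V where "V \<xi> = (\<Sum>(i, j)\<in>edges n. \<rho> * W (\<xi> i) (\<xi> j))" for \<xi>
  define T where "T \<xi> = (\<Sum>i<n. \<Sum>j<n. if i = j then \<rho> * Q (\<phi> (\<xi> i)) (\<phi> (\<xi> i)) else \<bar>H (\<xi> i) (\<xi> j)\<bar>)" for \<xi>
  \<comment> \<open>A bound on the risk conditional on the sample. Its expectation requires only
    those of \<open>V\<close>, \<open>T\<close> and \<open>mismatch Q\<close>.\<close>
  define G where "G \<xi> = \<kappa> + ((ln 2 + 2 * real n * ln 2) / u + 4 * u * V \<xi>) / (real n)\<^sup>2 + (T \<xi> / (real n)\<^sup>2 + 2 * \<rho> * mismatch Q \<xi> + L1_norm H)" for \<xi>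
  have Wpos: "0 \<le> W x y" "W x y = W y x" if "x \<in> {0..1}" "y \<in> {0..1}" for x y
    using W that by (auto simp: Lp_graphons_def)
  have kt: "integrable_kernel (truncated \<rho> W)" by (rule kernel_truncated[OF W \<rho>(1)])
  note kB = kernel_empirical_graphon[OF n]
  have inner: "(\<integral>\<^sup>+A. ennreal (?d A) \<partial>adjacency_pmf n (Theta0 n \<rho> W \<xi>)) \<le> ennreal (G \<xi>)"
    if \<xi>: "\<xi> \<in> space (samples n)" for \<xi>
  proof -
    let ?\<Theta> = "Theta0 n \<rho> W \<xi>"
    let ?P = "adjacency_pmf n ?\<Theta>"
    have \<xi>01: "\<xi> i \<in> {0..1}" if "i < n" for i
      using \<xi> that by (auto simp: space_PiM PiE_iff)
    have \<Theta>: "0 \<le> ?\<Theta> $$ (i, j) \<and> ?\<Theta> $$ (i, j) \<le> 1 \<and> ?\<Theta> $$ (i, j) = ?\<Theta> $$ (j, i)" if "i < n" "j < n" for i j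
      using that Wpos \<xi>01 \<rho>(1) by (auto simp: Theta0_def)
    have diag: "?\<Theta> $$ (i, i) = 0" if "i < n" for i using that by (simp add: Theta0_def)
    let ?c = "T \<xi> / (real n)\<^sup>2 + 2 * \<rho> * mismatch Q \<xi> + L1_norm H"
    let ?g = "\<lambda>A. \<kappa> + max_deviation n A ?\<Theta> / (real n)\<^sup>2 + ?c"
    have int: "integrable (measure_pmf ?P) (f :: _ \<Rightarrow> real)" for f
      by (rule integrable_measure_pmf_finite[OF finite_set_adjacency_pmf])
    have pw: "?d A \<le> ?g A" if "A \<in> set_pmf ?P" for A
    proof -
      have A: "A \<in> carrier_mat n n" using that by (auto simp: adjacency_pmf_def adjacency_matrix_def)
      have "?d A
          \<le> cut_norm (\<lambda>x y. empirical_graphon n (F A) x y - empirical_graphon n A x y) + cut_dist (empirical_graphon n A) (truncated \<rho> W)"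
        by (rule cut_dist_triangle[OF kB kB kt])
      moreover have "cut_dist (empirical_graphon n A) (truncated \<rho> W)
          \<le> cut_norm (\<lambda>x y. empirical_graphon n A x y - empirical_graphon n ?\<Theta> x y) + cut_dist (empirical_graphon n ?\<Theta>) (truncated \<rho> W)"
        by (rule cut_dist_triangle[OF kB kB kt])
      moreover have "cut_dist (empirical_graphon n ?\<Theta>) (truncated \<rho> W) \<le> ?c"
        using cut_dist_sample_le[OF W \<rho>(1) \<xi> Q] unfolding T_def H_def .
      ultimately show ?thesis using F[OF A] cut_norm_le_max_deviation[OF n, of A ?\<Theta>] by linarith
    qed
    have pos: "0 \<le> ?d A" for A by (rule cut_dist_nonneg[OF kB kt])
    have "(\<integral>\<^sup>+A. ennreal (?d A) \<partial>?P) \<le> (\<integral>\<^sup>+A. ennreal (?g A) \<partial>?P)"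
      by (rule nn_integral_mono_AE) (use pw in \<open>auto simp: AE_measure_pmf_iff intro!: ennreal_leI\<close>)
    also have "\<dots> = ennreal (measure_pmf.expectation ?P ?g)"
    proof (rule nn_integral_eq_integral[OF int])
      have "0 \<le> ?g A" if "A \<in> set_pmf ?P" for A using pw[OF that] pos[of A] by linarith
      then show "AE A in measure_pmf ?P. 0 \<le> ?g A" by (auto simp: AE_measure_pmf_iff)
    qed
    also have "measure_pmf.expectation ?P ?g = \<kappa> + measure_pmf.expectation ?P (\<lambda>A. max_deviation n A ?\<Theta>) / (real n)\<^sup>2 + ?c"
      by (simp add: int)
    also have "\<dots> \<le> G \<xi>"
    proof -
      have "measure_pmf.expectation ?P (\<lambda>A. max_deviation n A ?\<Theta>)
          \<le> (ln 2 + 2 * real n * ln 2) / u + 4 * u * (\<Sum>ij\<in>edges n. ?\<Theta> $$ ij)"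
        by (rule expectation_max_deviation[OF \<Theta> diag u])
      also have "(\<Sum>ij\<in>edges n. ?\<Theta> $$ ij) \<le> V \<xi>"
        unfolding V_def by (rule sum_mono) (auto simp: Theta0_def)
      finally have "measure_pmf.expectation ?P (\<lambda>A. max_deviation n A ?\<Theta>) \<le> (ln 2 + 2 * real n * ln 2) / u + 4 * u * V \<xi>"
        using u by simp
      then have "measure_pmf.expectation ?P (\<lambda>A. max_deviation n A ?\<Theta>) / (real n)\<^sup>2 \<le> ((ln 2 + 2 * real n * ln 2) / u + 4 * u * V \<xi>) / (real n)\<^sup>2"
        by (rule divide_right_mono) simp
      then show ?thesis unfolding G_def by linarith
    qed
    finally show ?thesis by (simp add: ennreal_leI)
  qed
  have kH: "integrable_kernel (\<lambda>x y. \<bar>H x y\<bar>)"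
  proof -
    have "integrable_kernel H" unfolding H_def by (rule kernel_diff[OF kernel_step[OF \<phi> \<phi> k k] kt])
    then have "integrable unit_square (\<lambda>z. \<bar>case_prod H z\<bar>)" by (rule integrable_abs)
    then show ?thesis by (simp add: case_prod_beta')
  qed
  have iV: "integrable (samples n) V" and eV: "(LINT \<xi>|samples n. V \<xi>) \<le> (real n)\<^sup>2 * \<rho>"
  proof -
    have i: "integrable (samples n) (\<lambda>\<xi>. \<rho> * W (\<xi> i) (\<xi> j))" "(LINT \<xi>|samples n. \<rho> * W (\<xi> i) (\<xi> j)) \<le> \<rho>"
      if "(i, j) \<in> edges n" for i j
    proof -
      have ij: "i < n" "j < n" "i \<noteq> j" using that by auto
      show "integrable (samples n) (\<lambda>\<xi>. \<rho> * W (\<xi> i) (\<xi> j))"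
        using samples_pair(1)[OF ij kW] by simp
      have "(LINT (x, y)|unit_square. W x y) \<le> L1_norm W"
        unfolding L1_norm_def case_prod_beta'
        using kW integrable_abs[OF kW] by (intro integral_mono) (auto simp: case_prod_beta')
      then have "(LINT \<xi>|samples n. W (\<xi> i) (\<xi> j)) \<le> 1" unfolding samples_pair(2)[OF ij kW] using L1 by linarith
      then have "\<rho> * (LINT \<xi>|samples n. W (\<xi> i) (\<xi> j)) \<le> \<rho> * 1" using \<rho>(1) by (intro mult_left_mono) auto
      then show "(LINT \<xi>|samples n. \<rho> * W (\<xi> i) (\<xi> j)) \<le> \<rho>" by simp
    qed
    show "integrable (samples n) V" unfolding V_def
      by (rule Bochner_Integration.integrable_sum) (use i(1) in auto)
    have "(LINT \<xi>|samples n. V \<xi>) = (\<Sum>(i, j)\<in>edges n. LINT \<xi>|samples n. \<rho> * W (\<xi> i) (\<xi> j))"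
      unfolding V_def case_prod_beta' by (rule Bochner_Integration.integral_sum) (use i(1) in auto)
    also have "\<dots> \<le> (\<Sum>(i, j)\<in>edges n. \<rho>)" by (rule sum_mono) (use i(2) in auto)
    also have "\<dots> = card (edges n) * \<rho>" by (simp add: case_prod_beta')
    also have "\<dots> \<le> (real n)\<^sup>2 * \<rho>"
    proof -
      have "card (edges n) \<le> card ({..<n} \<times> {..<n})" by (rule card_mono) auto
      then have "real (card (edges n)) \<le> (real n)\<^sup>2" by (simp add: power2_eq_square flip: of_nat_mult)
      then show ?thesis using \<rho>(1) by (intro mult_right_mono) auto
    qed
    finally show "(LINT \<xi>|samples n. V \<xi>) \<le> (real n)\<^sup>2 * \<rho>" .
  qed
  have iT: "integrable (samples n) T"
    and eT: "(LINT \<xi>|samples n. T \<xi>) \<le> n * \<rho> * (\<Sum>a<k. Q a a * \<alpha> a) + (real n)\<^sup>2 * L1_norm H"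
  proof -
    let ?t = "\<lambda>i j \<xi>. if i = j then \<rho> * Q (\<phi> (\<xi> i)) (\<phi> (\<xi> i)) else \<bar>H (\<xi> i) (\<xi> j)\<bar>"
    let ?d = "\<Sum>a<k. Q a a * \<alpha> a"
    have i: "integrable (samples n) (?t i j)" if "i < n" "j < n" for i j
      using samples_pair(1)[OF that _ kH] label_expectation(1)[OF that(1), of "\<lambda>a. \<rho> * Q a a"]
      by (cases "i = j") auto
    have e: "(LINT \<xi>|samples n. ?t i j \<xi>) = (if i = j then \<rho> * ?d else L1_norm H)" if "i < n" "j < n" for i j
    proof (cases "i = j")
      case True
      have "(LINT \<xi>|samples n. \<rho> * Q (\<phi> (\<xi> i)) (\<phi> (\<xi> i))) = \<rho> * ?d"
        unfolding label_expectation(2)[OF that(1), of "\<lambda>a. \<rho> * Q a a"] by (simp add: sum_distrib_left mult.assoc)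
      then show ?thesis using True by simp
    next
      case False
      then show ?thesis using samples_pair(2)[OF that False kH] by (simp add: L1_norm_def)
    qed
    show "integrable (samples n) T" unfolding T_def
      by (intro Bochner_Integration.integrable_sum) (use i in auto)
    have "(LINT \<xi>|samples n. T \<xi>) = (\<Sum>i<n. LINT \<xi>|samples n. (\<Sum>j<n. ?t i j \<xi>))"
      unfolding T_def by (rule Bochner_Integration.integral_sum, rule Bochner_Integration.integrable_sum) (use i in auto)
    also have "\<dots> = (\<Sum>i<n. \<Sum>j<n. LINT \<xi>|samples n. ?t i j \<xi>)"
      by (rule sum.cong[OF refl], rule Bochner_Integration.integral_sum) (use i in auto)
    also have "\<dots> = (\<Sum>i<n. \<Sum>j<n. if i = j then \<rho> * ?d else L1_norm H)"
      by (intro sum.cong refl) (use e in auto)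
    also have "\<dots> \<le> (\<Sum>i<n. \<Sum>j<n. (if i = j then \<rho> * ?d else 0) + L1_norm H)"
      by (intro sum_mono) (use L1_norm_nonneg in auto)
    also have "\<dots> = n * \<rho> * ?d + (real n)\<^sup>2 * L1_norm H"
      by (simp add: sum.distrib power2_eq_square algebra_simps)
    finally show "(LINT \<xi>|samples n. T \<xi>) \<le> n * \<rho> * ?d + (real n)\<^sup>2 * L1_norm H" .
  qed
  let ?m = "\<Sum>a<k. \<Sum>b<k. Q a b * (sqrt (\<alpha> a / n) * (2 * \<alpha> b) + sqrt (\<alpha> a * \<alpha> b) / n)"
  have iM: "integrable (samples n) (mismatch Q)" and eM: "(LINT \<xi>|samples n. mismatch Q \<xi>) \<le> ?m"
    using expectation_mismatch_le[of Q] Q by auto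
  have iG: "integrable (samples n) G"
    unfolding G_def using iV iT iM by simp
  have "(LINT \<xi>|samples n. G \<xi>) = \<kappa> + ((ln 2 + 2 * real n * ln 2) / u + 4 * u * (LINT \<xi>|samples n. V \<xi>)) / (real n)\<^sup>2
      + ((LINT \<xi>|samples n. T \<xi>) / (real n)\<^sup>2 + 2 * \<rho> * (LINT \<xi>|samples n. mismatch Q \<xi>) + L1_norm H)"
    unfolding G_def using iV iT iM by (simp add: P.prob_space)
  also have "\<dots> \<le> \<kappa> + ((ln 2 + 2 * real n * ln 2) / u + 4 * u * ((real n)\<^sup>2 * \<rho>)) / (real n)\<^sup>2
      + ((n * \<rho> * (\<Sum>a<k. Q a a * \<alpha> a) + (real n)\<^sup>2 * L1_norm H) / (real n)\<^sup>2 + 2 * \<rho> * ?m + L1_norm H)"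
    using eV eT eM u \<rho>(1) by (intro add_mono divide_right_mono mult_left_mono order_refl) auto
  also have "(n * \<rho> * (\<Sum>a<k. Q a a * \<alpha> a) + (real n)\<^sup>2 * L1_norm H) / (real n)\<^sup>2
      = \<rho> * ((\<Sum>a<k. Q a a * \<alpha> a) / n) + L1_norm H"
    using n by (simp add: add_divide_distrib power2_eq_square)
  also have "((ln 2 + 2 * real n * ln 2) / u + 4 * u * ((real n)\<^sup>2 * \<rho>)) / (real n)\<^sup>2 \<le> 8 * sqrt (\<rho> / n)"
  proof -
    define r where "r = sqrt (\<rho> * n)"
    have r: "1 \<le> r" "r\<^sup>2 = \<rho> * n" using \<open>1 \<le> sqrt (\<rho> * n)\<close> \<rho>(1) by (simp_all add: r_def)
    have rn: "sqrt (\<rho> / n) = r / n"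
    proof -
      have "sqrt (\<rho> / n) = sqrt (\<rho> * n / (real n)\<^sup>2)" using n by (simp add: power2_eq_square)
      also have "\<dots> = r / n" by (simp add: r_def real_sqrt_divide)
      finally show ?thesis .
    qed
    \<comment> \<open>The constant 8 arises as 3 * 2 + 2: the entropy is at most 3 n and is divided
      by \<open>u\<close>, which contributes 2 r, while the edge term equals 2 n r.\<close>
    have "ln 2 + 2 * real n * ln 2 \<le> 1 + 2 * real n * 1"
      using ln_2_less_1 n by (intro add_mono mult_left_mono less_imp_le) simp_all
    also have "\<dots> \<le> 3 * n" using n by simp
    finally have "(ln 2 + 2 * real n * ln 2) / u \<le> 3 * n * (2 * r)"
      using r(1) by (simp add: u_def r_def[symmetric] mult_right_mono)
    moreover have "4 * u * ((real n)\<^sup>2 * \<rho>) = 2 * n * r"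
      using r by (simp add: u_def r_def[symmetric] field_simps power2_eq_square)
    ultimately have "(ln 2 + 2 * real n * ln 2) / u + 4 * u * ((real n)\<^sup>2 * \<rho>) \<le> 3 * n * (2 * r) + 2 * n * r"
      by (intro add_mono) simp_all
    also have "\<dots> = 8 * n * r" by simp
    finally have "((ln 2 + 2 * real n * ln 2) / u + 4 * u * ((real n)\<^sup>2 * \<rho>)) / (real n)\<^sup>2 \<le> (8 * n * r) / (real n)\<^sup>2"
      by (rule divide_right_mono) simp
    also have "\<dots> = 8 * sqrt (\<rho> / n)" using n by (simp add: rn power2_eq_square)
    finally show ?thesis .
  qed
  finally have "(LINT \<xi>|samples n. G \<xi>) \<le> \<kappa> + 8 * sqrt (\<rho> / n) + (\<rho> * ((\<Sum>a<k. Q a a * \<alpha> a) / n) + L1_norm H + 2 * \<rho> * ?m + L1_norm H)"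
    by simp
  also have "\<dots> = \<kappa> + 8 * sqrt (\<rho> / n) + 2 * L1_norm H + \<rho> * step_error Q"
    by (simp add: step_error_def algebra_simps)
  finally have EG: "(LINT \<xi>|samples n. G \<xi>) \<le> \<kappa> + 8 * sqrt (\<rho> / n) + 2 * L1_norm H + \<rho> * step_error Q" .
  have posG: "0 \<le> G \<xi>" if "\<xi> \<in> space (samples n)" for \<xi>
  proof -
    have \<xi>01: "\<xi> i \<in> {0..1}" if "i < n" for i
      using \<open>\<xi> \<in> space (samples n)\<close> that by (auto simp: space_PiM PiE_iff)
    have "0 \<le> V \<xi>" unfolding V_def using Wpos \<xi>01 \<rho>(1) by (intro sum_nonneg) auto
    moreover have "0 \<le> T \<xi>" unfolding T_def using Q k \<xi>01 \<rho>(1) by (intro sum_nonneg) auto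
    moreover have "0 \<le> mismatch Q \<xi>" unfolding mismatch_def using Q \<alpha>_nonneg by (intro sum_nonneg mult_nonneg_nonneg) auto
    ultimately show ?thesis unfolding G_def using \<kappa> u \<rho>(1) L1_norm_nonneg[of H] by (intro add_nonneg_nonneg divide_nonneg_nonneg mult_nonneg_nonneg) auto
  qed
  have "(\<integral>\<^sup>+A. ennreal (?d A) \<partial>graph_law n \<rho> W)
    = (\<integral>\<^sup>+\<xi>. \<integral>\<^sup>+A. ennreal (?d A) \<partial>adjacency_pmf n (Theta0 n \<rho> W \<xi>) \<partial>samples n)"
    unfolding graph_law_def by (rule nn_integral_bind[OF _ adjacency_kernel_measurable[OF W \<rho>(1)]]) simp
  also have "\<dots> \<le> (\<integral>\<^sup>+\<xi>. ennreal (G \<xi>) \<partial>samples n)" by (rule nn_integral_mono) (rule inner)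
  also have "\<dots> = ennreal (LINT \<xi>|samples n. G \<xi>)"
    by (rule nn_integral_eq_integral[OF iG]) (use posG in auto)
  also have "\<dots> \<le> ennreal (\<kappa> + 8 * sqrt (\<rho> / n) + 2 * L1_norm H + \<rho> * step_error Q)"
    using EG by (rule ennreal_leI)
  finally show ?thesis .
qed

end

subsection \<open>The two classes of step functions\<close>

lemma (in labelled_sample) L1_norm_step:
  assumes "\<And>a b. a < k \<Longrightarrow> b < k \<Longrightarrow> 0 \<le> Q a b"
  shows "L1_norm (\<lambda>x y. Q (\<phi> x) (\<phi> y)) = (\<Sum>a<k. \<Sum>b<k. Q a b * \<alpha> a * \<alpha> b)"
  unfolding L1_norm_def step_kernel_integral[of "\<lambda>a b. \<bar>Q a b\<bar>"]
  using assms by (intro sum.cong refl) simp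

lemma (in labelled_sample) L2_norm_step:
  "L2_norm (\<lambda>x y. Q (\<phi> x) (\<phi> y)) = sqrt (\<Sum>a<k. \<Sum>b<k. (Q a b)\<^sup>2 * \<alpha> a * \<alpha> b)"
  unfolding L2_norm_def step_kernel_integral[of "\<lambda>a b. (Q a b)\<^sup>2"] ..

text \<open>Balance says 1 / n \<le> s^2 * \<alpha> a for the rate s = sqrt (k / (\<mu> n)), hence
  sqrt (\<alpha> a / n) \<le> s * \<alpha> a: each fluctuation is at most \<open>s\<close> times the
  block measure. As \<open>s\<close> is at most 1, the terms with \<open>s\<^sup>2\<close> are
  absorbed as well, and every sum becomes a multiple of the L1 norm.\<close>

lemma (in labelled_sample) step_error_balanced:
  fixes \<mu> :: real
  assumes Q: "\<And>a b. a < k \<Longrightarrow> b < k \<Longrightarrow> 0 \<le> Q a b"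
    and \<mu>: "0 < \<mu>" and bal: "\<And>a. a < k \<Longrightarrow> \<mu> / k \<le> \<alpha> a" and kn: "k \<le> \<mu> * n"
  shows "step_error Q \<le> 7 * L1_norm (\<lambda>x y. Q (\<phi> x) (\<phi> y)) * sqrt (k / (\<mu> * n))"
proof -
  define s where "s = sqrt (k / (\<mu> * n))"
  have k0: "0 < k" using k[of 0] by simp
  have s2: "s\<^sup>2 = k / (\<mu> * n)" using \<mu> n by (simp add: s_def)
  have s: "0 \<le> s" "s \<le> 1" using \<mu> n kn by (auto simp: s_def)
  have ss: "s\<^sup>2 \<le> s" using s by (simp add: power2_eq_square mult_left_le)
  have inv: "1 / n \<le> s\<^sup>2 * \<alpha> a" if "a < k" for a
  proof -
    have "1 / n = s\<^sup>2 * (\<mu> / k)" using \<mu> k0 n by (simp add: s2)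
    also have "\<dots> \<le> s\<^sup>2 * \<alpha> a" using bal[OF that] by (intro mult_left_mono) auto
    finally show ?thesis .
  qed
  have sq: "sqrt (\<alpha> a / n) \<le> s * \<alpha> a" if "a < k" for a
  proof -
    have "\<alpha> a / n = \<alpha> a * (1 / n)" by simp
    also have "\<dots> \<le> \<alpha> a * (s\<^sup>2 * \<alpha> a)" using inv[OF that] \<alpha>_nonneg by (rule mult_left_mono)
    also have "\<dots> = (s * \<alpha> a)\<^sup>2" by (simp add: power2_eq_square)
    finally show ?thesis using s \<alpha>_nonneg by (simp add: real_le_lsqrt)
  qed
  have sq2: "sqrt (\<alpha> a * \<alpha> b) / n \<le> s * (\<alpha> a * \<alpha> b)" if "a < k" "b < k" for a b
  proof -
    have "sqrt (\<alpha> a * \<alpha> b) / n = sqrt (\<alpha> a / n) * sqrt (\<alpha> b / n)"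
      by (simp add: real_sqrt_mult real_sqrt_divide)
    also have "\<dots> \<le> (s * \<alpha> a) * (s * \<alpha> b)" using sq that s \<alpha>_nonneg by (intro mult_mono) auto
    also have "\<dots> = s\<^sup>2 * (\<alpha> a * \<alpha> b)" by (simp add: power2_eq_square)
    also have "\<dots> \<le> s * (\<alpha> a * \<alpha> b)" using ss \<alpha>_nonneg by (intro mult_right_mono) auto
    finally show ?thesis .
  qed
  let ?w = "\<Sum>a<k. \<Sum>b<k. Q a b * \<alpha> a * \<alpha> b"
  have "(\<Sum>a<k. Q a a * \<alpha> a) / n = (\<Sum>a<k. Q a a * \<alpha> a * (1 / n))"
    by (simp add: sum_divide_distrib)
  also have "\<dots> \<le> (\<Sum>a<k. s * (Q a a * \<alpha> a * \<alpha> a))"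
  proof (rule sum_mono)
    fix a assume a: "a \<in> {..<k}"
    have "1 / n \<le> s * \<alpha> a" using inv[of a] a mult_right_mono[OF ss \<alpha>_nonneg[of a]] by simp
    then have "Q a a * \<alpha> a * (1 / n) \<le> Q a a * \<alpha> a * (s * \<alpha> a)"
      using Q a \<alpha>_nonneg by (intro mult_left_mono mult_nonneg_nonneg) auto
    then show "Q a a * \<alpha> a * (1 / n) \<le> s * (Q a a * \<alpha> a * \<alpha> a)" by (simp add: mult_ac)
  qed
  also have "\<dots> \<le> s * ?w"
    unfolding sum_distrib_left[symmetric]
  proof (intro mult_left_mono sum_mono s)
    fix a assume a: "a \<in> {..<k}"
    show "Q a a * \<alpha> a * \<alpha> a \<le> (\<Sum>b<k. Q a b * \<alpha> a * \<alpha> b)"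
      by (rule member_le_sum[of a "{..<k}" "\<lambda>b. Q a b * \<alpha> a * \<alpha> b"]) (use a Q \<alpha>_nonneg in auto)
  qed
  finally have 1: "(\<Sum>a<k. Q a a * \<alpha> a) / n \<le> s * ?w" .
  have "(\<Sum>a<k. \<Sum>b<k. Q a b * (sqrt (\<alpha> a / n) * (2 * \<alpha> b) + sqrt (\<alpha> a * \<alpha> b) / n))
      \<le> (\<Sum>a<k. \<Sum>b<k. Q a b * ((s * \<alpha> a) * (2 * \<alpha> b) + s * (\<alpha> a * \<alpha> b)))"
    using sq sq2 Q \<alpha>_nonneg by (intro sum_mono mult_left_mono add_mono mult_right_mono) auto
  also have "\<dots> = 3 * s * ?w"
    unfolding sum_distrib_left by (intro sum.cong refl) (simp add: algebra_simps)
  finally have "step_error Q \<le> s * ?w + 2 * (3 * s * ?w)"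
    unfolding step_error_def using 1 by (intro add_mono mult_left_mono) auto
  then show ?thesis by (simp add: L1_norm_step[of Q, OF Q] s_def mult_ac)
qed

text \<open>Cauchy-Schwarz over the pairs of labels: the factor
  \<open>Q a b * sqrt (\<alpha> a * \<alpha> b)\<close> has Euclidean norm \<open>w\<close>, and
  what remains in the three sums is the identity matrix, \<open>sqrt (\<alpha> b)\<close> and the
  constant 1, of norms sqrt k, sqrt k and k. Since 1 \<le> k \<le> n, dividing by n, sqrt n and n
  respectively leaves at most \<open>s\<close> each time.\<close>

lemma (in labelled_sample) step_error_square:
  assumes Q: "\<And>a b. a < k \<Longrightarrow> b < k \<Longrightarrow> 0 \<le> Q a b" and kn: "k \<le> n"
  shows "step_error Q \<le> 7 * L2_norm (\<lambda>x y. Q (\<phi> x) (\<phi> y)) * sqrt (k / n)"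
proof -
  define s where "s = sqrt (k / n)"
  define w where "w = L2_norm (\<lambda>x y. Q (\<phi> x) (\<phi> y))"
  have w: "w = L2_set (\<lambda>(a, b). Q a b * sqrt (\<alpha> a * \<alpha> b)) ({..<k} \<times> {..<k})"
  proof -
    have "(Q a b)\<^sup>2 * \<alpha> a * \<alpha> b = (Q a b * sqrt (\<alpha> a * \<alpha> b))\<^sup>2" for a b
      using \<alpha>_nonneg[of a] \<alpha>_nonneg[of b] by (simp add: power_mult_distrib)
    then show ?thesis
      by (simp add: w_def L2_norm_step L2_set_def sum.cartesian_product case_prod_beta')
  qed
  have w0: "0 \<le> w" by (simp add: w)
  have s: "0 \<le> s" "s \<le> 1" using n kn by (auto simp: s_def)
  have CS: "(\<Sum>a<k. \<Sum>b<k. Q a b * sqrt (\<alpha> a * \<alpha> b) * g a b) \<le> w * sqrt (\<Sum>a<k. \<Sum>b<k. (g a b)\<^sup>2)"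
    if g: "\<And>a b. 0 \<le> g a b" for g :: "nat \<Rightarrow> nat \<Rightarrow> real"
  proof -
    have "(\<Sum>a<k. \<Sum>b<k. Q a b * sqrt (\<alpha> a * \<alpha> b) * g a b)
        = (\<Sum>z\<in>{..<k} \<times> {..<k}. \<bar>case z of (a, b) \<Rightarrow> Q a b * sqrt (\<alpha> a * \<alpha> b)\<bar> * \<bar>case z of (a, b) \<Rightarrow> g a b\<bar>)"
      unfolding sum.cartesian_product using Q g \<alpha>_nonneg by (intro sum.cong refl) (auto simp: abs_mult)
    also have "\<dots> \<le> w * L2_set (\<lambda>(a, b). g a b) ({..<k} \<times> {..<k})"
      unfolding w by (rule L2_set_mult_ineq)
    also have "L2_set (\<lambda>(a, b). g a b) ({..<k} \<times> {..<k}) = sqrt (\<Sum>a<k. \<Sum>b<k. (g a b)\<^sup>2)"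
      by (simp add: L2_set_def sum.cartesian_product case_prod_beta')
    finally show ?thesis .
  qed
  have ns: "1 / sqrt n * sqrt k = s" by (simp add: s_def real_sqrt_divide)
  have k0: "1 \<le> sqrt k" using k[of 0] by simp
  have kns: "k / n \<le> s"
  proof -
    have "k / n = s * s" by (simp add: s_def)
    also have "\<dots> \<le> s" using s by (simp add: mult_left_le)
    finally show ?thesis .
  qed
  have A: "(\<Sum>a<k. Q a a * \<alpha> a) / n \<le> w * s"
  proof -
    have "(\<Sum>a<k. Q a a * \<alpha> a) = (\<Sum>a<k. \<Sum>b<k. Q a b * sqrt (\<alpha> a * \<alpha> b) * of_bool (a = b))"
      using \<alpha>_nonneg by simp
    also have "\<dots> \<le> w * sqrt (\<Sum>a<k. \<Sum>b<k. (of_bool (a = b))\<^sup>2)" by (rule CS) simp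
    also have "(\<Sum>a<k. \<Sum>b<k. (of_bool (a = b))\<^sup>2) = real k"
      by (simp add: of_bool_def if_distrib[of "\<lambda>x. x\<^sup>2"] cong: if_cong)
    finally have "(\<Sum>a<k. Q a a * \<alpha> a) / n \<le> w * (sqrt k / n)" by (simp add: divide_right_mono)
    also have "sqrt k / n \<le> k / n" using k0 by (intro divide_right_mono) (simp_all add: sqrt_le_D real_le_lsqrt power2_eq_square)
    also note kns
    finally show ?thesis using w0 by (simp add: mult_left_mono)
  qed
  have B: "(\<Sum>a<k. \<Sum>b<k. Q a b * (sqrt (\<alpha> a / n) * (2 * \<alpha> b))) \<le> 2 * (w * s)"
  proof -
    have "(\<Sum>a<k. \<Sum>b<k. Q a b * (sqrt (\<alpha> a / n) * (2 * \<alpha> b)))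
       = 2 / sqrt n * (\<Sum>a<k. \<Sum>b<k. Q a b * sqrt (\<alpha> a * \<alpha> b) * sqrt (\<alpha> b))"
      unfolding sum_distrib_left using \<alpha>_nonneg
      by (intro sum.cong refl) (simp add: real_sqrt_divide real_sqrt_mult)
    also have "\<dots> \<le> 2 / sqrt n * (w * sqrt (\<Sum>a<k. \<Sum>b<k. (sqrt (\<alpha> b))\<^sup>2))"
      by (intro mult_left_mono CS) (simp_all add: \<alpha>_nonneg)
    also have "(\<Sum>a<k. \<Sum>b<k. (sqrt (\<alpha> b))\<^sup>2) = real k" by (simp add: \<alpha>_nonneg sum_\<alpha>)
    finally show ?thesis by (simp add: ns[symmetric] mult_ac)
  qed
  have C: "(\<Sum>a<k. \<Sum>b<k. Q a b * (sqrt (\<alpha> a * \<alpha> b) / n)) \<le> w * s"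
  proof -
    have "(\<Sum>a<k. \<Sum>b<k. Q a b * (sqrt (\<alpha> a * \<alpha> b) / n)) = (\<Sum>a<k. \<Sum>b<k. Q a b * sqrt (\<alpha> a * \<alpha> b) * 1) / n"
      by (simp add: sum_divide_distrib)
    also have "\<dots> \<le> w * sqrt (\<Sum>a<k. \<Sum>b<k. 1\<^sup>2) / n"
      by (intro divide_right_mono CS) simp_all
    also have "\<dots> = w * (k / n)" by (simp add: real_sqrt_mult)
    also have "\<dots> \<le> w * s" using kns w0 by (rule mult_left_mono)
    finally show ?thesis .
  qed
  have "step_error Q = (\<Sum>a<k. Q a a * \<alpha> a) / n + 2 * ((\<Sum>a<k. \<Sum>b<k. Q a b * (sqrt (\<alpha> a / n) * (2 * \<alpha> b)))
     + (\<Sum>a<k. \<Sum>b<k. Q a b * (sqrt (\<alpha> a * \<alpha> b) / n)))"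
    unfolding step_error_def ring_distribs(1)[of "Q _ _"] sum.distrib ..
  then show ?thesis using A B C unfolding w_def[symmetric] s_def[symmetric] mult.assoc by argo
qed

text \<open>The labelling of a step graphon need not be measurable. Identifying labels with equal
  rows repairs this, because the values of \<open>W\<close> at finitely many representatives decide
  the row of a point.\<close>

lemma measurable_labelling:
  assumes W: "W \<in> Lp_graphons p" and rep: "block_representation k Q0 \<phi>0 W"
  obtains \<phi> Q where "\<phi> \<in> measurable I01 (count_space UNIV)" "\<And>x. x \<in> {0..1} \<Longrightarrow> \<phi> x < k"
    "\<And>a b. 0 \<le> Q a b \<and> Q a b = (Q b a :: real)"
    "\<And>x y. x \<in> {0..1} \<Longrightarrow> y \<in> {0..1} \<Longrightarrow> W x y = Q (\<phi> x) (\<phi> y)"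
proof -
  have \<phi>0: "\<And>x. x \<in> {0..1} \<Longrightarrow> \<phi>0 x < k" and W0: "\<And>x y. x \<in> {0..1} \<Longrightarrow> y \<in> {0..1} \<Longrightarrow> W x y = Q0 $$ (\<phi>0 x, \<phi>0 y)"
    using rep by (auto simp: block_representation_def simp del: atLeastAtMost_iff)
  have Wsym: "W x y = W y x" and Wpos: "0 \<le> W x y" if "x \<in> {0..1}" "y \<in> {0..1}" for x y
    using W that unfolding Lp_graphons_def by blast+
  define U where "U = \<phi>0 ` {0..1}"
  have U: "finite U" "\<And>a. a \<in> U \<Longrightarrow> a < k"
    using \<phi>0 by (auto simp: U_def simp del: atLeastAtMost_iff intro: finite_subset[of _ "{..<k}"])
  have "\<exists>x. x \<in> {0..1} \<and> \<phi>0 x = a" if "a \<in> U" for a using that unfolding U_def by blast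
  then obtain r where r: "\<And>a. a \<in> U \<Longrightarrow> r a \<in> {0..1}" "\<And>a. a \<in> U \<Longrightarrow> \<phi>0 (r a) = a" by metis
  define T where "T a x \<longleftrightarrow> a \<in> U \<and> (\<forall>b\<in>U. W x (r b) = W (r a) (r b))" for a x
  \<comment> \<open>The least label with the row of \<open>x\<close>. It depends on \<open>x\<close>
    only through the finitely many measurable functions \<open>W x (r b)\<close>.\<close>
  define \<phi> where "\<phi> x = (LEAST a. T a x)" for x
  have T0: "T (\<phi>0 x) x" "\<phi>0 x \<in> U" if "x \<in> {0..1}" for x
    using that r W0 by (auto simp: T_def U_def simp del: atLeastAtMost_iff)
  have T: "T (\<phi> x) x" if "x \<in> {0..1}" for x unfolding \<phi>_def using T0(1)[OF that] by (rule LeastI)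
  have row: "W x y = W (r (\<phi> x)) y" if "x \<in> {0..1}" "y \<in> {0..1}" for x y
  proof -
    have rU: "r (\<phi> x) \<in> {0..1}" using T[OF that(1)] r by (simp add: T_def)
    have ry: "r (\<phi>0 y) \<in> {0..1}" "\<phi>0 (r (\<phi>0 y)) = \<phi>0 y" using T0[OF that(2)] r by auto
    \<comment> \<open>Replacing \<open>y\<close> by the representative of its original label changes
      no value of \<open>W\<close>, so agreement at the representatives is agreement
      everywhere.\<close>
    have "W x y = W x (r (\<phi>0 y))" using W0 that ry by simp
    also have "\<dots> = W (r (\<phi> x)) (r (\<phi>0 y))" using T[OF that(1)] T0[OF that(2)] by (simp add: T_def)
    also have "\<dots> = W (r (\<phi> x)) y" using W0 rU that ry by simp
    finally show ?thesis .
  qed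
  define Q where "Q a b = (if a \<in> U \<and> b \<in> U then W (r a) (r b) else 0)" for a b
  have meas: "\<phi> \<in> measurable I01 (count_space UNIV)"
  proof -
    have [measurable]: "(\<lambda>x. W x (r b)) \<in> borel_measurable I01" if "b \<in> U" for b
    proof -
      have "(\<lambda>x. (x, r b)) \<in> measurable I01 unit_square" using r(1)[OF that] by simp
      from measurable_compose[OF this, of "case_prod W" borel] show ?thesis using W by (simp add: Lp_graphons_def)
    qed
    have P: "Measurable.pred I01 (\<lambda>x. T a x)" for a
      unfolding T_def using U(1) by measurable
    show ?thesis unfolding \<phi>_def[abs_def] by (rule measurable_Least[OF P])
  qed
  show thesis
  proof (rule that[OF meas])
    show "\<phi> x < k" if "x \<in> {0..1}" for x using T[OF that] U(2) by (simp add: T_def)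
    show "0 \<le> Q a b \<and> Q a b = Q b a" for a b using Wpos Wsym r by (auto simp: Q_def simp del: atLeastAtMost_iff)
    fix x y :: real assume xy: "x \<in> {0..1}" "y \<in> {0..1}"
    have u: "\<phi> x \<in> U" "\<phi> y \<in> U" using T xy by (simp_all add: T_def)
    have "W x y = W (r (\<phi> x)) y" by (rule row[OF xy])
    also have "\<dots> = W y (r (\<phi> x))" using Wsym r u xy by blast
    also have "\<dots> = W (r (\<phi> y)) (r (\<phi> x))" using row[OF xy(2)] r u by blast
    also have "\<dots> = W (r (\<phi> x)) (r (\<phi> y))" using Wsym r u by blast
    finally show "W x y = Q (\<phi> x) (\<phi> y)" using u by (simp add: Q_def)
  qed
qed

text \<open>The given labelling has to be kept: merging labels with equal rows would empty some
  blocks and destroy the balance. Its measurability comes from the level sets in the definition of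
  the class.\<close>

lemma balanced_labelling:
  assumes "W \<in> balanced_step_graphons p k \<mu>"
  obtains \<phi> Q where "\<phi> \<in> measurable I01 (count_space UNIV)" "\<And>x. x \<in> {0..1} \<Longrightarrow> \<phi> x < k"
    "\<And>a b. a < k \<Longrightarrow> b < k \<Longrightarrow> 0 \<le> Q a b \<and> Q a b = (Q b a :: real)"
    "\<And>x y. x \<in> {0..1} \<Longrightarrow> y \<in> {0..1} \<Longrightarrow> W x y = Q (\<phi> x) (\<phi> y)"
    "\<And>a. a < k \<Longrightarrow> \<mu> / k \<le> measure I01 {x\<in>{0..1}. \<phi> x = a}"
proof -
  obtain Q0 \<phi> where rep: "block_representation k Q0 \<phi> W"
    and bal: "\<And>a. a < k \<Longrightarrow> \<phi> -` {a} \<inter> {0..1} \<in> sets I01 \<and> \<mu> / real k \<le> measure I01 (\<phi> -` {a} \<inter> {0..1})"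
    using assms unfolding balanced_step_graphons_def by blast
  have \<phi>: "\<And>x. x \<in> {0..1} \<Longrightarrow> \<phi> x < k" and W: "\<And>x y. x \<in> {0..1} \<Longrightarrow> y \<in> {0..1} \<Longrightarrow> W x y = Q0 $$ (\<phi> x, \<phi> y)"
    and Q0: "Q0 \<in> carrier_mat k k" "transpose_mat Q0 = Q0" "\<And>a b. a < k \<Longrightarrow> b < k \<Longrightarrow> 0 \<le> Q0 $$ (a, b)"
    using rep by (auto simp: block_representation_def simp del: atLeastAtMost_iff)
  have sym: "Q0 $$ (a, b) = Q0 $$ (b, a)" if "a < k" "b < k" for a b
    using Q0(1) that index_transpose_mat(1)[of b Q0 a] unfolding Q0(2) by auto
  have eq: "\<phi> -` {a} \<inter> {0..1} = {x\<in>{0..1}. \<phi> x = a}" for a by auto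
  have "\<phi> \<in> measurable I01 (count_space UNIV)"
    unfolding measurable_count_space_eq2_countable
  proof (intro conjI ballI)
    fix a :: nat
    show "\<phi> -` {a} \<inter> space I01 \<in> sets I01"
    proof (cases "a < k")
      case False
      then have "\<phi> -` {a} \<inter> space I01 = {}" using \<phi> by auto
      then show ?thesis by simp
    qed (use bal in simp)
  qed auto
  then show thesis using that[of \<phi> "\<lambda>a b. Q0 $$ (a, b)"] \<phi> W Q0(3) sym bal unfolding eq by blast
qed

section \<open>Integrability and comparison of norms\<close>

lemma abs_powr_2: "\<bar>x\<bar> powr 2 = (x::real)\<^sup>2"
  by (cases "x = 0") (simp_all add: powr_numeral)

lemma kernel_Lp1:
  assumes "W \<in> Lp_graphons 1"
  shows "integrable_kernel W"
proof -
  have m: "case_prod W \<in> borel_measurable unit_square"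
    and "integrable unit_square (\<lambda>(x, y). \<bar>W x y\<bar> powr 1)"
    using assms by (auto simp: Lp_graphons_def)
  then have "integrable unit_square (\<lambda>z. \<bar>case_prod W z\<bar>)"
    by (simp add: case_prod_beta')
  then show ?thesis using m by (simp only: integrable_abs_iff)
qed

lemma kernel_square:
  assumes "W \<in> Lp_graphons 2"
  shows "integrable_kernel (\<lambda>x y. (W x y)\<^sup>2)"
  using assms by (simp add: Lp_graphons_def abs_powr_2)

lemma kernel_Lp2:
  assumes "W \<in> Lp_graphons 2"
  shows "integrable_kernel W"
proof (rule Bochner_Integration.integrable_bound[where f = "\<lambda>z. 1 + (case_prod W z)\<^sup>2"])
  have "integrable unit_square (\<lambda>z. (case_prod W z)\<^sup>2)"
    using kernel_square[OF assms] by (simp add: case_prod_beta')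
  then show "integrable unit_square (\<lambda>z. 1 + (case_prod W z)\<^sup>2)" by simp
  show "case_prod W \<in> borel_measurable unit_square" using assms by (simp add: Lp_graphons_def)
  have "\<bar>w\<bar> \<le> 1 + w\<^sup>2" for w :: real
    using power2_diff[of "\<bar>w\<bar>" 1] zero_le_power2[of "\<bar>w\<bar> - 1"] zero_le_power2[of w] by simp
  then show "AE z in unit_square. norm (case_prod W z) \<le> norm (1 + (case_prod W z)\<^sup>2)"
    by (intro AE_I2) simp
qed

lemma L1_norm_le_L2_norm:
  assumes W: "case_prod W \<in> borel_measurable unit_square" and sq: "integrable_kernel (\<lambda>x y. (W x y)\<^sup>2)"
    and k: "integrable_kernel W"
  shows "L1_norm W \<le> L2_norm W"
proof -
  let ?a = "\<lambda>z. \<bar>case_prod W z\<bar>"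
  have i1: "integrable unit_square ?a" using k by (rule integrable_abs)
  have i2: "integrable unit_square (\<lambda>z. (?a z)\<^sup>2)" using sq by (simp add: case_prod_beta')
  have "(\<integral>\<^sup>+z. ennreal (?a z) * 1 \<partial>unit_square)\<^sup>2
      \<le> (\<integral>\<^sup>+z. (ennreal (?a z))\<^sup>2 \<partial>unit_square) * (\<integral>\<^sup>+z. 1\<^sup>2 \<partial>unit_square)"
    using W by (intro Cauchy_Schwarz_nn_integral) auto
  also have "(\<integral>\<^sup>+z. ennreal (?a z) * 1 \<partial>unit_square) = ennreal (L1_norm W)"
    using nn_integral_eq_integral[OF i1] by (simp add: L1_norm_def case_prod_beta')
  also have "(\<integral>\<^sup>+z. (ennreal (?a z))\<^sup>2 \<partial>unit_square) = ennreal (LINT z|unit_square. (?a z)\<^sup>2)"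
    using nn_integral_eq_integral[OF i2] by (simp add: ennreal_power)
  also have "(\<integral>\<^sup>+z. 1\<^sup>2 \<partial>unit_square) = 1" by (simp add: I2.P.emeasure_space_1)
  finally have "(L1_norm W)\<^sup>2 \<le> (LINT z|unit_square. (?a z)\<^sup>2)"
    by (simp add: ennreal_power L1_norm_nonneg)
  then have "L1_norm W \<le> sqrt (LINT z|unit_square. (?a z)\<^sup>2)" by (rule real_le_rsqrt)
  then show ?thesis by (simp add: L2_norm_def case_prod_beta')
qed

lemma L1_norm_mono:
  assumes "integrable_kernel V" "integrable_kernel W" "\<And>x y. x \<in> {0..1} \<Longrightarrow> y \<in> {0..1} \<Longrightarrow> \<bar>V x y\<bar> \<le> \<bar>W x y\<bar>"
  shows "L1_norm V \<le> L1_norm W"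
proof -
  have "L1_norm V = (LINT z|unit_square. \<bar>case_prod V z\<bar>)" by (simp add: L1_norm_def case_prod_beta')
  also have "\<dots> \<le> (LINT z|unit_square. \<bar>case_prod W z\<bar>)"
    using assms by (intro integral_mono integrable_abs) (auto simp: space_pair_measure)
  also have "\<dots> = L1_norm W" by (simp add: L1_norm_def case_prod_beta')
  finally show ?thesis .
qed

lemma L1_norm_cong:
  assumes "\<And>x y. x \<in> {0..1} \<Longrightarrow> y \<in> {0..1} \<Longrightarrow> V x y = W x y"
  shows "L1_norm V = L1_norm W"
  unfolding L1_norm_def by (rule Bochner_Integration.integral_cong) (auto simp: space_pair_measure assms)

lemma L2_norm_cong:
  assumes "\<And>x y. x \<in> {0..1} \<Longrightarrow> y \<in> {0..1} \<Longrightarrow> V x y = W x y"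
  shows "L2_norm V = L2_norm W"
  unfolding L2_norm_def by (rule arg_cong[of _ _ sqrt], rule Bochner_Integration.integral_cong) (auto simp: space_pair_measure assms)

lemma L1_norm_scale: "L1_norm (\<lambda>x y. c * W x y) = \<bar>c\<bar> * L1_norm W"
proof -
  have "L1_norm (\<lambda>x y. c * W x y) = (LINT z|unit_square. \<bar>c\<bar> * \<bar>case_prod W z\<bar>)"
    by (simp add: L1_norm_def case_prod_beta' abs_mult)
  also have "\<dots> = \<bar>c\<bar> * L1_norm W" unfolding integral_mult_right_zero by (simp add: L1_norm_def case_prod_beta')
  finally show ?thesis .
qed

lemma kernel_zero: "integrable_kernel (\<lambda>x y. 0)"
  by (simp add: case_prod_beta')

text \<open>This keeps the infimum from ranging over an empty set. The \<open>k\<close> equal cells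
  have measure 1 / k, which is where \<mu> \<le> 1 enters.\<close>

lemma zero_balanced_step_graphon:
  assumes "0 < \<mu>" "\<mu> \<le> 1" "0 < k"
  shows "(\<lambda>x y. 0) \<in> balanced_step_graphons 1 k \<mu>"
proof -
  have "block_representation k (0\<^sub>m k k) (cell k) (\<lambda>x y. 0)"
    using cell_less[OF assms(3)] by (auto simp: block_representation_def)
  moreover have "cell k -` {a} \<inter> {0..1} \<in> sets I01" "\<mu> / k \<le> measure I01 (cell k -` {a} \<inter> {0..1})" if "a < k" for a
  proof -
    show "cell k -` {a} \<inter> {0..1} \<in> sets I01"
      using measurable_sets[OF cell_measurable, of "{a}" k] by simp
    have "cell k -` {a} \<inter> {0..1} = {x\<in>{0..1}. cell k x = a}" by auto
    then show "\<mu> / k \<le> measure I01 (cell k -` {a} \<inter> {0..1})"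
      using measure_cell[OF that] assms by (simp add: divide_right_mono)
  qed
  moreover have "(\<lambda>x y. 0) \<in> Lp_graphons 1" by (simp add: Lp_graphons_def case_prod_beta')
  ultimately show ?thesis unfolding balanced_step_graphons_def by blast
qed

lemma zero_step_graphon:
  assumes "0 < k"
  shows "(\<lambda>x y. 0) \<in> step_graphons 2 k"
proof -
  have "block_representation k (0\<^sub>m k k) (\<lambda>_. 0) (\<lambda>x y. 0)"
    using assms by (auto simp: block_representation_def)
  moreover have "(\<lambda>x y. 0) \<in> Lp_graphons 2" by (simp add: Lp_graphons_def case_prod_beta')
  ultimately show ?thesis unfolding step_graphons_def by blast
qed

subsection \<open>Oracle inequalities\<close>

text \<open>Both estimators in one: \<open>F\<close> is the identity with
  \<open>\<kappa> = 0\<close>, or hard thresholding with its cut norm error as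
  \<open>\<kappa>\<close>.\<close>

locale sparse_graphon =
  fixes W0 :: "real \<Rightarrow> real \<Rightarrow> real" and p \<rho> :: real and n :: nat and F :: "real mat \<Rightarrow> real mat" and \<kappa> :: real
  assumes W0: "W0 \<in> Lp_graphons p" and kW0: "integrable_kernel W0" and L1: "L1_norm W0 \<le> 1"
    and n: "0 < n" and \<rho>: "0 < \<rho>" "1 / n \<le> \<rho>"
    and F: "\<And>A. A \<in> carrier_mat n n \<Longrightarrow>
      cut_norm (\<lambda>x y. empirical_graphon n (F A) x y - empirical_graphon n A x y) \<le> \<kappa>" and \<kappa>: "0 \<le> \<kappa>"
begin

abbreviation risk :: real where
  "risk \<equiv> (LINT A|graph_law n \<rho> W0. cut_dist (empirical_graphon n (F A)) (\<lambda>x y. min (\<rho> * W0 x y) 1))"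

definition W0' :: "real \<Rightarrow> real \<Rightarrow> real" where
  "W0' x y = inverse \<rho> * min (\<rho> * W0 x y) 1"

lemma W0'_eq: "W0' = (\<lambda>x y. inverse \<rho> * min (\<rho> * W0 x y) 1)"
  by (intro ext) (rule W0'_def)

lemma truncated_W0: "truncated \<rho> W0 x y = \<rho> * W0' x y"
  using \<rho> by (simp add: truncated_def W0'_def)

lemma W0_nonneg: "x \<in> {0..1} \<Longrightarrow> y \<in> {0..1} \<Longrightarrow> 0 \<le> W0 x y"
  using W0 by (auto simp: Lp_graphons_def)

lemma W0'_bounds: "x \<in> {0..1} \<Longrightarrow> y \<in> {0..1} \<Longrightarrow> 0 \<le> W0' x y \<and> W0' x y \<le> W0 x y"
  using W0_nonneg[of x y] \<rho>(1) by (auto simp: W0'_def field_simps min_def)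

lemma kernel_W0': "integrable_kernel W0'"
proof -
  have "integrable_kernel (truncated \<rho> W0)" by (rule kernel_truncated[OF W0 \<rho>(1)])
  then have "integrable unit_square (\<lambda>z. inverse \<rho> * case_prod (truncated \<rho> W0) z)" by simp
  then show ?thesis using \<rho>(1) by (simp add: case_prod_beta' truncated_def W0'_def[abs_def])
qed

lemma L1_W0': "L1_norm W0' \<le> 1"
proof -
  have "L1_norm W0' \<le> L1_norm W0"
    by (rule L1_norm_mono[OF kernel_W0' kW0]) (use W0'_bounds W0_nonneg in fastforce)
  then show ?thesis using L1 by simp
qed

lemma L1_norm_mp_bijection:
  assumes "\<tau> \<in> mp_bijections" "integrable_kernel V"
  shows "L1_norm (\<lambda>x y. V (\<tau> x) (\<tau> y)) = L1_norm V"
proof -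
  have "case_prod (\<lambda>x y. \<bar>V x y\<bar>) \<in> borel_measurable unit_square"
    using borel_measurable_abs[OF borel_measurable_integrable[OF assms(2)]] by (simp add: case_prod_beta')
  then show ?thesis unfolding L1_norm_def by (rule integral_mp_bijection[OF assms(1)])
qed

text \<open>The bijection \<open>\<tau>\<close> of the infimum is absorbed into the model: the
  rearranged graphon generates the same graph law, and its cut distance to the estimate is no
  smaller. So \<open>expected_cut_dist_le\<close> is applied to the rearranged \<open>W0\<close>,
  with a step function on fixed coordinates.\<close>

lemma risk_le:
  assumes "labelled_sample \<phi> k n" and Q: "\<And>a b. a < k \<Longrightarrow> b < k \<Longrightarrow> 0 \<le> Q a b \<and> Q a b = Q b a"
    and \<tau>: "\<tau> \<in> mp_bijections" and W: "\<And>x y. x \<in> {0..1} \<Longrightarrow> y \<in> {0..1} \<Longrightarrow> W x y = Q (\<phi> x) (\<phi> y)"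
  shows "risk \<le> \<kappa> + 8 * sqrt (\<rho> / n) + 2 * \<rho> * L1_norm (\<lambda>x y. W x y - W0' (\<tau> x) (\<tau> y))
    + \<rho> * labelled_sample.step_error \<phi> k n Q"
proof -
  interpret labelled_sample \<phi> k n by fact
  let ?V = "\<lambda>x y. W0 (\<tau> x) (\<tau> y)"
  have V: "?V \<in> Lp_graphons p" by (rule Lp_graphons_mp_bijection[OF W0 \<tau>])
  have kV: "integrable_kernel ?V" by (rule kernel_mp_bijection[OF \<tau> kW0])
  have L1V: "L1_norm ?V \<le> 1" using L1 by (simp add: L1_norm_mp_bijection[OF \<tau> kW0])
  let ?H = "\<lambda>x y. \<rho> * Q (\<phi> x) (\<phi> y) - truncated \<rho> ?V x y"
  have H: "L1_norm ?H = \<rho> * L1_norm (\<lambda>x y. W x y - W0' (\<tau> x) (\<tau> y))"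
  proof -
    have "L1_norm ?H = L1_norm (\<lambda>x y. \<rho> * (W x y - W0' (\<tau> x) (\<tau> y)))"
      by (rule L1_norm_cong) (use W truncated_W0 in \<open>simp add: truncated_def algebra_simps\<close>)
    then show ?thesis using \<rho>(1) by (simp add: L1_norm_scale)
  qed
  let ?R = "\<kappa> + 8 * sqrt (\<rho> / n) + 2 * L1_norm ?H + \<rho> * step_error Q"
  have kt: "integrable_kernel (truncated \<rho> W0)" by (rule kernel_truncated[OF W0 \<rho>(1)])
  have R0: "0 \<le> ?R"
  proof -
    have "0 \<le> step_error Q" unfolding step_error_def using Q \<alpha>_nonneg
      by (intro add_nonneg_nonneg mult_nonneg_nonneg divide_nonneg_nonneg sum_nonneg) auto
    then show ?thesis using \<kappa> \<rho>(1) L1_norm_nonneg[of ?H] by simp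
  qed
  have "(\<integral>\<^sup>+A. ennreal (cut_dist (empirical_graphon n (F A)) (truncated \<rho> W0)) \<partial>graph_law n \<rho> W0)
      \<le> (\<integral>\<^sup>+A. ennreal (cut_dist (empirical_graphon n (F A)) (truncated \<rho> ?V)) \<partial>graph_law n \<rho> W0)"
  proof (intro nn_integral_mono ennreal_leI)
    fix A
    show "cut_dist (empirical_graphon n (F A)) (truncated \<rho> W0) \<le> cut_dist (empirical_graphon n (F A)) (truncated \<rho> ?V)"
      using cut_dist_mp_bijection[OF \<tau> kernel_empirical_graphon[OF n] kt, of "F A"]
      by (simp add: truncated_def[abs_def])
  qed
  also have "\<dots> = (\<integral>\<^sup>+A. ennreal (cut_dist (empirical_graphon n (F A)) (truncated \<rho> ?V)) \<partial>graph_law n \<rho> ?V)"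
    by (simp only: graph_law_mp_bijection[OF W0 \<rho>(1) \<tau>])
  also have "\<dots> \<le> ennreal ?R"
    by (rule expected_cut_dist_le[OF V kV L1V \<rho> Q F \<kappa>])
  \<comment> \<open>The upper bound for the nonnegative integral transfers to the Bochner integral
    because \<open>?R\<close> is nonnegative.\<close>
  finally have "(LINT A|graph_law n \<rho> W0. cut_dist (empirical_graphon n (F A)) (truncated \<rho> W0)) \<le> ?R"
    by (rule integral_real_bounded[OF R0])
  from this[unfolded H] show ?thesis by (simp add: truncated_def[abs_def] mult.assoc)
qed

text \<open>The step error is proportional to the norm of the step function. When the latter is farther
  from \<open>W0'\<close> than the zero graphon, comparing with zero, whose step error vanishes, is better.\<close>

lemma risk_le_zero: "risk \<le> \<kappa> + 8 * sqrt (\<rho> / n) + 2 * \<rho> * L1_norm W0'"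
proof -
  \<comment> \<open>The zero graphon as a step function with a single block.\<close>
  have l: "labelled_sample (\<lambda>_. 0) 1 n" by unfold_locales (use n in auto)
  have e: "labelled_sample.step_error (\<lambda>_. 0) 1 n (\<lambda>_ _. 0) = 0"
    unfolding labelled_sample.step_error_def[OF l] by simp
  have "risk \<le> \<kappa> + 8 * sqrt (\<rho> / n) + 2 * \<rho> * L1_norm (\<lambda>x y. 0 - W0' x y) + \<rho> * labelled_sample.step_error (\<lambda>_. 0) 1 n (\<lambda>_ _. 0)"
    by (rule risk_le[OF l _ id_mp_bijection]) auto
  also have "L1_norm (\<lambda>x y. 0 - W0' x y) = L1_norm W0'" by (simp add: L1_norm_def)
  finally show ?thesis unfolding e by simp
qed

lemma risk_balanced:
  fixes \<mu> :: real
  assumes W: "W \<in> balanced_step_graphons 1 k \<mu>" and \<mu>: "0 < \<mu>" and kn: "real k \<le> \<mu> * n" and \<tau>: "\<tau> \<in> mp_bijections"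
  shows "risk \<le> 2 * \<rho> * L1_norm (\<lambda>x y. W x y - W0' (\<tau> x) (\<tau> y))
     + (\<kappa> + 8 * sqrt (\<rho> / n) + 14 * \<rho> * sqrt (real k / (\<mu> * real n)))"
proof (cases "L1_norm (\<lambda>x y. W x y - W0' (\<tau> x) (\<tau> y)) \<le> 1")
  case True
  obtain \<phi> Q where \<phi>: "\<phi> \<in> measurable I01 (count_space UNIV)" "\<And>x. x \<in> {0..1} \<Longrightarrow> \<phi> x < k"
    and Q: "\<And>a b. a < k \<Longrightarrow> b < k \<Longrightarrow> 0 \<le> Q a b \<and> Q a b = (Q b a :: real)"
    and WQ: "\<And>x y. x \<in> {0..1} \<Longrightarrow> y \<in> {0..1} \<Longrightarrow> W x y = Q (\<phi> x) (\<phi> y)"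
    and bal: "\<And>a. a < k \<Longrightarrow> \<mu> / k \<le> measure I01 {x\<in>{0..1}. \<phi> x = a}"
    by (rule balanced_labelling[OF W]) blast
  interpret labelled_sample \<phi> k n by unfold_locales (use \<phi> n in auto)
  have kW: "integrable_kernel W" using W by (simp add: balanced_step_graphons_def kernel_Lp1)
  \<comment> \<open>Distance at most 1 plus a truncated graphon of norm at most 1; this doubles the
    constant 7.\<close>
  have "L1_norm W \<le> 2"
  proof -
    have "L1_norm (\<lambda>x y. W x y - 0) \<le> L1_norm (\<lambda>x y. W x y - W0' (\<tau> x) (\<tau> y)) + L1_norm (\<lambda>x y. W0' (\<tau> x) (\<tau> y) - 0)"
      by (rule L1_norm_triangle[OF kW kernel_mp_bijection[OF \<tau> kernel_W0'] kernel_zero])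
    then show ?thesis using True L1_W0' L1_norm_mp_bijection[OF \<tau> kernel_W0'] by simp
  qed
  then have "L1_norm (\<lambda>x y. Q (\<phi> x) (\<phi> y)) \<le> 2"
    using L1_norm_cong[of W "\<lambda>x y. Q (\<phi> x) (\<phi> y)"] WQ by simp
  then have "7 * L1_norm (\<lambda>x y. Q (\<phi> x) (\<phi> y)) * sqrt (real k / (\<mu> * real n)) \<le> 14 * sqrt (real k / (\<mu> * real n))"
    using \<mu> by (intro mult_right_mono) auto
  moreover have "step_error Q \<le> 7 * L1_norm (\<lambda>x y. Q (\<phi> x) (\<phi> y)) * sqrt (real k / (\<mu> * real n))"
    by (rule step_error_balanced) (use Q bal \<mu> kn in \<open>auto simp: \<alpha>_def simp del: atLeastAtMost_iff\<close>)
  ultimately have "\<rho> * step_error Q \<le> \<rho> * (14 * sqrt (real k / (\<mu> * real n)))"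
    using \<rho>(1) by (intro mult_left_mono) auto
  then show ?thesis using risk_le[of \<phi> k Q \<tau> W, OF labelled_sample_axioms Q \<tau> WQ] by simp
next
  case False
  \<comment> \<open>Here \<open>W\<close> is farther from \<open>W0'\<close> than 1, and zero is at
    distance at most 1.\<close>
  then have "\<rho> * L1_norm W0' \<le> \<rho> * L1_norm (\<lambda>x y. W x y - W0' (\<tau> x) (\<tau> y))"
    using L1_W0' \<rho>(1) by (intro mult_left_mono) auto
  moreover have "0 \<le> 14 * \<rho> * sqrt (real k / (\<mu> * real n))" using \<rho>(1) \<mu> by simp
  ultimately show ?thesis using risk_le_zero by linarith
qed

lemma risk_square:
  assumes W: "W \<in> step_graphons 2 k" and W2: "W0 \<in> Lp_graphons 2" and kn: "k \<le> n" and \<tau>: "\<tau> \<in> mp_bijections"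
  shows "risk \<le> 2 * \<rho> * L2_norm (\<lambda>x y. W x y - W0' (\<tau> x) (\<tau> y))
     + (\<kappa> + 8 * sqrt (\<rho> / n) + 14 * \<rho> * L2_norm W0 * sqrt (k / n))"
proof -
  let ?U = "\<lambda>x y. W0' (\<tau> x) (\<tau> y)"
  let ?D = "\<lambda>x y. W x y - ?U x y"
  have WL: "W \<in> Lp_graphons 2" using W by (simp add: step_graphons_def)
  have kW: "integrable_kernel W" by (rule kernel_Lp2[OF WL])
  have kU: "integrable_kernel ?U" by (rule kernel_mp_bijection[OF \<tau> kernel_W0'])
  have sW: "integrable_kernel (\<lambda>x y. (W x y)\<^sup>2)" by (rule kernel_square[OF WL])
  have sW0: "integrable_kernel (\<lambda>x y. (W0 x y)\<^sup>2)" by (rule kernel_square[OF W2])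
  have sW0': "integrable_kernel (\<lambda>x y. (W0' x y)\<^sup>2)"
  proof (rule Bochner_Integration.integrable_bound[OF sW0])
    have "(\<lambda>z. (case_prod W0' z)\<^sup>2) \<in> borel_measurable unit_square"
      using borel_measurable_integrable[OF kernel_W0'] by measurable
    then show "case_prod (\<lambda>x y. (W0' x y)\<^sup>2) \<in> borel_measurable unit_square" by (simp add: case_prod_beta')
    show "AE z in unit_square. norm (case_prod (\<lambda>x y. (W0' x y)\<^sup>2) z) \<le> norm (case_prod (\<lambda>x y. (W0 x y)\<^sup>2) z)"
      by (rule AE_I2) (use W0'_bounds in \<open>auto simp: space_pair_measure power_mono\<close>)
  qed
  have sU: "integrable_kernel (\<lambda>x y. (?U x y)\<^sup>2)" by (rule kernel_mp_bijection[OF \<tau> sW0'])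
  have sD: "integrable_kernel (\<lambda>x y. (?D x y)\<^sup>2)"
  proof (rule Bochner_Integration.integrable_bound)
    show "integrable unit_square (\<lambda>z. 2 * case_prod (\<lambda>x y. (W x y)\<^sup>2) z + 2 * case_prod (\<lambda>x y. (?U x y)\<^sup>2) z)"
      by (intro Bochner_Integration.integrable_add integrable_mult_right sW sU)
    have "(\<lambda>z. (case_prod ?D z)\<^sup>2) \<in> borel_measurable unit_square"
      using borel_measurable_integrable[OF kernel_diff[OF kW kU]] by measurable
    then show "case_prod (\<lambda>x y. (?D x y)\<^sup>2) \<in> borel_measurable unit_square" by (simp add: case_prod_beta')
    have ab: "(a - b)\<^sup>2 \<le> 2 * a\<^sup>2 + 2 * b\<^sup>2" for a b :: real
      using zero_le_power2[of "a + b"] by (simp add: power2_eq_square algebra_simps)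
    show "AE z in unit_square. norm (case_prod (\<lambda>x y. (?D x y)\<^sup>2) z)
        \<le> norm (2 * case_prod (\<lambda>x y. (W x y)\<^sup>2) z + 2 * case_prod (\<lambda>x y. (?U x y)\<^sup>2) z)"
    proof (rule AE_I2)
      fix z :: "real \<times> real"
      show "norm (case_prod (\<lambda>x y. (?D x y)\<^sup>2) z)
        \<le> norm (2 * case_prod (\<lambda>x y. (W x y)\<^sup>2) z + 2 * case_prod (\<lambda>x y. (?U x y)\<^sup>2) z)"
        using ab[of "W (fst z) (snd z)" "?U (fst z) (snd z)"] by (simp add: case_prod_beta')
    qed
  qed
  have L2U: "L2_norm ?U \<le> L2_norm W0"
  proof -
    have "L2_norm ?U = L2_norm W0'"
      unfolding L2_norm_def using integral_mp_bijection[OF \<tau> borel_measurable_integrable[OF sW0']] by simp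
    also have "\<dots> \<le> L2_norm W0"
      unfolding L2_norm_def
      by (rule real_sqrt_le_mono, rule integral_mono[OF sW0' sW0]) (use W0'_bounds in \<open>auto simp: space_pair_measure power_mono\<close>)
    finally show ?thesis .
  qed
  have L12: "L1_norm ?D \<le> L2_norm ?D"
    by (rule L1_norm_le_L2_norm[OF borel_measurable_integrable[OF kernel_diff[OF kW kU]] sD kernel_diff[OF kW kU]])
  show ?thesis
  \<comment> \<open>Only the L1 norm is normalised, so the reference value in the square case is the
    L2 norm of \<open>W0\<close> instead of 1.\<close>
  proof (cases "L2_norm ?D \<le> L2_norm W0")
    case True
    obtain Q0 \<phi>0 where "block_representation k Q0 \<phi>0 W" using W by (auto simp: step_graphons_def)
    then obtain \<phi> Q where \<phi>: "\<phi> \<in> measurable I01 (count_space UNIV)" "\<And>x. x \<in> {0..1} \<Longrightarrow> \<phi> x < k"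
      and Q: "\<And>a b. 0 \<le> Q a b \<and> Q a b = (Q b a :: real)"
      and WQ: "\<And>x y. x \<in> {0..1} \<Longrightarrow> y \<in> {0..1} \<Longrightarrow> W x y = Q (\<phi> x) (\<phi> y)"
      by (rule measurable_labelling[OF WL]) blast
    interpret labelled_sample \<phi> k n by unfold_locales (use \<phi> n in auto)
    have "L2_norm W \<le> 2 * L2_norm W0"
    proof -
      let ?I = "\<lambda>f. LINT z|unit_square. case_prod (\<lambda>x y. (f x y)\<^sup>2) z"
      have sq: "(L2_norm f)\<^sup>2 = ?I f" "0 \<le> L2_norm f" for f
        by (simp_all add: L2_norm_def case_prod_beta')
      have "?I W \<le> (LINT z|unit_square. 2 * case_prod (\<lambda>x y. (?D x y)\<^sup>2) z + 2 * case_prod (\<lambda>x y. (?U x y)\<^sup>2) z)"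
      proof (rule integral_mono[OF sW])
        show "integrable unit_square (\<lambda>z. 2 * case_prod (\<lambda>x y. (?D x y)\<^sup>2) z + 2 * case_prod (\<lambda>x y. (?U x y)\<^sup>2) z)"
          by (intro Bochner_Integration.integrable_add integrable_mult_right sD sU)
        \<comment> \<open>With both norms on the right at most that of \<open>W0\<close>, this
          pointwise inequality gives the same factor 2 as the triangle inequality in L2.\<close>
        have ab: "a\<^sup>2 \<le> 2 * (a - b)\<^sup>2 + 2 * b\<^sup>2" for a b :: real
          using zero_le_power2[of "a - 2 * b"] by (simp add: power2_eq_square algebra_simps)
        show "case_prod (\<lambda>x y. (W x y)\<^sup>2) z \<le> 2 * case_prod (\<lambda>x y. (?D x y)\<^sup>2) z + 2 * case_prod (\<lambda>x y. (?U x y)\<^sup>2) z" for z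
          using ab[of "W (fst z) (snd z)" "?U (fst z) (snd z)"] by (simp add: case_prod_beta')
      qed
      also have "\<dots> = 2 * ?I ?D + 2 * ?I ?U"
        using sD sU by simp
      also have "\<dots> \<le> 2 * (L2_norm W0)\<^sup>2 + 2 * (L2_norm W0)\<^sup>2"
        unfolding sq(1)[symmetric] using True L2U sq(2) by (intro add_mono mult_left_mono power_mono) auto
      finally have "(L2_norm W)\<^sup>2 \<le> (2 * L2_norm W0)\<^sup>2" by (simp add: sq(1) power_mult_distrib)
      then show ?thesis by (rule power2_le_imp_le) (simp add: sq(2))
    qed
    then have "7 * L2_norm W * sqrt (k / n) \<le> 14 * L2_norm W0 * sqrt (k / n)"
      by (intro mult_right_mono) auto
    moreover have "step_error Q \<le> 7 * L2_norm W * sqrt (k / n)"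
    proof -
      have "L2_norm W = L2_norm (\<lambda>x y. Q (\<phi> x) (\<phi> y))" by (rule L2_norm_cong) (rule WQ)
      moreover have "step_error Q \<le> 7 * L2_norm (\<lambda>x y. Q (\<phi> x) (\<phi> y)) * sqrt (k / n)"
        by (rule step_error_square[OF _ kn]) (use Q in blast)
      ultimately show ?thesis by simp
    qed
    ultimately have "\<rho> * step_error Q \<le> \<rho> * (14 * L2_norm W0 * sqrt (k / n))"
      using \<rho>(1) by (intro mult_left_mono) auto
    moreover have "2 * \<rho> * L1_norm ?D \<le> 2 * \<rho> * L2_norm ?D" using L12 \<rho>(1) by (intro mult_left_mono) auto
    ultimately show ?thesis using risk_le[of \<phi> k Q \<tau> W, OF labelled_sample_axioms Q \<tau> WQ] by simp
  next
    case False
    have "L1_norm W0' \<le> L1_norm W0"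
      by (rule L1_norm_mono[OF kernel_W0' kW0]) (use W0'_bounds W0_nonneg in fastforce)
    also have "\<dots> \<le> L2_norm W0"
      by (rule L1_norm_le_L2_norm[OF borel_measurable_integrable[OF kW0] sW0 kW0])
    finally have "\<rho> * L1_norm W0' \<le> \<rho> * L2_norm ?D"
      using False \<rho>(1) by (intro mult_left_mono) auto
    moreover have "0 \<le> 14 * \<rho> * L2_norm W0 * sqrt (k / n)"
      using \<rho>(1) by (simp add: L2_norm_def case_prod_beta')
    ultimately show ?thesis using risk_le_zero by linarith
  qed
qed

lemma risk_balanced_INF:
  fixes \<mu> :: real
  assumes \<mu>: "0 < \<mu>" "\<mu> \<le> 1" and k: "0 < k" "real k \<le> \<mu> * n"
  shows "risk \<le> 2 * \<rho> * (INF W\<in>balanced_step_graphons 1 k \<mu>. L1_dist W W0')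
     + (\<kappa> + 8 * sqrt (\<rho> / n) + 14 * \<rho> * sqrt (real k / (\<mu> * real n)))" (is "_ \<le> 2 * \<rho> * ?I + ?R")
proof -
  \<comment> \<open>Solved for the distance, the bound becomes a lower bound for every competitor
    and every bijection, hence for both nested infima.\<close>
  have "(risk - ?R) / (2 * \<rho>) \<le> ?I"
  proof (rule cINF_greatest)
    show "balanced_step_graphons 1 k \<mu> \<noteq> {}" using zero_balanced_step_graphon[OF \<mu> k(1)] by blast
    fix W assume W: "W \<in> balanced_step_graphons 1 k \<mu>"
    show "(risk - ?R) / (2 * \<rho>) \<le> L1_dist W W0'"
    proof (rule graphon_dist_greatest)
      fix \<tau> assume "\<tau> \<in> mp_bijections"
      from risk_balanced[OF W \<mu>(1) k(2) this] \<rho>(1)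
      show "(risk - ?R) / (2 * \<rho>) \<le> L1_norm (\<lambda>x y. W x y - W0' (\<tau> x) (\<tau> y))"
        by (simp add: divide_le_eq mult_ac)
    qed
  qed
  then show ?thesis using \<rho>(1) by (simp add: divide_le_eq mult_ac)
qed

lemma risk_square_INF:
  assumes W2: "W0 \<in> Lp_graphons 2" and k: "0 < k" "k \<le> n"
  shows "risk \<le> 2 * \<rho> * (INF W\<in>step_graphons 2 k. L2_dist W W0')
     + (\<kappa> + 8 * sqrt (\<rho> / n) + 14 * \<rho> * L2_norm W0 * sqrt (k / n))" (is "_ \<le> 2 * \<rho> * ?I + ?R")
proof -
  \<comment> \<open>The same passage to both infima, now in L2.\<close>
  have "(risk - ?R) / (2 * \<rho>) \<le> ?I"
  proof (rule cINF_greatest)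
    show "step_graphons 2 k \<noteq> {}" using zero_step_graphon[OF k(1)] by blast
    fix W assume W: "W \<in> step_graphons 2 k"
    show "(risk - ?R) / (2 * \<rho>) \<le> L2_dist W W0'"
    proof (rule graphon_dist_greatest)
      fix \<tau> assume "\<tau> \<in> mp_bijections"
      from risk_square[OF W W2 k(2) this] \<rho>(1)
      show "(risk - ?R) / (2 * \<rho>) \<le> L2_norm (\<lambda>x y. W x y - W0' (\<tau> x) (\<tau> y))"
        by (simp add: divide_le_eq mult_ac)
    qed
  qed
  then show ?thesis using \<rho>(1) by (simp add: divide_le_eq mult_ac)
qed

end

text \<open>Weights between 0 and 1 / n form vectors of Euclidean norm at most 1 / sqrt n, so the
  operator norm bound \<open>t\<close> for the residual loses a factor \<open>n\<close>.\<close>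

lemma cut_norm_hard_threshold:
  assumes "A \<in> carrier_mat n n" "0 < n" "0 < t"
  shows "cut_norm (\<lambda>x y. empirical_graphon n (hard_threshold n t A) x y - empirical_graphon n A x y) \<le> t / n"
proof (rule cut_norm_empirical_le[OF assms(2)])
  fix x y :: "nat \<Rightarrow> real"
  assume x: "\<And>i. i < n \<Longrightarrow> 0 \<le> x i \<and> x i \<le> 1 / n" and y: "\<And>i. i < n \<Longrightarrow> 0 \<le> y i \<and> y i \<le> 1 / n"
  have d: "dot n z z \<le> 1 / n" if z: "\<And>i. i < n \<Longrightarrow> 0 \<le> z i \<and> z i \<le> 1 / n" for z
  proof -
    have "dot n z z \<le> (\<Sum>i<n. (1 / n) * (1 / n))"
      by (intro sum_mono mult_mono) (use z in auto)
    then show ?thesis using assms(2) by simp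
  qed
  have "\<bar>\<Sum>i<n. \<Sum>j<n. (hard_threshold n t A $$ (i, j) - A $$ (i, j)) * x i * y j\<bar>
      \<le> t * sqrt (dot n x x) * sqrt (dot n y y)"
    by (rule hard_threshold_residual[OF assms(1,3)])
  also have "\<dots> \<le> t * sqrt (1 / n) * sqrt (1 / n)"
    using d[OF x] d[OF y] assms(3) by (intro mult_mono mult_left_mono real_sqrt_le_mono) (auto simp: sum_nonneg)
  also have "\<dots> = t / n" by (simp add: real_sqrt_divide)
  finally show "\<bar>\<Sum>i<n. \<Sum>j<n. (hard_threshold n t A $$ (i, j) - A $$ (i, j)) * x i * y j\<bar> \<le> t / n" .
qed

theorem proposition8:
  shows "\<exists>c0>0. \<forall>c\<ge>c0::real. \<exists>C>0::real. \<forall>n\<ge>1::nat. \<forall>\<rho>::real.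
    0 < \<rho> \<and> \<rho> \<le> 1 \<and> 1 / real n \<le> \<rho> \<longrightarrow>
    (\<forall>W0 :: real \<Rightarrow> real \<Rightarrow> real.
      let lam = c * sqrt (\<rho> * real n);
          f0' = (\<lambda>x y. min (\<rho> * W0 x y) 1);
          W0' = (\<lambda>x y. inverse \<rho> * min (\<rho> * W0 x y) 1);
          risk_A = (LINT A|graph_law n \<rho> W0. cut_dist (empirical_graphon n A) f0');
          risk_T = (LINT A|graph_law n \<rho> W0.
                      cut_dist (empirical_graphon n (hard_threshold n lam A)) f0')
      in
        (W0 \<in> Lp_graphons 1 \<and> L1_norm W0 = 1 \<longrightarrow>
          (\<forall>\<mu>::real. \<forall>k::nat. 0 < \<mu> \<and> \<mu> \<le> 1 \<and> 0 < k \<and> real k \<le> \<mu> * real n \<longrightarrow>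
            risk_A \<le> 2 * \<rho> * (INF W\<in>balanced_step_graphons 1 k \<mu>. L1_dist W W0')
              + C * (\<rho> * sqrt (real k / (\<mu> * real n)) + sqrt (\<rho> / real n)) \<and>
            risk_T \<le> 2 * \<rho> * (INF W\<in>balanced_step_graphons 1 k \<mu>. L1_dist W W0')
              + C * (\<rho> * sqrt (real k / (\<mu> * real n)) + sqrt (\<rho> / real n)))) \<and>
        (W0 \<in> Lp_graphons 2 \<and> L1_norm W0 = 1 \<longrightarrow>
          (\<forall>k::nat. 0 < k \<and> k \<le> n \<longrightarrow>
            risk_A \<le> 2 * \<rho> * (INF W\<in>step_graphons 2 k. L2_dist W W0')
              + C * (\<rho> * L2_norm W0 * sqrt (real k / real n) + sqrt (\<rho> / real n)) \<and>
            risk_T \<le> 2 * \<rho> * (INF W\<in>step_graphons 2 k. L2_dist W W0')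
              + C * (\<rho> * L2_norm W0 * sqrt (real k / real n) + sqrt (\<rho> / real n)))))"
  (is "\<exists>c0>0. \<forall>c\<ge>c0. \<exists>C>0. \<forall>n\<ge>1. \<forall>\<rho>. _ n \<rho> \<longrightarrow> (\<forall>W0. ?claim c C n \<rho> W0)")
\<comment> \<open>The lower bound 1 makes the threshold positive, as
  \<open>cut_norm_hard_threshold\<close> requires.\<close>
proof (rule exI[of _ "1::real"], intro conjI allI impI)
  show "(0::real) < 1" by simp
next
  fix c :: real
  assume c: "1 \<le> c"
  show "\<exists>C>0. \<forall>n\<ge>1. \<forall>\<rho>. 0 < \<rho> \<and> \<rho> \<le> 1 \<and> 1 / real n \<le> \<rho> \<longrightarrow>
    (\<forall>W0. ?claim c C n \<rho> W0)"
  \<comment> \<open>In this constant \<open>c\<close> absorbs the thresholding error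
    \<open>\<kappa>\<close>, and 14 is the coefficient of the step error, which also dominates the 8
    of the random deviation.\<close>
  proof (rule exI[of _ "c + 14"], intro conjI allI impI)
    show "0 < c + 14" using c by simp
    fix n :: nat and \<rho> :: real and W0 :: "real \<Rightarrow> real \<Rightarrow> real"
    assume n1: "1 \<le> n" and "0 < \<rho> \<and> \<rho> \<le> 1 \<and> 1 / real n \<le> \<rho>"
    then have n: "0 < n" and \<rho>: "0 < \<rho>" "1 / n \<le> \<rho>" by auto
    let ?lam = "c * sqrt (\<rho> * real n)"
    let ?s = "sqrt (\<rho> / n)"
    have lam: "0 < ?lam" using c \<rho> n by simp
    have lam_n: "?lam / n = c * ?s"
    proof -
      have "sqrt (\<rho> * n) / n = sqrt (\<rho> * n / (real n)\<^sup>2)" by (simp add: real_sqrt_divide)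
      also have "\<rho> * n / (real n)\<^sup>2 = \<rho> / n" by (simp add: power2_eq_square)
      finally show ?thesis by (simp only: times_divide_eq_right[symmetric])
    qed
    let ?R = "\<lambda>F. LINT A|graph_law n \<rho> W0. cut_dist (empirical_graphon n (F A)) (\<lambda>x y. min (\<rho> * W0 x y) 1)"
    let ?W = "\<lambda>x y. inverse \<rho> * min (\<rho> * W0 x y) 1"
    have A: "sparse_graphon W0 p \<rho> n (\<lambda>A. A) 0" and T: "sparse_graphon W0 p \<rho> n (hard_threshold n ?lam) (c * ?s)"
      if "W0 \<in> Lp_graphons p" "integrable_kernel W0" "L1_norm W0 = 1" for p
    proof -
      have "cut_norm (\<lambda>x y. empirical_graphon n A x y - empirical_graphon n A x y) \<le> 0" for A
        using cut_norm_empirical_le[OF n, of A A 0] by simp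
      then show "sparse_graphon W0 p \<rho> n (\<lambda>A. A) 0"
        using that n \<rho> by unfold_locales auto
      show "sparse_graphon W0 p \<rho> n (hard_threshold n ?lam) (c * ?s)"
        using that n \<rho> c cut_norm_hard_threshold[OF _ n lam] by unfold_locales (auto simp: lam_n)
    qed
    have absorb: "R \<le> X + (c + 14) * (t + ?s)"
      if "R \<le> X + (\<kappa> + 8 * ?s + 14 * t)" "\<kappa> \<le> c * ?s" "0 \<le> t" for R X \<kappa> t
    proof -
      have "0 \<le> ?s" "0 \<le> c * t" using \<rho> c that(3) by simp_all
      moreover have "(c + 14) * (t + ?s) = c * t + c * ?s + 14 * t + 14 * ?s" by (simp add: algebra_simps)
      ultimately show ?thesis using that by linarith
    qed
    show "?claim c (c + 14) n \<rho> W0"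
      unfolding Let_def
    proof (intro conjI impI allI)
      fix \<mu> :: real and k :: nat
      assume W0: "W0 \<in> Lp_graphons 1 \<and> L1_norm W0 = 1" and \<mu>: "0 < \<mu> \<and> \<mu> \<le> 1 \<and> 0 < k \<and> real k \<le> \<mu> * real n"
      then have k: "integrable_kernel W0" by (simp add: kernel_Lp1)
      have t: "0 \<le> \<rho> * sqrt (real k / (\<mu> * real n))" using \<rho> \<mu> by simp
      show "?R (\<lambda>A. A)
        \<le> 2 * \<rho> * (INF W\<in>balanced_step_graphons 1 k \<mu>. L1_dist W ?W)
          + (c + 14) * (\<rho> * sqrt (real k / (\<mu> * real n)) + ?s)"
        using sparse_graphon.risk_balanced_INF[OF A[of 1], of \<mu> k] sparse_graphon.W0'_eq[OF A[of 1]] W0 \<mu> k c \<rho>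
        by (intro absorb[OF _ _ t, of _ _ 0]) (simp_all add: mult.assoc)
      show "?R (hard_threshold n ?lam)
        \<le> 2 * \<rho> * (INF W\<in>balanced_step_graphons 1 k \<mu>. L1_dist W ?W)
          + (c + 14) * (\<rho> * sqrt (real k / (\<mu> * real n)) + ?s)"
        using sparse_graphon.risk_balanced_INF[OF T[of 1], of \<mu> k] sparse_graphon.W0'_eq[OF T[of 1]] W0 \<mu> k c \<rho>
        by (intro absorb[OF _ _ t, of _ _ "c * ?s"]) (simp_all add: mult.assoc)
    next
      fix k :: nat
      assume W0: "W0 \<in> Lp_graphons 2 \<and> L1_norm W0 = 1" and k: "0 < k \<and> k \<le> n"
      then have i: "integrable_kernel W0" by (simp add: kernel_Lp2)
      have t: "0 \<le> \<rho> * L2_norm W0 * sqrt (real k / real n)" using \<rho> by (simp add: L2_norm_def case_prod_beta')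
      show "?R (\<lambda>A. A)
        \<le> 2 * \<rho> * (INF W\<in>step_graphons 2 k. L2_dist W ?W)
          + (c + 14) * (\<rho> * L2_norm W0 * sqrt (real k / real n) + ?s)"
        using sparse_graphon.risk_square_INF[OF A[of 2], of k] sparse_graphon.W0'_eq[OF A[of 2]] W0 i k c \<rho>
        by (intro absorb[OF _ _ t, of _ _ 0]) (simp_all add: mult.assoc)
      show "?R (hard_threshold n ?lam)
        \<le> 2 * \<rho> * (INF W\<in>step_graphons 2 k. L2_dist W ?W)
          + (c + 14) * (\<rho> * L2_norm W0 * sqrt (real k / real n) + ?s)"
        using sparse_graphon.risk_square_INF[OF T[of 2], of k] sparse_graphon.W0'_eq[OF T[of 2]] W0 i k c \<rho>
        by (intro absorb[OF _ _ t, of _ _ "c * ?s"]) (simp_all add: mult.assoc)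
    qed
  qed
qed

end
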